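(* Let $p>3$ be a prime. (i) If $p\equiv 1\pmod 3$ and $p=x^2+3y^2$ with $x,y\in\mathbb{Z}$, then $$\sum_{k=0}^{p-1}k^2\frac{D_k}{4^k}\equiv\frac{16}{9}x^2-\frac{8p}{9}-\frac{7p^2}{18x^2}\pmod{p^3}$$ and $$\sum_{k=0}^{p-1}k^2\frac{D_k}{16^k}\equiv\frac{4}{9}x^2-\frac{2p}{9}-\frac{p^2}{18x^2}\pmod{p^3}.$$ (ii) If $p\equiv 2\pmod 3$, then $$\sum_{k=0}^{p-1}k^2\frac{D_k}{4^k}\equiv-\frac{20}{9}R_3(p)\pmod{p^2},\qquad \sum_{k=0}^{p-1}k^2\frac{D_k}{16^k}\equiv\frac{4}{9}R_3(p)\pmod{p^2},$$ and $$\sum_{k=0}^{p-1}k\frac{D_k}{4^k}\equiv-\sum_{k=0}^{p-1}k\frac{D_k}{16^k}\equiv\frac{4}{3}R_3(p)\pmod{p^2}.$$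
   Context: For $n\ge 0$ the $n$th Domb number is $D_n=\sum_{k=0}^n\binom{n}{k}^2\binom{2k}{k}\binom{2n-2k}{n-k}$. For a prime $p>3$, $$R_3(p)=\left(1+2p+\frac43\left(2^{p-1}-1\right)-\frac32\left(3^{p-1}-1\right)\right)\binom{\frac{p-1}{2}}{\lfloor p/6\rfloor}^2.$$ Congruences modulo $p^r$ between rational numbers mean that the difference lies in $p^r\mathbb{Z}_{p}$, where $\mathbb{Z}_p$ is the ring of $p$-adic integers. *)

theory Defs
  imports Complex_Main "HOL-Number_Theory.Cong"
begin

definition domb :: "nat \<Rightarrow> nat" where
  "domb n = (\<Sum>k = 0..n. (n choose k)\<^sup>2 * ((2 * k) choose k) * ((2 * n - 2 * k) choose (n - k)))"

(* p is odd in all uses, so (p - 1) div 2 is exact; p div 6 is the floor of p/6. *)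
definition R3 :: "nat \<Rightarrow> rat" where
  "R3 p = (1 + 2 * of_nat p + 4 / 3 * (2 ^ (p - 1) - 1) - 3 / 2 * (3 ^ (p - 1) - 1))
            * (of_nat (((p - 1) div 2) choose (p div 6)))\<^sup>2"

(* The rational p-adic integers, i.e. the intersection of Z_p with the rationals, for prime p.
   A denominator b not divisible by p is automatically nonzero. *)
definition padic_integer_rats :: "nat \<Rightarrow> rat set" where
  "padic_integer_rats p = {of_int a / of_int b | a b :: int. \<not> int p dvd b}"

(* Congruence of rationals modulo p^r: the difference lies in p^r Z_p. As the difference is
   rational, this only involves the rational elements of Z_p. *)
definition rat_cong :: "nat \<Rightarrow> nat \<Rightarrow> rat \<Rightarrow> rat \<Rightarrow> bool" where
  "rat_cong p r u v \<longleftrightarrow> (\<exists>z \<in> padic_integer_rats p. u - v = of_nat p ^ r * z)"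

end

theory Submission
  imports Defs "HOL-Number_Theory.Number_Theory"
begin

text \<open>
Write \<open>S\<^sub>j(c)\<close> for the sum of \<open>k ^ j * D\<^sub>k / c ^ k\<close> over \<open>k < p\<close>, where \<open>c\<close> is 4 or 16. The
proof is elementary: it turns these sums into products of Pochhammer symbols, and compares
the products with a cubic character sum when \<open>p \<equiv> 1 (mod 3)\<close> and with Fermat quotients when
\<open>p \<equiv> 2 (mod 3)\<close>.

\<^item> \<^emph>\<open>Removing the square.\<close> The three-term recurrence of the Domb numbers makes two quadratically
  weighted sums telescope to \<open>p\<^sup>3\<close> times a \<open>p\<close>-integral number
  (\<open>domb_weighted_sum_4\<close>, \<open>domb_weighted_sum_16\<close>). Hence \<open>S\<^sub>2(c)\<close> is a combination of
  \<open>S\<^sub>1(c)\<close> and \<open>S\<^sub>0(c)\<close> modulo \<open>p\<^sup>3\<close>.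

\<^item> \<^emph>\<open>Hypergeometric form.\<close> The Domb numbers are sums of \<open>binom(2k,k)\<^sup>2 binom(3k,k)\<close> times
  \<open>binom(n+k,3k)\<close> or \<open>binom(n+2k,3k)\<close> (\<open>domb_eq_term4\<close>, \<open>domb_eq_term16\<close>), because these sums
  satisfy the same recurrence. Summing over \<open>n < p\<close> first gives
  \<open>S\<^sub>0 = p * \<Sum>k<p. T (\<plusminus>p) k / (3 k + 1)\<close>, and \<open>S\<^sub>1\<close> also involves the denominators \<open>3 k + 2\<close>.

\<^item> \<^emph>\<open>One critical denominator.\<close> For \<open>k < p / 2\<close> one has \<open>T (\<plusminus>p) k = v k * rho k\<close>, where \<open>v k\<close> is
  the weight of a balanced terminating \<open>\<^sub>3F\<^sub>2\<close> series and \<open>rho k \<equiv> 1 (mod p\<^sup>2)\<close>. The factor \<open>rho\<close>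
  therefore matters modulo \<open>p\<^sup>3\<close> only at the single index whose denominator is divisible by \<open>p\<close>
  (\<open>weighted_sum_cong\<close>), and the remaining sum is a product by Saalschuetz's theorem
  (\<open>saalschutz_partial_fractions\<close>).

\<^item> \<^emph>\<open>The products.\<close> Reflecting factorials at \<open>p\<close> leaves the square of a binomial coefficient times
  products of factors \<open>1 + e p / j\<close>. Modulo \<open>p\<^sup>3\<close> such products are truncated exponentials
  of harmonic sums, so identities between them become linear relations between
  harmonic numbers.

\<^item> \<^emph>\<open>The case \<open>p = 6 m + 1\<close>.\<close> Both \<open>S\<^sub>0(4)\<close> and \<open>S\<^sub>0(16)\<close> are congruent to \<open>J\<^sup>2\<close>, where
  \<open>J = - C * E lam\<close> and \<open>C = binom(3m,m)\<close>. On the other side stand the sums \<open>S r\<close> of Legendre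
  symbols of \<open>t\<^sup>3 + r\<close>: orthogonality gives \<open>(S 1)\<^sup>2 = 4 x\<^sup>2\<close> (\<open>Sa_square\<close>). A quintic polynomial
  represents the Legendre symbol modulo \<open>p\<^sup>3\<close>, and replacing \<open>t\<close> by \<open>t ^ p\<^sup>2\<close> turns the power
  sums into sums over roots of unity modulo \<open>p\<^sup>3\<close>. This gives \<open>8 * S 1 \<equiv> Y1 + Y2\<close> and
  \<open>Y1 * Y2 \<equiv> 64 * p\<close> with explicit sums of binomial coefficients (\<open>Y_relations\<close>), and
  \<open>Y1 \<equiv> 8 * J\<close>. Hence \<open>4 x\<^sup>2 \<equiv> (J + p / J)\<^sup>2\<close>, that is
  \<open>J\<^sup>2 \<equiv> 4 x\<^sup>2 - 2 p - p\<^sup>2 / (4 x\<^sup>2)\<close>.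

\<^item> \<^emph>\<open>The case \<open>p = 6 d + 5\<close>.\<close> Here \<open>p\<^sup>2\<close> divides \<open>S\<^sub>0(c)\<close>, and \<open>S\<^sub>1(c)\<close> comes from the denominators
  \<open>3 k + 2\<close>. Modulo \<open>p\<^sup>2\<close> it is a squared binomial coefficient times \<open>\<plusminus>4 / 3\<close> times a factor
  \<open>1 + p * l\<close>, where \<open>l\<close> is a combination of two harmonic numbers. These are the Fermat
  quotients of 2 and 3 in disguise, which produces \<open>R3 p\<close>.
\<close>

section \<open>The recurrence of the Domb numbers\<close>

definition domb_summand :: "nat \<Rightarrow> nat \<Rightarrow> rat" where
  "domb_summand n k = (of_nat (n choose k))\<^sup>2 * of_nat ((2 * k) choose k)
     * of_nat ((2 * (n - k)) choose (n - k))"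

lemma domb_eq_sum: "(of_nat (domb n) :: rat) = (\<Sum>k\<le>n. domb_summand n k)"
  by (auto simp: domb_def domb_summand_def atMost_atLeast0 diff_mult_distrib2 intro!: sum.cong)

lemma central_choose_Suc:
  "of_nat (Suc k) * (of_nat ((2 * Suc k) choose Suc k) :: rat)
     = 2 * (2 * of_nat k + 1) * of_nat ((2 * k) choose k)"
proof -
  have 1: "Suc k * ((2 * Suc k) choose Suc k) = 2 * Suc k * ((2 * k + 1) choose k)"
    using Suc_times_binomial_eq[of "2 * k + 1" k] by (simp add: mult.commute)
  have 2: "Suc k * ((2 * k + 1) choose k) = (2 * k + 1) * ((2 * k) choose k)"
    using binomial_absorb_comp[of "2 * k + 1" k] by simp
  have "Suc k * (Suc k * ((2 * Suc k) choose Suc k)) = Suc k * (2 * (2 * k + 1) * ((2 * k) choose k))"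
    unfolding 1 using 2 by (metis mult.assoc mult.left_commute)
  then have "Suc k * ((2 * Suc k) choose Suc k) = 2 * (2 * k + 1) * ((2 * k) choose k)"
    by (metis Suc_neq_Zero mult_cancel1)
  from arg_cong[OF this, of "of_nat :: nat \<Rightarrow> rat"] show ?thesis
    by (simp del: mult_Suc_right binomial_Suc_Suc add: algebra_simps)
qed

text \<open>The summand is hypergeometric in both variables; this ratio and the next are stated with
denominators cleared, so that they can be used as polynomial relations.\<close>
lemma domb_summand_Suc_n:
  assumes "k \<le> n"
  shows "(of_nat n + 1 - of_nat k) ^ 3 * domb_summand (Suc n) k
     = 2 * (of_nat n + 1)\<^sup>2 * (2 * (of_nat n - of_nat k) + 1) * domb_summand n k"
proof -
  obtain j where n: "n = k + j" using assms le_Suc_ex by blast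
  have 1: "(of_nat j + 1) * (of_nat (Suc n choose k) :: rat) = (of_nat n + 1) * of_nat (n choose k)"
  proof -
    have "Suc j * (Suc n choose k) = Suc n * (n choose k)"
      using binomial_absorb_comp[of "Suc n" k] by (simp add: n Suc_diff_le)
    from arg_cong[OF this, of "of_nat :: nat \<Rightarrow> rat"] show ?thesis
      by (simp del: binomial_Suc_Suc add: algebra_simps)
  qed
  have 2: "(of_nat j + 1) * (of_nat ((2 * Suc j) choose Suc j) :: rat)
     = 2 * (2 * of_nat j + 1) * of_nat ((2 * j) choose j)"
    using central_choose_Suc[of j] by (simp only: of_nat_Suc add.commute)
  have e: "Suc n - k = Suc j" "n - k = j" "of_nat n + 1 - of_nat k = (of_nat j + 1 :: rat)"
     "of_nat n - of_nat k = (of_nat j :: rat)"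
    by (auto simp: n)
  have "(of_nat j + 1) ^ 3 * domb_summand (Suc n) k
      = ((of_nat j + 1) * of_nat (Suc n choose k))\<^sup>2 * of_nat ((2 * k) choose k)
         * ((of_nat j + 1) * of_nat ((2 * Suc j) choose Suc j))"
    unfolding domb_summand_def e by (simp only: power2_eq_square power3_eq_cube mult_ac)
  also have "\<dots> = 2 * (of_nat n + 1)\<^sup>2 * (2 * of_nat j + 1) * domb_summand n k"
    unfolding domb_summand_def e 1 2 by (simp only: power2_eq_square power3_eq_cube mult_ac)
  finally show ?thesis unfolding e .
qed

lemma domb_summand_Suc_k:
  assumes "k < n"
  shows "(of_nat k + 1) ^ 3 * (2 * (of_nat n - of_nat k) - 1) * domb_summand n (Suc k)
     = (of_nat n - of_nat k) ^ 3 * (2 * of_nat k + 1) * domb_summand n k"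
proof -
  obtain j where n: "n = k + Suc j" using assms less_imp_Suc_add by fastforce
  have 1: "(of_nat k + 1) * (of_nat (n choose Suc k) :: rat) = (of_nat j + 1) * of_nat (n choose k)"
  proof -
    have "Suc k * (n choose Suc k) = Suc j * (n choose k)"
      using binomial_absorption[of k n] binomial_absorb_comp[of n k] by (simp add: n)
    from arg_cong[OF this, of "of_nat :: nat \<Rightarrow> rat"] show ?thesis
      by (simp del: binomial_Suc_Suc add: algebra_simps)
  qed
  have 2: "(of_nat j + 1) * (of_nat ((2 * Suc j) choose Suc j) :: rat)
     = 2 * (2 * of_nat j + 1) * of_nat ((2 * j) choose j)"
    "(of_nat k + 1) * (of_nat ((2 * Suc k) choose Suc k) :: rat)
     = 2 * (2 * of_nat k + 1) * of_nat ((2 * k) choose k)"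
    using central_choose_Suc[of j] central_choose_Suc[of k] by (simp_all only: of_nat_Suc add.commute)
  have e: "n - Suc k = j" "n - k = Suc j" "of_nat n - of_nat k = (of_nat j + 1 :: rat)"
     "2 * (of_nat j + 1) - 1 = (2 * of_nat j + 1 :: rat)"
    by (auto simp: n)
  have "2 * ((of_nat k + 1) ^ 3 * (2 * of_nat j + 1) * domb_summand n (Suc k))
     = ((of_nat k + 1) * of_nat (n choose Suc k))\<^sup>2
        * ((of_nat k + 1) * (of_nat ((2 * Suc k) choose Suc k)))
        * (2 * (2 * of_nat j + 1) * of_nat ((2 * j) choose j))"
    unfolding domb_summand_def e by (simp only: power2_eq_square power3_eq_cube mult_ac)
  also have "\<dots> = 2 * ((of_nat j + 1) ^ 3 * (2 * of_nat k + 1) * domb_summand n k)"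
    unfolding domb_summand_def e 1 2(1)[symmetric] 2(2)
    by (simp only: power2_eq_square power3_eq_cube mult_ac)
  finally show ?thesis unfolding e by simp
qed

text \<open>Numerator of the rational certificate found by Zeilberger's algorithm: the recurrence operator
applied to the summand \<open>F n k\<close> is \<open>G n (k + 1) - G n k\<close> with
\<open>G n (k + 1) = (2 k + 1) * domb_cert n (k + 1) * F n k / (n - k + 1) ^ 3\<close>.\<close>
definition domb_cert :: "rat \<Rightarrow> rat \<Rightarrow> rat" where
  "domb_cert n k = 16 * (n + 1)\<^sup>2 * k ^ 3 - (72 * n ^ 3 + 264 * n\<^sup>2 + 312 * n + 120) * k\<^sup>2
     + (104 * n ^ 4 + 564 * n ^ 3 + 1112 * n\<^sup>2 + 948 * n + 296) * k
     - (48 * n ^ 5 + 344 * n ^ 4 + 960 * n ^ 3 + 1304 * n\<^sup>2 + 864 * n + 224)"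

text \<open>The telescoping property after dividing by the summand. The variable \<open>j = n - k\<close> keeps the
factors coming from the shifts in \<open>n\<close> small.\<close>
lemma cert_poly:
  fixes j k n :: rat
  assumes "n = k + j"
  shows "(n + 2) ^ 3 * 4 * (n + 1)\<^sup>2 * (n + 2)\<^sup>2 * (2 * j + 1) * (2 * j + 3)
     - 2 * (2 * n + 3) * (5 * n\<^sup>2 + 15 * n + 12) * 2 * (n + 1)\<^sup>2 * (2 * j + 1) * (j + 2) ^ 3
     + 64 * (n + 1) ^ 3 * (j + 1) ^ 3 * (j + 2) ^ 3
     = (2 * k + 1) * (j + 2) ^ 3 * domb_cert n (k + 1) - k ^ 3 * (2 * j + 1) * domb_cert n k"
  unfolding assms domb_cert_def by Groebner_Basis.algebra

text \<open>The operator whose kernel contains the Domb numbers; it is applied both to the numbers themselves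
and, with \<open>k\<close> fixed, to summands of their expansions.\<close>
definition domb_op :: "(nat \<Rightarrow> rat) \<Rightarrow> nat \<Rightarrow> rat" where
  "domb_op f n = (of_nat n + 2) ^ 3 * f (Suc (Suc n))
     - 2 * (2 * of_nat n + 3) * (5 * (of_nat n)\<^sup>2 + 15 * of_nat n + 12) * f (Suc n)
     + 64 * (of_nat n + 1) ^ 3 * f n"

lemma domb_op_summand:
  assumes "k \<le> n"
  defines "j \<equiv> (of_nat n - of_nat k :: rat)"
  shows "(j + 1) ^ 3 * (j + 2) ^ 3 * domb_op (\<lambda>n. domb_summand n k) n
    = ((2 * of_nat k + 1) * (j + 2) ^ 3 * domb_cert (of_nat n) (of_nat k + 1)
        - (of_nat k) ^ 3 * (2 * j + 1) * domb_cert (of_nat n) (of_nat k)) * domb_summand n k"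
proof -
  have 1: "(j + 1) ^ 3 * domb_summand (Suc n) k = 2 * (of_nat n + 1)\<^sup>2 * (2 * j + 1) * domb_summand n k"
    using domb_summand_Suc_n[OF assms(1)] by (simp add: j_def algebra_simps)
  have 2: "(j + 2) ^ 3 * domb_summand (Suc (Suc n)) k
      = 2 * (of_nat n + 2)\<^sup>2 * (2 * j + 3) * domb_summand (Suc n) k"
    using domb_summand_Suc_n[of k "Suc n"] assms(1) by (simp add: j_def algebra_simps)
  have n: "of_nat n = of_nat k + j" by (simp add: j_def)
  show ?thesis
    unfolding cert_poly[OF n, symmetric] domb_op_def using 1 2 by Groebner_Basis.algebra
qed

text \<open>Partial sums up to \<open>K \<le> n\<close> stay in the range where the ratios of consecutive summands are
regular; the two summands beyond \<open>n\<close> are added separately in the recurrence below.\<close>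
lemma domb_telescope:
  assumes "K \<le> n"
  shows "(of_nat n - of_nat K + 1) ^ 3 * (\<Sum>k\<le>K. domb_op (\<lambda>n. domb_summand n k) n)
     = (2 * of_nat K + 1) * domb_cert (of_nat n) (of_nat K + 1) * domb_summand n K"
  using assms
proof (induction K)
  case 0
  have "of_nat n + 2 \<noteq> (0 :: rat)" by (metis of_nat_0_eq_iff of_nat_add of_nat_numeral add_is_0 zero_neq_numeral)
  with domb_op_summand[of 0 n] show ?case by simp
next
  case (Suc K)
  define j :: rat where "j = of_nat n - of_nat (Suc K)"
  have j: "j \<ge> 0" using Suc.prems unfolding j_def by (metis diff_ge_0_iff_ge of_nat_le_iff)
  let ?S = "\<Sum>k\<le>K. domb_op (\<lambda>n. domb_summand n k) n" and ?K = "of_nat K + 1 :: rat"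
  have e: "of_nat (Suc K) = ?K" "of_nat n - of_nat K + 1 = j + 2" "of_nat n - of_nat K = j + 1"
    by (auto simp: j_def)
  have IH: "(j + 2) ^ 3 * ?S = (2 * of_nat K + 1) * domb_cert (of_nat n) ?K * domb_summand n K"
    using Suc e(2) by simp
  have r: "?K ^ 3 * (2 * j + 1) * domb_summand n (Suc K) = (j + 1) ^ 3 * (2 * of_nat K + 1) * domb_summand n K"
    using domb_summand_Suc_k[of K n] Suc.prems unfolding e(3) by (simp add: algebra_simps)
  have o: "(j + 1) ^ 3 * (j + 2) ^ 3 * domb_op (\<lambda>n. domb_summand n (Suc K)) n
    = ((2 * ?K + 1) * (j + 2) ^ 3 * domb_cert (of_nat n) (?K + 1)
        - ?K ^ 3 * (2 * j + 1) * domb_cert (of_nat n) ?K) * domb_summand n (Suc K)"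
    using domb_op_summand[OF Suc.prems] unfolding e(1) j_def .
  have "(j + 2) ^ 3 * ((j + 1) ^ 3 * (?S + domb_op (\<lambda>n. domb_summand n (Suc K)) n))
      = (j + 2) ^ 3 * ((2 * ?K + 1) * domb_cert (of_nat n) (?K + 1) * domb_summand n (Suc K))"
    using IH r o by Groebner_Basis.algebra
  moreover have "(j + 2) ^ 3 \<noteq> 0" using j by simp
  ultimately have "(j + 1) ^ 3 * (?S + domb_op (\<lambda>n. domb_summand n (Suc K)) n)
      = (2 * ?K + 1) * domb_cert (of_nat n) (?K + 1) * domb_summand n (Suc K)"
    using mult_left_cancel by blast
  moreover have "of_nat n - of_nat (Suc K) + 1 = j + 1" by (simp add: j_def)
  ultimately show ?case by (simp only: e(1) sum.atMost_Suc)
qed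

text \<open>The telescoped sum leaves the boundary term at \<open>k = n\<close>. It cancels against the
summands with index \<open>n + 1\<close> and \<open>n + 2\<close>, all of which are rational multiples of one
central binomial coefficient.\<close>
lemma domb_recurrence: "domb_op (\<lambda>n. of_nat (domb n)) n = 0"
proof -
  let ?F = domb_summand and ?n = "of_nat n :: rat"
  have cc: "of_nat (Suc k) * ?F m m = 2 * (2 * of_nat k + 1) * ?F k k" if "m = Suc k" for k m
    using central_choose_Suc[of k] unfolding that domb_summand_def by simp
  have T: "(\<Sum>k\<le>n. domb_op (\<lambda>n. ?F n k) n) = (2 * ?n + 1) * domb_cert ?n (?n + 1) * ?F n n"
    using domb_telescope[of n n] by simp
  have b: "?F (Suc (Suc n)) (Suc n) = 2 * (?n + 2)\<^sup>2 * ?F (Suc n) (Suc n)"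
    by (simp add: domb_summand_def numeral_2_eq_2[symmetric] power_mult_distrib)
  have "domb_op (\<lambda>n. of_nat (domb n)) n = (\<Sum>k\<le>n. domb_op (\<lambda>n. ?F n k) n)
     + (?n + 2) ^ 3 * (?F (Suc (Suc n)) (Suc n) + ?F (Suc (Suc n)) (Suc (Suc n)))
     - 2 * (2 * ?n + 3) * (5 * ?n\<^sup>2 + 15 * ?n + 12) * ?F (Suc n) (Suc n)"
    unfolding domb_op_def domb_eq_sum
    by (simp add: sum.distrib sum_subtractf flip: sum_distrib_left) (simp add: algebra_simps)
  then have "(?n + 1) * domb_op (\<lambda>n. of_nat (domb n)) n = 0"
    unfolding T b domb_cert_def
    using cc[of "Suc n" n] cc[of "Suc (Suc n)" "Suc n"] unfolding of_nat_Suc by Groebner_Basis.algebra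
  moreover have "?n + 1 \<noteq> 0" by (metis of_nat_Suc of_nat_eq_0_iff add.commute nat.distinct(1))
  ultimately show ?thesis by simp
qed

section \<open>Two expansions of the Domb numbers\<close>

text \<open>The leading coefficient \<open>(n + 2) ^ 3\<close> never vanishes, so two initial values determine
a solution.\<close>
lemma domb_op_unique:
  assumes "\<And>n. domb_op f n = 0" "\<And>n. domb_op g n = 0" "f 0 = g 0" "f 1 = g 1"
  shows "f n = g n"
proof (induction n rule: less_induct)
  case (less n)
  consider "n = 0" | "n = 1" | m where "n = Suc (Suc m)"
    by (metis One_nat_def not0_implies_Suc)
  then show ?case
  proof cases
    case 3
    have "(of_nat m + 2 :: rat) \<noteq> 0"
      by (metis of_nat_0_eq_iff of_nat_add of_nat_numeral add_is_0 zero_neq_numeral)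
    moreover have "f m = g m" "f (Suc m) = g (Suc m)"
      using less(1) 3 by simp_all
    then have "(of_nat m + 2) ^ 3 * f n = (of_nat m + 2) ^ 3 * g n"
      using assms(1)[of m] assms(2)[of m] unfolding domb_op_def 3 by (metis add_right_cancel diff_add_cancel)
    ultimately show ?thesis by (meson mult_left_cancel power_not_zero)
  qed (use assms in auto)
qed

definition Gk :: "nat \<Rightarrow> rat" where
  "Gk k = (of_nat ((2 * k) choose k))\<^sup>2 * of_nat ((3 * k) choose k)"

lemma choose_Suc_rat:
  "of_nat (r + 1) * (of_nat (N choose (r + 1)) :: rat) = (of_nat N - of_nat r) * of_nat (N choose r)"
proof (cases "r \<le> N")
  case True
  have "(r + 1) * (N choose (r + 1)) = (N - r) * (N choose r)"
    using binomial_absorption[of r N] binomial_absorb_comp[of N r] by simp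
  from arg_cong[OF this, of "of_nat :: nat \<Rightarrow> rat"] show ?thesis
    using True by (simp only: of_nat_mult of_nat_diff)
next
  case False
  then show ?thesis by (cases "N choose r = 0") (simp_all add: binomial_eq_0)
qed

lemma Suc_choose_Suc_rat:
  "of_nat (r + 1) * (of_nat ((N + 1) choose (r + 1)) :: rat) = of_nat (N + 1) * of_nat (N choose r)"
  using arg_cong[OF Suc_times_binomial_eq[of N r], of "of_nat :: nat \<Rightarrow> rat"]
  by (simp only: of_nat_mult Suc_eq_plus1 mult.commute[of _ "of_nat (r + 1)"])

text \<open>Expressing three neighbouring binomial coefficients through the one with lower index \<open>3 K + 1\<close>
keeps all the relations polynomial, also where the coefficients vanish.\<close>
lemma choose_step3:
  fixes N K :: nat
  defines "B \<equiv> (of_nat (N choose (3 * K + 1)) :: rat)" and "k \<equiv> (of_nat K :: rat)"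
    and "x \<equiv> (of_nat N :: rat)"
  shows "(3 * k + 2) * (3 * k + 3) * of_nat (N choose (3 * Suc K)) = (x - 3 * k - 1) * (x - 3 * k - 2) * B"
    and "(3 * k + 2) * (3 * k + 3) * of_nat ((N + 1) choose (3 * Suc K)) = (x + 1) * (x - 3 * k - 1) * B"
    and "(3 * k + 2) * (3 * k + 3) * of_nat ((N + 2) choose (3 * Suc K)) = (x + 2) * (x + 1) * B"
proof -
  have 1: "(3 * k + 2) * of_nat (N choose (3 * K + 2)) = (x - 3 * k - 1) * B"
    using choose_Suc_rat[of "3 * K + 1" N] unfolding B_def k_def x_def by (simp add: algebra_simps)
  have 2: "(3 * k + 3) * of_nat (N choose (3 * K + 3)) = (x - 3 * k - 2) * of_nat (N choose (3 * K + 2))"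
    using choose_Suc_rat[of "3 * K + 2" N] unfolding k_def x_def by (simp add: algebra_simps eval_nat_numeral)
  have 3: "(3 * k + 3) * of_nat ((N + 1) choose (3 * K + 3)) = (x + 1) * of_nat (N choose (3 * K + 2))"
    using Suc_choose_Suc_rat[of "3 * K + 2" N] unfolding k_def x_def
    by (simp add: algebra_simps eval_nat_numeral del: binomial_Suc_Suc)
  have 4: "(3 * k + 2) * of_nat ((N + 1) choose (3 * K + 2)) = (x + 1) * B"
    using Suc_choose_Suc_rat[of "3 * K + 1" N] unfolding k_def x_def B_def
    by (simp add: algebra_simps eval_nat_numeral del: binomial_Suc_Suc)
  have 5: "(3 * k + 3) * of_nat ((N + 2) choose (3 * K + 3)) = (x + 2) * of_nat ((N + 1) choose (3 * K + 2))"
    using Suc_choose_Suc_rat[of "3 * K + 2" "N + 1"] unfolding k_def x_def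
    by (simp add: algebra_simps eval_nat_numeral del: binomial_Suc_Suc)
  have e: "3 * Suc K = 3 * K + 3" by simp
  show "(3 * k + 2) * (3 * k + 3) * of_nat (N choose (3 * Suc K)) = (x - 3 * k - 1) * (x - 3 * k - 2) * B"
    unfolding e using 1 2 by Groebner_Basis.algebra
  show "(3 * k + 2) * (3 * k + 3) * of_nat ((N + 1) choose (3 * Suc K)) = (x + 1) * (x - 3 * k - 1) * B"
    unfolding e using 1 3 by Groebner_Basis.algebra
  show "(3 * k + 2) * (3 * k + 3) * of_nat ((N + 2) choose (3 * Suc K)) = (x + 2) * (x + 1) * B"
    unfolding e using 4 5 by Groebner_Basis.algebra
qed

lemma Gk_fact: "Gk k * fact k ^ 5 = fact (2 * k) * fact (3 * k)"
proof -
  have 1: "fact k * fact k * of_nat ((2 * k) choose k) = (fact (2 * k) :: rat)"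
    using arg_cong[OF binomial_fact_lemma[of k "2 * k"], of "of_nat :: nat \<Rightarrow> rat"] by simp
  have 2: "fact k * fact (2 * k) * of_nat ((3 * k) choose k) = (fact (3 * k) :: rat)"
    using arg_cong[OF binomial_fact_lemma[of k "3 * k"], of "of_nat :: nat \<Rightarrow> rat"] by simp
  have "fact (2 * k) * (Gk k * fact k ^ 5) = (fact (2 * k) :: rat) * (fact (2 * k) * fact (3 * k))"
    unfolding Gk_def 1[symmetric] 2[symmetric] by (simp add: eval_nat_numeral algebra_simps del: fact_Suc binomial_Suc_Suc)
  then show ?thesis by simp
qed

lemma Gk_Suc: "Gk (Suc k) * (of_nat k + 1) ^ 3
    = 6 * (2 * of_nat k + 1) * (3 * of_nat k + 1) * (3 * of_nat k + 2) * Gk k"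
proof -
  have f: "fact (2 * Suc k) = (2 * of_nat k + 2) * (2 * of_nat k + 1) * (fact (2 * k) :: rat)"
    "fact (3 * Suc k) = (3 * of_nat k + 3) * (3 * of_nat k + 2) * (3 * of_nat k + 1) * (fact (3 * k) :: rat)"
    "fact (Suc k) = (of_nat k + 1) * (fact k :: rat)"
    by (simp_all add: algebra_simps numeral_3_eq_3)
  have "(of_nat k + 1) ^ 2 * fact k ^ 5 * (Gk (Suc k) * (of_nat k + 1) ^ 3)
      = (of_nat k + 1) ^ 2 * fact k ^ 5 * (6 * (2 * of_nat k + 1) * (3 * of_nat k + 1) * (3 * of_nat k + 2) * Gk k)"
    using Gk_fact[of k] Gk_fact[of "Suc k"] unfolding f by Groebner_Basis.algebra
  moreover have "(of_nat k + 1) ^ 2 * fact k ^ 5 \<noteq> (0 :: rat)"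
    by (metis fact_nonzero mult_eq_0_iff of_nat_Suc of_nat_eq_0_iff add.commute nat.distinct(1) power_not_zero)
  ultimately show ?thesis using mult_left_cancel by blast
qed

definition term4 :: "nat \<Rightarrow> nat \<Rightarrow> rat" where
  "term4 n k = Gk k * of_nat ((n + k) choose (3 * k)) * 4 ^ n / 16 ^ k"

definition term16 :: "nat \<Rightarrow> nat \<Rightarrow> rat" where
  "term16 n k = Gk k * of_nat ((n + 2 * k) choose (3 * k)) * 16 ^ n / (- 16) ^ k"

text \<open>The inductive step of the telescoping below, with the binomial coefficients replaced by
variables that satisfy the relations between neighbours. Multiplying by the common denominator
turns it into a polynomial identity.\<close>
lemma step4_poly:
  fixes n k g0 g1 B b0 b1 b2 bm q :: rat
  assumes "g1 * (k + 1) ^ 3 = 6 * (2 * k + 1) * (3 * k + 1) * (3 * k + 2) * g0"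
    and "(3 * k + 2) * (3 * k + 3) * b0 = (n - 2 * k) * (n - 2 * k - 1) * B"
    and "(3 * k + 2) * (3 * k + 3) * b1 = (n + k + 2) * (n - 2 * k) * B"
    and "(3 * k + 2) * (3 * k + 3) * b2 = (n + k + 3) * (n + k + 2) * B"
    and "(n + k + 1) * bm = (3 * k + 1) * B"
    and k: "k \<ge> 0"
  shows "- 24 * (3 * n + 4) * (2 * k + 1) * (n + k + 1) * (g0 * bm * (16 * q))
     + ((n + 2) ^ 3 * (g1 * b2 * (16 * q)) - 2 * (2 * n + 3) * (5 * n\<^sup>2 + 15 * n + 12) * (g1 * b1 * (4 * q))
         + 64 * (n + 1) ^ 3 * (g1 * b0 * q))
     = - 24 * (3 * n + 4) * (2 * (k + 1) + 1) * (n + (k + 1) + 1) * (g1 * b0 * q)" (is "?L = ?R")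
proof -
  define d where "d = (3 * k + 2) * (3 * k + 3)"
  have d: "d \<noteq> 0" using k by (simp add: d_def)
  have k3: "(k + 1) ^ 3 \<noteq> 0" using k by simp
  have "d * (k + 1) ^ 3 * (?L - ?R) = 0"
  proof -
    have "d * (k + 1) ^ 3 * (?L - ?R) =
      q * (- 24 * (3 * n + 4) * (2 * k + 1) * 16 * g0 * ((n + k + 1) * bm) * d * (k + 1) ^ 3
       + (g1 * (k + 1) ^ 3) * ((n + 2) ^ 3 * 16 * (d * b2) - 8 * (2 * n + 3) * (5 * n\<^sup>2 + 15 * n + 12) * (d * b1)
         + 64 * (n + 1) ^ 3 * (d * b0) + 24 * (3 * n + 4) * (2 * (k + 1) + 1) * (n + (k + 1) + 1) * (d * b0)))"
      by Groebner_Basis.algebra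
    also have "\<dots> = 0"
      unfolding d_def assms(1-5) by Groebner_Basis.algebra
    finally show ?thesis .
  qed
  with d k3 show ?thesis by simp
qed

lemma step16_poly:
  fixes n k g0 g1 B b0 b1 b2 bm bp q :: rat
  assumes "g1 * (k + 1) ^ 3 = 6 * (2 * k + 1) * (3 * k + 1) * (3 * k + 2) * g0"
    and "(3 * k + 2) * (3 * k + 3) * b0 = (n - k + 1) * (n - k) * B"
    and "(3 * k + 2) * (3 * k + 3) * b1 = (n + 2 * k + 3) * (n - k + 1) * B"
    and "(3 * k + 2) * (3 * k + 3) * b2 = (n + 2 * k + 4) * (n + 2 * k + 3) * B"
    and "(n + 2 * k + 2) * bm = (3 * k + 1) * B"
    and k: "k \<ge> 0"
  shows "96 * (3 * n + 5) * (2 * k + 1) * (n + 2 * k + 2) * (g0 * bm * (- 16 * q))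
     + ((n + 2) ^ 3 * (g1 * b2 * (256 * q)) - 2 * (2 * n + 3) * (5 * n\<^sup>2 + 15 * n + 12) * (g1 * b1 * (16 * q))
         + 64 * (n + 1) ^ 3 * (g1 * b0 * q))
     = 96 * (3 * n + 5) * (2 * (k + 1) + 1) * (n + 2 * (k + 1) + 2) * (g1 * b1 * q)" (is "?L = ?R")
proof -
  define d where "d = (3 * k + 2) * (3 * k + 3)"
  have d: "d \<noteq> 0" using k by (simp add: d_def)
  have k3: "(k + 1) ^ 3 \<noteq> 0" using k by simp
  have "d * (k + 1) ^ 3 * (?L - ?R) = 0"
  proof -
    have "d * (k + 1) ^ 3 * (?L - ?R) =
      q * (96 * (3 * n + 5) * (2 * k + 1) * (- 16) * g0 * ((n + 2 * k + 2) * bm) * d * (k + 1) ^ 3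
       + (g1 * (k + 1) ^ 3) * ((n + 2) ^ 3 * 256 * (d * b2) - 32 * (2 * n + 3) * (5 * n\<^sup>2 + 15 * n + 12) * (d * b1)
         + 64 * (n + 1) ^ 3 * (d * b0) - 96 * (3 * n + 5) * (2 * (k + 1) + 1) * (n + 2 * (k + 1) + 2) * (d * b1)))"
      by Groebner_Basis.algebra
    also have "\<dots> = 0"
      unfolding d_def assms(1-5) by Groebner_Basis.algebra
    finally show ?thesis .
  qed
  with d k3 show ?thesis by simp
qed

text \<open>The closed form of the partial sums is the certificate of the expansion. At \<open>K = n + 2\<close> it
vanishes because \<open>binom(n+K,3K) = 0\<close>, which is the recurrence for the whole sum.\<close>
lemma term4_telescope:
  "(\<Sum>k\<le>K. domb_op (\<lambda>n. term4 n k) n)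
     = - 24 * (3 * of_nat n + 4) * (2 * of_nat K + 1) * (of_nat n + of_nat K + 1) * term4 n K"
proof (induction K)
  case 0
  show ?case
    by (simp add: domb_op_def term4_def Gk_def) Groebner_Basis.algebra
next
  case (Suc K)
  let ?b = "\<lambda>i. of_nat ((n + K + i) choose (3 * Suc K)) :: rat" and ?n = "of_nat n :: rat" and ?k = "of_nat K :: rat"
  define q :: rat where "q = 4 ^ n / 16 ^ Suc K"
  have t: "term4 n (Suc K) = Gk (Suc K) * ?b 1 * q" "term4 (Suc n) (Suc K) = Gk (Suc K) * ?b 2 * (4 * q)"
     "term4 (Suc (Suc n)) (Suc K) = Gk (Suc K) * ?b 3 * (16 * q)"
     "term4 n K = Gk K * of_nat ((n + K) choose (3 * K)) * (16 * q)"
    by (simp_all add: term4_def q_def eval_nat_numeral del: binomial_Suc_Suc)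
  have B: "(?n + ?k + 1) * of_nat ((n + K) choose (3 * K)) = (3 * ?k + 1) * of_nat ((n + K + 1) choose (3 * K + 1))"
    using Suc_choose_Suc_rat[of "3 * K" "n + K"] by (simp add: algebra_simps del: binomial_Suc_Suc)
  have c: "(3 * ?k + 2) * (3 * ?k + 3) * ?b 1 = (?n - 2 * ?k) * (?n - 2 * ?k - 1) * of_nat ((n + K + 1) choose (3 * K + 1))"
    "(3 * ?k + 2) * (3 * ?k + 3) * ?b 2 = (?n + ?k + 2) * (?n - 2 * ?k) * of_nat ((n + K + 1) choose (3 * K + 1))"
    "(3 * ?k + 2) * (3 * ?k + 3) * ?b 3 = (?n + ?k + 3) * (?n + ?k + 2) * of_nat ((n + K + 1) choose (3 * K + 1))"
    using choose_step3[of K "n + K + 1"] by (simp_all add: algebra_simps eval_nat_numeral del: binomial_Suc_Suc)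
  show ?case
    unfolding sum.atMost_Suc Suc.IH unfolding domb_op_def t of_nat_Suc add.commute[of 1 ?k]
    by (rule step4_poly[OF Gk_Suc c B]) simp
qed

text \<open>As for the other expansion, except that the certificate contains \<open>binom(n+2K+1,3K)\<close>, so the
closed form is not a multiple of the summand itself.\<close>
lemma term16_telescope:
  "(\<Sum>k\<le>K. domb_op (\<lambda>n. term16 n k) n)
     = 96 * (3 * of_nat n + 5) * (2 * of_nat K + 1) * (of_nat n + 2 * of_nat K + 2)
        * (Gk K * of_nat ((n + 2 * K + 1) choose (3 * K)) * (16 ^ n / (- 16) ^ K))"
proof (induction K)
  case 0
  show ?case
    by (simp add: domb_op_def term16_def Gk_def) Groebner_Basis.algebra
next
  case (Suc K)
  let ?b = "\<lambda>i. of_nat ((n + 2 * K + i) choose (3 * Suc K)) :: rat" and ?n = "of_nat n :: rat" and ?k = "of_nat K :: rat"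
  define q :: rat where "q = 16 ^ n / (- 16) ^ Suc K"
  have t: "term16 n (Suc K) = Gk (Suc K) * ?b 2 * q" "term16 (Suc n) (Suc K) = Gk (Suc K) * ?b 3 * (16 * q)"
     "term16 (Suc (Suc n)) (Suc K) = Gk (Suc K) * ?b 4 * (256 * q)"
    by (simp_all add: term16_def q_def eval_nat_numeral del: binomial_Suc_Suc)
  have q: "16 ^ n / (- 16) ^ K = - 16 * q" "16 ^ n / (- 16) ^ Suc K = q" by (simp_all add: q_def)
  have B: "(?n + 2 * ?k + 2) * of_nat ((n + 2 * K + 1) choose (3 * K)) = (3 * ?k + 1) * of_nat ((n + 2 * K + 2) choose (3 * K + 1))"
    using Suc_choose_Suc_rat[of "3 * K" "n + 2 * K + 1"] by (simp add: algebra_simps eval_nat_numeral del: binomial_Suc_Suc)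
  have c: "(3 * ?k + 2) * (3 * ?k + 3) * ?b 2 = (?n - ?k + 1) * (?n - ?k) * of_nat ((n + 2 * K + 2) choose (3 * K + 1))"
    "(3 * ?k + 2) * (3 * ?k + 3) * ?b 3 = (?n + 2 * ?k + 3) * (?n - ?k + 1) * of_nat ((n + 2 * K + 2) choose (3 * K + 1))"
    "(3 * ?k + 2) * (3 * ?k + 3) * ?b 4 = (?n + 2 * ?k + 4) * (?n + 2 * ?k + 3) * of_nat ((n + 2 * K + 2) choose (3 * K + 1))"
    using choose_step3[of K "n + 2 * K + 2"] by (simp_all add: algebra_simps eval_nat_numeral del: binomial_Suc_Suc)
  have e: "n + 2 * Suc K + 1 = n + 2 * K + 3" by simp
  show ?case
    unfolding sum.atMost_Suc Suc.IH unfolding domb_op_def t of_nat_Suc add.commute[of 1 ?k] q e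
    by (rule step16_poly[OF Gk_Suc c B]) simp
qed

text \<open>Extending all the sums to the same range is possible because the additional summands vanish.\<close>
lemma domb_op_sum:
  assumes "\<And>m k. k > m \<Longrightarrow> f m k = 0"
  shows "domb_op (\<lambda>n. \<Sum>k\<le>n. f n k) n = (\<Sum>k\<le>n + 2. domb_op (\<lambda>n. f n k) n)"
proof -
  have "(\<Sum>k\<le>m. f m k) = (\<Sum>k\<le>n + 2. f m k)" if "m \<le> n + 2" for m
    by (rule sum.mono_neutral_left) (use that assms in auto)
  from this[of n] this[of "Suc n"] this[of "Suc (Suc n)"] show ?thesis
    unfolding domb_op_def by (simp add: sum.distrib sum_subtractf flip: sum_distrib_left)
qed

lemma domb_0_1: "domb 0 = 1" "domb 1 = 4"
  by (simp_all add: domb_def numeral_2_eq_2)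

theorem domb_eq_term4: "of_nat (domb n) = (\<Sum>k\<le>n. term4 n k)"
proof (rule domb_op_unique)
  show "domb_op (\<lambda>n. \<Sum>k\<le>n. term4 n k) n = 0" for n
    by (subst domb_op_sum) (simp_all only: term4_telescope, simp_all add: term4_def binomial_eq_0)
qed (auto simp: domb_recurrence domb_0_1[simplified] term4_def Gk_def)

theorem domb_eq_term16: "of_nat (domb n) = (\<Sum>k\<le>n. term16 n k)"
proof (rule domb_op_unique)
  show "domb_op (\<lambda>n. \<Sum>k\<le>n. term16 n k) n = 0" for n
    by (subst domb_op_sum) (simp_all only: term16_telescope, simp_all add: term16_def binomial_eq_0)
qed (auto simp: domb_recurrence domb_0_1[simplified] term16_def Gk_def numeral_2_eq_2 numeral_3_eq_3)

section \<open>Truncated sums of Domb numbers\<close>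

lemma domb_recurrence_Suc:
  "(of_nat N + 2) ^ 3 * of_nat (domb (Suc (Suc N)))
     = 2 * (2 * of_nat N + 3) * (5 * (of_nat N)\<^sup>2 + 15 * of_nat N + 12) * of_nat (domb (Suc N))
        - 64 * (of_nat N + 1) ^ 3 * (of_nat (domb N) :: rat)"
  using domb_recurrence[of N] unfolding domb_op_def by linarith

text \<open>The weight is chosen such that the summand is the difference of consecutive values of the right
hand side modulo the recurrence. At \<open>N = p - 1\<close> the right hand side is divisible by \<open>p\<^sup>3\<close>.\<close>
lemma domb_weighted_sum_4:
  "(\<Sum>n\<le>N. (of_nat n + 1) * (3 * of_nat n + 2) * (of_nat (domb n) / 4 ^ n) :: rat)
     = (of_nat N + 1) ^ 3 * ((32 * of_nat (domb N) - 2 * of_nat (domb (Suc N))) / (3 * 4 ^ Suc N))"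
proof (induction N)
  case (Suc N)
  define i :: rat where "i = 1 / 4 ^ N"
  have i: "x / (3 * 4 ^ Suc N) = x * i / 12" "x / (3 * 4 ^ Suc (Suc N)) = x * i / 48"
    "x / 4 ^ Suc N = x * i / 4" for x
    by (simp_all add: i_def)
  show ?case
    unfolding sum.atMost_Suc Suc.IH i using domb_recurrence_Suc[of N]
    unfolding of_nat_Suc by Groebner_Basis.algebra
qed (simp add: domb_0_1[simplified])

lemma domb_weighted_sum_16:
  "(\<Sum>n\<le>N. of_nat n * (3 * of_nat n + 1) * (of_nat (domb n) / 16 ^ n) :: rat)
     = (of_nat N + 1) ^ 3 * ((8 * of_nat (domb (Suc N)) - 32 * of_nat (domb N)) / (3 * 16 ^ Suc N))"
proof (induction N)
  case (Suc N)
  define i :: rat where "i = 1 / 16 ^ N"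
  have i: "x / (3 * 16 ^ Suc N) = x * i / 48" "x / (3 * 16 ^ Suc (Suc N)) = x * i / 768"
    "x / 16 ^ Suc N = x * i / 16" for x
    by (simp_all add: i_def)
  show ?case
    unfolding sum.atMost_Suc Suc.IH i using domb_recurrence_Suc[of N]
    unfolding of_nat_Suc by Groebner_Basis.algebra
qed (simp add: domb_0_1[simplified])

lemma hockey_stick:
  "(\<Sum>n<N. of_nat ((n + a) choose (r + a)) :: rat) = of_nat ((N + a) choose (r + a + 1))"
  by (induction N) simp_all

text \<open>Multiplication by \<open>n\<close> raises the lower index once more, which accounts for the denominator
\<open>3 k + 2\<close> in the first moment of the Domb numbers.\<close>
lemma hockey_stick_weighted:
  "(of_nat (r + a) + 2) * (\<Sum>n<N. of_nat n * of_nat ((n + a) choose (r + a)) :: rat)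
     = ((of_nat (r + a) + 1) * of_nat N - (of_nat a + 1)) * of_nat ((N + a) choose (r + a + 1))"
proof (induction N)
  case (Suc N)
  have 1: "(of_nat (r + a) + 1) * (of_nat ((N + a) choose (r + a + 1)) :: rat)
      = (of_nat N - of_nat r) * of_nat ((N + a) choose (r + a))"
    using choose_Suc_rat[of "r + a" "N + a"] by (simp add: algebra_simps)
  have 2: "(of_nat ((Suc N + a) choose (r + a + 1)) :: rat)
      = of_nat ((N + a) choose (r + a)) + of_nat ((N + a) choose (r + a + 1))"
    by simp
  show ?case
    unfolding sum.lessThan_Suc distrib_left Suc.IH 2 using 1
    unfolding of_nat_Suc of_nat_add by Groebner_Basis.algebra
qed simp

text \<open>Exchanging the order of summation replaces the inner sum over \<open>n\<close> by a single binomial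
coefficient.\<close>
lemma sums_of_binomial_expansion:
  fixes f w :: "nat \<Rightarrow> rat"
  assumes f: "\<And>n. n < N \<Longrightarrow> f n = (\<Sum>k<N. w k * of_nat ((n + a k) choose (3 * k)))"
    and a: "\<And>k. a k \<le> 3 * k"
  shows "(\<Sum>n<N. f n) = (\<Sum>k<N. w k * of_nat ((N + a k) choose (3 * k + 1)))"
    and "(\<Sum>n<N. of_nat n * f n) = (\<Sum>k<N. w k * of_nat ((N + a k) choose (3 * k + 1))
          * (((3 * of_nat k + 1) * of_nat N - (of_nat (a k) + 1)) / (3 * of_nat k + 2)))"
proof -
  have e: "3 * k - a k + a k = 3 * k" for k using a[of k] by simp
  have h1: "(\<Sum>n<N. of_nat ((n + a k) choose (3 * k)) :: rat) = of_nat ((N + a k) choose (3 * k + 1))" for k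
    using hockey_stick[of "a k" "3 * k - a k" N] unfolding e .
  have h2: "(\<Sum>n<N. of_nat n * of_nat ((n + a k) choose (3 * k)) :: rat)
     = of_nat ((N + a k) choose (3 * k + 1)) * (((3 * of_nat k + 1) * of_nat N - (of_nat (a k) + 1)) / (3 * of_nat k + 2))" for k
  proof -
    have nz: "3 * of_nat k + 2 \<noteq> (0 :: rat)"
      using of_nat_0_le_iff[of k, where ?'a = rat] by linarith
    show ?thesis
      using hockey_stick_weighted[of "3 * k - a k" "a k" N] nz unfolding e by (simp add: field_simps)
  qed
  have "(\<Sum>n<N. f n) = (\<Sum>n<N. \<Sum>k<N. w k * of_nat ((n + a k) choose (3 * k)))"
    by (intro sum.cong refl) (simp add: f)
  also have "\<dots> = (\<Sum>k<N. w k * (\<Sum>n<N. of_nat ((n + a k) choose (3 * k))))"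
    by (subst sum.swap) (simp add: sum_distrib_left)
  finally show "(\<Sum>n<N. f n) = (\<Sum>k<N. w k * of_nat ((N + a k) choose (3 * k + 1)))"
    by (simp only: h1)
  have "(\<Sum>n<N. of_nat n * f n) = (\<Sum>n<N. \<Sum>k<N. w k * (of_nat n * of_nat ((n + a k) choose (3 * k))))"
    by (intro sum.cong refl) (simp add: f sum_distrib_left mult_ac)
  also have "\<dots> = (\<Sum>k<N. w k * (\<Sum>n<N. of_nat n * of_nat ((n + a k) choose (3 * k))))"
    by (subst sum.swap) (simp add: sum_distrib_left)
  finally show "(\<Sum>n<N. of_nat n * f n) = (\<Sum>k<N. w k * of_nat ((N + a k) choose (3 * k + 1))
          * (((3 * of_nat k + 1) * of_nat N - (of_nat (a k) + 1)) / (3 * of_nat k + 2)))"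
    by (simp only: h2 mult.assoc)
qed

lemma domb_expansion_4:
  assumes "n < N"
  shows "of_nat (domb n) / 4 ^ n = (\<Sum>k<N. Gk k / 16 ^ k * of_nat ((n + k) choose (3 * k)))"
proof -
  have "of_nat (domb n) / 4 ^ n = (\<Sum>k\<le>n. Gk k / 16 ^ k * of_nat ((n + k) choose (3 * k)))"
    by (simp add: domb_eq_term4 term4_def sum_divide_distrib field_simps)
  also have "\<dots> = (\<Sum>k<N. Gk k / 16 ^ k * of_nat ((n + k) choose (3 * k)))"
    by (rule sum.mono_neutral_left) (use assms in \<open>auto simp: binomial_eq_0\<close>)
  finally show ?thesis .
qed

lemma domb_expansion_16:
  assumes "n < N"
  shows "of_nat (domb n) / 16 ^ n = (\<Sum>k<N. Gk k / (- 16) ^ k * of_nat ((n + 2 * k) choose (3 * k)))"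
proof -
  have "of_nat (domb n) / 16 ^ n = (\<Sum>k\<le>n. Gk k / (- 16) ^ k * of_nat ((n + 2 * k) choose (3 * k)))"
    by (simp add: domb_eq_term16 term16_def sum_divide_distrib field_simps)
  also have "\<dots> = (\<Sum>k<N. Gk k / (- 16) ^ k * of_nat ((n + 2 * k) choose (3 * k)))"
    by (rule sum.mono_neutral_left) (use assms in \<open>auto simp: binomial_eq_0\<close>)
  finally show ?thesis .
qed

text \<open>The summand of a \<open>\<^sub>4F\<^sub>3\<close> series at 1. At \<open>a = N\<close> and \<open>a = - N\<close> it collects all the factors of the
truncated sums over \<open>n < N\<close> other than the denominators linear in \<open>k\<close>.\<close>
definition T :: "rat \<Rightarrow> nat \<Rightarrow> rat" where
  "T a k = pochhammer (1 / 2) k * pochhammer (1 + a) k * pochhammer ((1 - a) / 2) k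
     * pochhammer (1 - a / 2) k / fact k ^ 4"

lemma two_power_double: "(2 :: rat) ^ (2 * k) = 4 ^ k"
  by (simp add: power_mult)

lemma central_factor: "Gk k / fact (3 * k) = 4 ^ k * pochhammer (1 / 2) k / fact k ^ 4"
proof -
  have "Gk k * fact k ^ 5 = 4 ^ k * pochhammer (1 / 2) k * fact k * fact (3 * k)"
    unfolding Gk_fact using fact_double[of k, where ?'a = rat] by (simp only: two_power_double)
  then have "fact k * (Gk k * fact k ^ 4) = fact k * (4 ^ k * pochhammer (1 / 2) k * fact (3 * k))"
    by (simp only: power_Suc numeral_eq_Suc pred_numeral_simps Num.BitM.simps mult_ac)
  then have "Gk k * fact k ^ 4 = 4 ^ k * pochhammer (1 / 2) k * fact (3 * k)" by simp
  then show ?thesis by (simp only: frac_eq_eq fact_nonzero power_not_zero not_False_eq_True)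
qed

text \<open>The factors of the binomial coefficient split into those below \<open>x\<close>, which pair up by the
duplication formula, the factor \<open>x\<close> itself, and those above \<open>x\<close>.\<close>
lemma Gk_gchoose_4: "Gk k * ((x + of_nat k) gchoose (3 * k + 1)) / 16 ^ k = x * (T x k / (3 * of_nat k + 1))"
proof -
  have e: "x + of_nat k - of_nat (3 * k + 1) + 1 = x - 1 - of_nat (2 * k) + 1" "3 * k + 1 = 2 * k + Suc k"
    "x - 1 - of_nat (2 * k) + 1 + of_nat (2 * k) = x"
    by simp_all
  have "pochhammer (x + of_nat k - of_nat (3 * k + 1) + 1) (3 * k + 1)
     = pochhammer (x - 1 - of_nat (2 * k) + 1) (2 * k) * pochhammer x (Suc k)"
    unfolding e(1) unfolding e(2) pochhammer_product' e(3) ..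
  also have "\<dots> = pochhammer (2 * ((1 - x) / 2)) (2 * k) * (x * pochhammer (1 + x) k)"
    by (simp only: pochhammer_minus' pochhammer_rec) (simp add: add.commute[of x] diff_divide_distrib add_divide_distrib)
  also have "\<dots> = 4 ^ k * pochhammer ((1 - x) / 2) k * pochhammer (1 - x / 2) k * (x * pochhammer (1 + x) k)"
    by (simp only: pochhammer_double of_nat_power of_nat_numeral two_power_double) (simp add: field_simps)
  finally have "(x + of_nat k) gchoose (3 * k + 1) = 4 ^ k * pochhammer ((1 - x) / 2) k
     * pochhammer (1 - x / 2) k * (x * pochhammer (1 + x) k) / ((3 * of_nat k + 1) * fact (3 * k))"
    by (simp only: gbinomial_pochhammer') (simp add: add.commute)
  then have "Gk k * ((x + of_nat k) gchoose (3 * k + 1)) / 16 ^ k = (Gk k / fact (3 * k)) * 4 ^ k / 16 ^ k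
      * (pochhammer ((1 - x) / 2) k * pochhammer (1 - x / 2) k * (x * pochhammer (1 + x) k)) / (3 * of_nat k + 1)"
    by (simp add: field_simps)
  also have "\<dots> = (4 ^ k * 4 ^ k / 16 ^ k) * (x * (T x k / (3 * of_nat k + 1)))"
    unfolding central_factor T_def by (simp add: divide_simps)
  also have "4 ^ k * 4 ^ k / 16 ^ k = (1 :: rat)"
    by (simp flip: power_mult_distrib)
  finally show ?thesis by simp
qed

lemma Gk_gchoose_16:
  "Gk k * ((x + of_nat (2 * k)) gchoose (3 * k + 1)) / (- 16) ^ k = x * (T (- x) k / (3 * of_nat k + 1))"
proof -
  have e: "x + of_nat (2 * k) - of_nat (3 * k + 1) + 1 = x - 1 - of_nat k + 1" "3 * k + 1 = k + Suc (2 * k)"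
    "x - 1 - of_nat k + 1 + of_nat k = x"
    by simp_all
  have "pochhammer (x + of_nat (2 * k) - of_nat (3 * k + 1) + 1) (3 * k + 1)
     = pochhammer (x - 1 - of_nat k + 1) k * pochhammer x (Suc (2 * k))"
    unfolding e(1) unfolding e(2) pochhammer_product' e(3) ..
  also have "\<dots> = (- 1) ^ k * pochhammer (1 - x) k * (x * pochhammer (2 * ((1 + x) / 2)) (2 * k))"
    by (simp only: pochhammer_minus' pochhammer_rec) (simp add: add.commute[of x] diff_divide_distrib add_divide_distrib)
  also have "\<dots> = (- 4) ^ k * pochhammer (1 - x) k * (x * pochhammer ((1 + x) / 2) k * pochhammer (1 + x / 2) k)"
    by (simp only: pochhammer_double of_nat_power of_nat_numeral two_power_double) (simp add: field_simps power_minus[of 4])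
  finally have "(x + of_nat (2 * k)) gchoose (3 * k + 1) = (- 4) ^ k * pochhammer (1 - x) k
     * (x * pochhammer ((1 + x) / 2) k * pochhammer (1 + x / 2) k) / ((3 * of_nat k + 1) * fact (3 * k))"
    by (simp only: gbinomial_pochhammer') (simp add: add.commute)
  then have "Gk k * ((x + of_nat (2 * k)) gchoose (3 * k + 1)) / (- 16) ^ k = (Gk k / fact (3 * k)) * (- 4) ^ k / (- 16) ^ k
      * (pochhammer (1 - x) k * (x * pochhammer ((1 + x) / 2) k * pochhammer (1 + x / 2) k)) / (3 * of_nat k + 1)"
    by (simp add: field_simps)
  also have "\<dots> = (4 ^ k * (- 4) ^ k / (- 16) ^ k) * (x * (T (- x) k / (3 * of_nat k + 1)))"
    unfolding central_factor T_def by (simp add: divide_simps)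
  also have "4 ^ k * (- 4) ^ k / (- 16) ^ k = (1 :: rat)"
    by (simp flip: power_mult_distrib)
  finally show ?thesis by simp
qed

lemma gchoose_term_4:
  "Gk k / 16 ^ k * of_nat ((N + k) choose (3 * k + 1)) = of_nat N * (T (of_nat N) k / (3 * of_nat k + 1))"
  using Gk_gchoose_4[of k "of_nat N"] by (simp add: binomial_gbinomial del: One_nat_def)

lemma gchoose_term_16:
  "Gk k / (- 16) ^ k * of_nat ((N + 2 * k) choose (3 * k + 1))
     = of_nat N * (T (- of_nat N) k / (3 * of_nat k + 1))"
  using Gk_gchoose_16[of k "of_nat N"] by (simp add: binomial_gbinomial del: One_nat_def)

lemma sum_domb_4:
  "(\<Sum>n<N. of_nat (domb n) / 4 ^ n :: rat) = of_nat N * (\<Sum>k<N. T (of_nat N) k / (3 * of_nat k + 1))"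
  "(\<Sum>n<N. of_nat n * (of_nat (domb n) / 4 ^ n) :: rat) = of_nat N * (\<Sum>k<N. T (of_nat N) k / (3 * of_nat k + 1)
     * (((3 * of_nat k + 1) * of_nat N - (of_nat k + 1)) / (3 * of_nat k + 2)))"
  using sums_of_binomial_expansion[OF domb_expansion_4, of N]
  unfolding gchoose_term_4 sum_distrib_left mult.assoc by simp_all

lemma sum_domb_16:
  "(\<Sum>n<N. of_nat (domb n) / 16 ^ n :: rat) = of_nat N * (\<Sum>k<N. T (- of_nat N) k / (3 * of_nat k + 1))"
  "(\<Sum>n<N. of_nat n * (of_nat (domb n) / 16 ^ n) :: rat) = of_nat N * (\<Sum>k<N. T (- of_nat N) k / (3 * of_nat k + 1)
     * (((3 * of_nat k + 1) * of_nat N - (2 * of_nat k + 1)) / (3 * of_nat k + 2)))"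
  using sums_of_binomial_expansion[OF domb_expansion_16, of N]
  unfolding gchoose_term_16 sum_distrib_left mult.assoc by simp_all

section \<open>Saalschuetz summation as a partial fraction expansion\<close>

lemma alternating_binomial_sum_Suc:
  fixes f :: "nat \<Rightarrow> 'a :: comm_ring_1"
  shows "(\<Sum>k\<le>Suc n. (- 1) ^ k * of_nat (Suc n choose k) * f k)
      = (\<Sum>k\<le>n. (- 1) ^ k * of_nat (n choose k) * f k) - (\<Sum>k\<le>n. (- 1) ^ k * of_nat (n choose k) * f (Suc k))"
proof -
  have "(\<Sum>k\<le>Suc n. (- 1) ^ k * of_nat (Suc n choose k) * f k)
     = f 0 + (\<Sum>k\<le>n. (- 1) ^ Suc k * of_nat (Suc n choose Suc k) * f (Suc k))"
    by (subst sum.atMost_Suc_shift) simp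
  also have "\<dots> = f 0 + ((\<Sum>k\<le>n. (- 1) ^ Suc k * of_nat (n choose Suc k) * f (Suc k))
      - (\<Sum>k\<le>n. (- 1) ^ k * of_nat (n choose k) * f (Suc k)))"
  proof -
    have "(- 1) ^ Suc k * of_nat (Suc n choose Suc k) * f (Suc k)
       = (- 1) ^ Suc k * of_nat (n choose Suc k) * f (Suc k) - (- 1) ^ k * of_nat (n choose k) * f (Suc k)" for k
      by (simp add: algebra_simps)
    then show ?thesis by (simp only: sum_subtractf)
  qed
  also have "\<dots> = f 0 + (\<Sum>k\<le>n. (- 1) ^ Suc k * of_nat (n choose Suc k) * f (Suc k))
      - (\<Sum>k\<le>n. (- 1) ^ k * of_nat (n choose k) * f (Suc k))" by simp
  also have "f 0 + (\<Sum>k\<le>n. (- 1) ^ Suc k * of_nat (n choose Suc k) * f (Suc k))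
     = (\<Sum>k\<le>Suc n. (- 1) ^ k * of_nat (n choose k) * f k)"
    using sum.atMost_Suc_shift[of "\<lambda>k. (- 1) ^ k * of_nat (n choose k) * f k" n]
    by (simp del: sum.atMost_Suc)
  finally show ?thesis by (simp add: binomial_eq_0)
qed

text \<open>An \<open>(n + 1)\<close>-st difference of a polynomial of degree \<open>n\<close> in \<open>k\<close>.\<close>
lemma alternating_sum_poch_0:
  fixes a :: "'a :: field_char_0"
  shows "(\<Sum>k\<le>Suc n. (- 1) ^ k * of_nat (Suc n choose k) * pochhammer (a - of_nat k) n) = 0"
proof (induction n arbitrary: a)
  case 0
  show ?case by simp
next
  case (Suc n)
  have "pochhammer (a - of_nat k) (Suc n) - pochhammer (a - of_nat (Suc k)) (Suc n)
     = of_nat (Suc n) * pochhammer (a - of_nat k) n" for k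
    by (subst (2) pochhammer_rec, subst pochhammer_rec') (simp add: algebra_simps)
  then have d: "x * pochhammer (a - of_nat k) (Suc n) - x * pochhammer (a - of_nat (Suc k)) (Suc n)
     = x * (of_nat (Suc n) * pochhammer (a - of_nat k) n)" for k x
    by (simp only: flip: right_diff_distrib)
  then have "(\<Sum>k\<le>Suc (Suc n). (- 1) ^ k * of_nat (Suc (Suc n) choose k) * pochhammer (a - of_nat k) (Suc n))
     = (\<Sum>k\<le>Suc n. (- 1) ^ k * of_nat (Suc n choose k) * (of_nat (Suc n) * pochhammer (a - of_nat k) n))"
    unfolding alternating_binomial_sum_Suc[of "Suc n"]
    by (simp only: d flip: sum_subtractf)
  also have "\<dots> = of_nat (Suc n) * (\<Sum>k\<le>Suc n. (- 1) ^ k * of_nat (Suc n choose k) * pochhammer (a - of_nat k) n)"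
    by (subst sum_distrib_left) (simp add: mult_ac)
  finally show ?case unfolding Suc.IH by simp
qed

text \<open>The right hand side is a rational function of \<open>z\<close> with simple poles at \<open>z = - k\<close>, and the
numerator has smaller degree than the denominator; the left hand side is its partial fraction
expansion. The induction on \<open>n\<close> uses Pascal's rule on the left and writes
\<open>a - k + n\<close> as \<open>(z + a + n) - (z + k)\<close>.\<close>
lemma partial_fractions_pochhammer:
  fixes a z :: "'a :: field_char_0"
  assumes "\<And>k. k \<le> n \<Longrightarrow> z + of_nat k \<noteq> 0"
  shows "(\<Sum>k\<le>n. (- 1) ^ k * of_nat (n choose k) * pochhammer (a - of_nat k) n / (z + of_nat k))
     = fact n * pochhammer (z + a) n / pochhammer z (Suc n)"
  using assms
proof (induction n arbitrary: a z)
  case 0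
  then show ?case by simp
next
  case (Suc n)
  let ?Q = "\<lambda>a k. pochhammer (a - of_nat k) n :: 'a"
  let ?c = "z + a + of_nat n"
  have nz: "z + of_nat k \<noteq> 0" if "k \<le> Suc n" for k using Suc.prems that by blast
  have IH1: "(\<Sum>k\<le>n. (- 1) ^ k * of_nat (n choose k) * ?Q a k / (z + of_nat k))
      = fact n * pochhammer (z + a) n / pochhammer z (Suc n)"
    by (rule Suc.IH) (use nz in auto)
  have IH2: "(\<Sum>k\<le>n. (- 1) ^ k * of_nat (n choose k) * ?Q (a - 1) k / (z + 1 + of_nat k))
      = fact n * pochhammer (z + 1 + (a - 1)) n / pochhammer (z + 1) (Suc n)"
    by (rule Suc.IH) (use nz[of "Suc k" for k] in \<open>auto simp: add_ac\<close>)
  have "(\<Sum>k\<le>Suc n. (- 1) ^ k * of_nat (Suc n choose k) * pochhammer (a - of_nat k) (Suc n) / (z + of_nat k))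
     = (\<Sum>k\<le>Suc n. (- 1) ^ k * of_nat (Suc n choose k) * (?c * (?Q a k / (z + of_nat k)) - ?Q a k))"
  proof (intro sum.cong refl)
    fix k assume "k \<in> {..Suc n}"
    then have "z + of_nat k \<noteq> 0" using nz by auto
    then show "(- 1) ^ k * of_nat (Suc n choose k) * pochhammer (a - of_nat k) (Suc n) / (z + of_nat k)
       = (- 1) ^ k * of_nat (Suc n choose k) * (?c * (?Q a k / (z + of_nat k)) - ?Q a k)"
      by (subst pochhammer_rec') (simp add: field_simps del: binomial_Suc_Suc)
  qed
  also have "\<dots> = ?c * (\<Sum>k\<le>Suc n. (- 1) ^ k * of_nat (Suc n choose k) * (?Q a k / (z + of_nat k)))"
    using alternating_sum_poch_0[of n a]
    by (simp add: sum_subtractf sum_distrib_left algebra_simps del: binomial_Suc_Suc sum.atMost_Suc)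
  also have "(\<Sum>k\<le>Suc n. (- 1) ^ k * of_nat (Suc n choose k) * (?Q a k / (z + of_nat k)))
     = fact n * pochhammer (z + a) n / pochhammer z (Suc n) - fact n * pochhammer (z + a) n / pochhammer (z + 1) (Suc n)"
    unfolding alternating_binomial_sum_Suc using IH1 IH2 by (simp add: algebra_simps)
  also have "\<dots> = fact n * pochhammer (z + a) n * of_nat (Suc n) / pochhammer z (Suc (Suc n))"
  proof -
    have nz2: "pochhammer z (Suc (Suc n)) \<noteq> 0"
      using nz by (auto simp: pochhammer_eq_0_iff less_Suc_eq_le eq_neg_iff_add_eq_0)
    have r1: "pochhammer z (Suc (Suc n)) = pochhammer z (Suc n) * (z + of_nat (Suc n))"
      by (simp only: pochhammer_rec'[of z "Suc n"] mult.commute)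
    have r2: "pochhammer z (Suc (Suc n)) = z * pochhammer (z + 1) (Suc n)" by (rule pochhammer_rec)
    let ?F = "fact n * pochhammer (z + a) n"
    have "?F / pochhammer z (Suc n) = ?F * (z + of_nat (Suc n)) / pochhammer z (Suc (Suc n))"
      using nz2 unfolding r1 by (simp del: of_nat_Suc)
    moreover have "?F / pochhammer (z + 1) (Suc n) = ?F * z / pochhammer z (Suc (Suc n))"
      using nz2 unfolding r2 by simp
    ultimately show ?thesis by (simp add: diff_divide_distrib[symmetric] right_diff_distrib[symmetric] del: of_nat_Suc)
  qed
  finally show ?case by (simp add: pochhammer_rec' field_simps)
qed

text \<open>Reversing the Pochhammer symbols identifies the hypergeometric weight with the residues of a
partial fraction expansion.\<close>
lemma saalschutz_weight:
  fixes a :: "'a :: field_char_0"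
  assumes "pochhammer (a - of_nat n) k \<noteq> 0" "pochhammer (1 - a) n \<noteq> 0"
  shows "pochhammer (- of_nat n) k * pochhammer a k / (fact k * pochhammer (a - of_nat n) k)
    = (- 1) ^ k * of_nat (n choose k) * pochhammer (1 - a - of_nat k) n / pochhammer (1 - a) n"
proof -
  have b: "(- 1) ^ k * of_nat (n choose k) = (pochhammer (- of_nat n) k / fact k :: 'a)"
    unfolding binomial_gbinomial gbinomial_pochhammer by (simp add: mult.assoc[symmetric] flip: power_mult_distrib)
  have r: "pochhammer (1 - x - of_nat k) k = (- 1) ^ k * pochhammer x k" for x :: 'a
    using pochhammer_minus'[of "- x" k] by (simp add: algebra_simps)
  have "pochhammer (1 - a - of_nat k) n * pochhammer (1 - a - of_nat k + of_nat n) k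
      = pochhammer (1 - a - of_nat k) k * pochhammer (1 - a - of_nat k + of_nat k) n"
    by (simp only: flip: pochhammer_product') (simp add: add.commute)
  moreover have "1 - a - of_nat k + of_nat n = 1 - (a - of_nat n) - of_nat k" by simp
  ultimately have "pochhammer (1 - a - of_nat k) n * ((- 1) ^ k * pochhammer (a - of_nat n) k)
      = (- 1) ^ k * pochhammer a k * pochhammer (1 - a) n"
    by (simp only: r diff_add_cancel)
  then have "pochhammer (1 - a - of_nat k) n * pochhammer (a - of_nat n) k = pochhammer a k * pochhammer (1 - a) n"
    by simp
  then have "pochhammer a k / pochhammer (a - of_nat n) k = pochhammer (1 - a - of_nat k) n / pochhammer (1 - a) n"
    using assms by (simp add: frac_eq_eq)
  then show ?thesis unfolding b
    by (metis (no_types, lifting) times_divide_eq_right times_divide_times_eq)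
qed

text \<open>Saalschuetz's theorem for the balanced series with parameters \<open>- n\<close>, \<open>a\<close>, \<open>z\<close> and
\<open>a - n\<close>, \<open>z + 1\<close>. In this form the denominator \<open>z + k\<close> is visible.\<close>
lemma saalschutz_partial_fractions:
  fixes a z :: "'a :: field_char_0"
  assumes "\<And>k. k \<le> n \<Longrightarrow> pochhammer (a - of_nat n) k \<noteq> 0" "pochhammer (1 - a) n \<noteq> 0"
    and "\<And>k. k \<le> n \<Longrightarrow> z + of_nat k \<noteq> 0"
  shows "(\<Sum>k\<le>n. pochhammer (- of_nat n) k * pochhammer a k / (fact k * pochhammer (a - of_nat n) k) / (z + of_nat k))
     = fact n * pochhammer (z + 1 - a) n / (pochhammer (1 - a) n * (z * pochhammer (z + 1) n))"
proof -
  have "(\<Sum>k\<le>n. pochhammer (- of_nat n) k * pochhammer a k / (fact k * pochhammer (a - of_nat n) k) / (z + of_nat k))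
     = (\<Sum>k\<le>n. (- 1) ^ k * of_nat (n choose k) * pochhammer (1 - a - of_nat k) n / (z + of_nat k)) / pochhammer (1 - a) n"
    unfolding sum_divide_distrib
  proof (intro sum.cong refl)
    fix k assume "k \<in> {..n}"
    then have nz: "pochhammer (a - of_nat n) k \<noteq> 0" using assms(1) by simp
    show "pochhammer (- of_nat n) k * pochhammer a k / (fact k * pochhammer (a - of_nat n) k) / (z + of_nat k)
       = (- 1) ^ k * of_nat (n choose k) * pochhammer (1 - a - of_nat k) n / (z + of_nat k) / pochhammer (1 - a) n"
      unfolding saalschutz_weight[OF nz assms(2)] by (simp only: divide_divide_eq_left mult.commute)
  qed
  also have "(\<Sum>k\<le>n. (- 1) ^ k * of_nat (n choose k) * pochhammer (1 - a - of_nat k) n / (z + of_nat k))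
     = fact n * pochhammer (z + (1 - a)) n / (z * pochhammer (z + 1) n)"
    using partial_fractions_pochhammer[of n z "1 - a", OF assms(3)] by (simp only: pochhammer_rec)
  also have "z + (1 - a) = z + 1 - a" by simp
  finally show ?thesis by (simp add: mult.commute)
qed

section \<open>Congruences between rational numbers\<close>

locale padic_prime =
  fixes p :: nat
  assumes prime_p: "prime p" and p_gt_3: "p > 3"
begin

abbreviation Zp :: "rat set" where "Zp \<equiv> padic_integer_rats p"
abbreviation P :: rat where "P \<equiv> of_nat p"
abbreviation cong1 (infix "\<simeq>\<^sub>1" 50) where "x \<simeq>\<^sub>1 y \<equiv> rat_cong p 1 x y"
abbreviation cong2 (infix "\<simeq>\<^sub>2" 50) where "x \<simeq>\<^sub>2 y \<equiv> rat_cong p 2 x y"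
abbreviation cong3 (infix "\<simeq>\<^sub>3" 50) where "x \<simeq>\<^sub>3 y \<equiv> rat_cong p 3 x y"

text \<open>Units of the local ring, that is, rational numbers of \<open>p\<close>-adic valuation 0.\<close>
definition unit :: "rat \<Rightarrow> bool" where
  "unit x \<longleftrightarrow> (\<exists>a b :: int. x = of_int a / of_int b \<and> \<not> int p dvd a \<and> \<not> int p dvd b)"

lemma prime_int_p: "prime (int p)" using prime_p by simp
lemma p_pos: "p > 0" using p_gt_3 by simp
lemma P_nz [simp]: "P \<noteq> 0" using p_pos by simp

lemma dvd_mult_int: "int p dvd a * b \<longleftrightarrow> int p dvd a \<or> int p dvd b"
  using prime_int_p by (rule prime_dvd_mult_iff)

lemma Zp_of_int [simp, intro]: "of_int a \<in> Zp"
  unfolding padic_integer_rats_def using p_gt_3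
  by (intro CollectI exI[of _ a] exI[of _ 1]) auto

lemma Zp_of_nat [simp, intro]: "of_nat a \<in> Zp"
  using Zp_of_int[of "int a"] by simp

lemma Zp_numeral [simp, intro]: "numeral a \<in> Zp"
  using Zp_of_nat[of "numeral a"] by simp

lemma Zp_0 [simp, intro]: "0 \<in> Zp" and Zp_1 [simp, intro]: "1 \<in> Zp"
  using Zp_of_nat[of 0] Zp_of_nat[of 1] by simp_all

lemma Zp_add [intro!]: "x \<in> Zp \<Longrightarrow> y \<in> Zp \<Longrightarrow> x + y \<in> Zp"
proof -
  assume "x \<in> Zp" "y \<in> Zp"
  then obtain a b c d where x: "x = of_int a / of_int b" "\<not> int p dvd b"
    and y: "y = of_int c / of_int d" "\<not> int p dvd d"
    unfolding padic_integer_rats_def by blast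
  have "b \<noteq> 0" "d \<noteq> 0" using x y by auto
  then have "x + y = of_int (a * d + c * b) / of_int (b * d)"
    by (simp add: x y field_simps)
  moreover have "\<not> int p dvd b * d" using x y by (simp add: dvd_mult_int)
  ultimately show ?thesis unfolding padic_integer_rats_def by blast
qed

lemma Zp_mult [intro!]: "x \<in> Zp \<Longrightarrow> y \<in> Zp \<Longrightarrow> x * y \<in> Zp"
proof -
  assume "x \<in> Zp" "y \<in> Zp"
  then obtain a b c d where x: "x = of_int a / of_int b" "\<not> int p dvd b"
    and y: "y = of_int c / of_int d" "\<not> int p dvd d"
    unfolding padic_integer_rats_def by blast
  have "x * y = of_int (a * c) / of_int (b * d)" by (simp add: x y)
  moreover have "\<not> int p dvd b * d" using x y by (simp add: dvd_mult_int)
  ultimately show ?thesis unfolding padic_integer_rats_def by blast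
qed

lemma Zp_uminus [intro!]: "x \<in> Zp \<Longrightarrow> - x \<in> Zp"
  using Zp_mult[of "of_int (-1)" x] Zp_of_int[of "-1"] by simp
lemma Zp_diff [intro!]: "x \<in> Zp \<Longrightarrow> y \<in> Zp \<Longrightarrow> x - y \<in> Zp"
  using Zp_add[of x "- y"] Zp_uminus[of y] by simp
lemma Zp_power [intro!]: "x \<in> Zp \<Longrightarrow> x ^ n \<in> Zp"
  by (induction n) auto
lemma Zp_sum [intro!]: "(\<And>i. i \<in> A \<Longrightarrow> f i \<in> Zp) \<Longrightarrow> sum f A \<in> Zp"
  by (induction A rule: infinite_finite_induct) auto
lemma Zp_prod [intro!]: "(\<And>i. i \<in> A \<Longrightarrow> f i \<in> Zp) \<Longrightarrow> prod f A \<in> Zp"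
  by (induction A rule: infinite_finite_induct) auto

lemma unit_nz: "unit x \<Longrightarrow> x \<noteq> 0" unfolding unit_def by auto
lemma unit_Zp: "unit x \<Longrightarrow> x \<in> Zp" unfolding unit_def padic_integer_rats_def by blast
lemma unit_inverse: "unit x \<Longrightarrow> unit (inverse x)"
  unfolding unit_def by (metis inverse_divide)
lemma unit_mult [intro!]: "unit x \<Longrightarrow> unit y \<Longrightarrow> unit (x * y)"
  unfolding unit_def by (metis dvd_mult_int of_int_mult times_divide_times_eq)
lemma unit_uminus [intro!]: "unit x \<Longrightarrow> unit (- x)"
  unfolding unit_def by (metis dvd_minus_iff minus_divide_left of_int_minus)
lemma unit_divide [intro!]: "unit x \<Longrightarrow> unit y \<Longrightarrow> unit (x / y)"
  by (simp add: divide_inverse unit_inverse unit_mult)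
lemma Zp_divide [intro!]: "x \<in> Zp \<Longrightarrow> unit y \<Longrightarrow> x / y \<in> Zp"
  by (simp add: divide_inverse Zp_mult unit_Zp unit_inverse)
lemma unit_of_int_iff: "unit (of_int a) \<longleftrightarrow> \<not> int p dvd a"
proof
  assume "unit (of_int a)"
  then obtain c d where "of_int a = (of_int c :: rat) / of_int d" "\<not> int p dvd c" "\<not> int p dvd d"
    unfolding unit_def by blast
  then have "of_int (a * d) = (of_int c :: rat)" by (auto simp: field_simps)
  then have "a * d = c" using of_int_eq_iff by blast
  with \<open>\<not> int p dvd c\<close> show "\<not> int p dvd a" by auto
next
  assume "\<not> int p dvd a"
  then show "unit (of_int a)" unfolding unit_def using p_gt_3
    by (intro exI[of _ a] exI[of _ 1]) auto
qed
lemma unit_of_nat_iff: "unit (of_nat a) \<longleftrightarrow> \<not> p dvd a"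
  using unit_of_int_iff[of "int a"] by simp
lemma unit_of_nat_less: "0 < a \<Longrightarrow> a < p \<Longrightarrow> unit (of_nat a)"
  unfolding unit_of_nat_iff using nat_dvd_not_less by blast
lemma unit_1 [simp, intro]: "unit 1" using unit_of_nat_less[of 1] p_gt_3 by simp
lemma unit_2 [simp, intro]: "unit 2" using unit_of_nat_less[of 2] p_gt_3 by simp
lemma unit_3 [simp, intro]: "unit 3" using unit_of_nat_less[of 3] p_gt_3 by simp
lemma unit_power [intro!]: "unit x \<Longrightarrow> unit (x ^ n)" by (induction n) auto
lemma unit_prod [intro!]: "(\<And>i. i \<in> A \<Longrightarrow> unit (f i)) \<Longrightarrow> unit (prod f A)"
  by (induction A rule: infinite_finite_induct) auto
lemma unit_numerals [simp, intro]:
  "unit 4" "unit 6" "unit 8" "unit 9" "unit 12" "unit 16" "unit 18" "unit 24" "unit 27" "unit 36" "unit 72"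
proof -
  have u: "unit (2 ^ a * 3 ^ b)" for a b by auto
  show "unit 4" "unit 6" "unit 8" "unit 9" "unit 12" "unit 16" "unit 18" "unit 24" "unit 27" "unit 36" "unit 72"
    using u[of 2 0] u[of 1 1] u[of 3 0] u[of 0 2] u[of 2 1] u[of 4 0] u[of 1 2] u[of 3 1] u[of 0 3] u[of 2 2] u[of 3 2]
    by simp_all
qed
lemma unit_fact: "n < p \<Longrightarrow> unit (fact n)"
  unfolding fact_prod of_nat_prod by (intro unit_prod unit_of_nat_less) auto

lemma unit_add_P: "unit x \<Longrightarrow> z \<in> Zp \<Longrightarrow> unit (x + P * z)"
proof -
  assume "unit x" "z \<in> Zp"
  then obtain a b c d where x: "x = of_int a / of_int b" "\<not> int p dvd a" "\<not> int p dvd b"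
    and z: "z = of_int c / of_int d" "\<not> int p dvd d"
    unfolding padic_integer_rats_def unit_def by blast
  have "b \<noteq> 0" "d \<noteq> 0" using x z by auto
  then have "x + P * z = of_int (a * d + int p * (b * c)) / of_int (b * d)"
    by (simp add: x z field_simps)
  moreover have "\<not> int p dvd b * d" using x z by (simp add: dvd_mult_int)
  moreover have "\<not> int p dvd a * d + int p * (b * c)"
    using x z by (simp add: dvd_add_left_iff dvd_mult_int)
  ultimately show ?thesis unfolding unit_def by blast
qed

lemma rat_cong_I: "x - y = P ^ r * z \<Longrightarrow> z \<in> Zp \<Longrightarrow> rat_cong p r x y"
  unfolding rat_cong_def by blast
lemma rat_cong_E: assumes "rat_cong p r x y" obtains z where "x = y + P ^ r * z" "z \<in> Zp"
  using assms unfolding rat_cong_def by (metis add.commute diff_add_cancel)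

lemma rc_refl [simp, intro]: "rat_cong p r x x" by (rule rat_cong_I[of _ _ _ 0]) auto
lemma rc_sym: "rat_cong p r x y \<Longrightarrow> rat_cong p r y x"
  by (erule rat_cong_E) (auto intro!: rat_cong_I[of _ _ _ "- z" for z] simp: algebra_simps)
lemma rc_trans [trans]: "rat_cong p r x y \<Longrightarrow> rat_cong p r y z \<Longrightarrow> rat_cong p r x z"
  by (elim rat_cong_E) (auto intro!: rat_cong_I[of _ _ _ "a + b" for a b] simp: algebra_simps)
lemma rc_eq_trans [trans]: "x = y \<Longrightarrow> rat_cong p r y z \<Longrightarrow> rat_cong p r x z" by simp
lemma rc_trans_eq [trans]: "rat_cong p r x y \<Longrightarrow> y = z \<Longrightarrow> rat_cong p r x z" by simp
lemma rc_add: "rat_cong p r x y \<Longrightarrow> rat_cong p r x' y' \<Longrightarrow> rat_cong p r (x + x') (y + y')"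
  by (elim rat_cong_E) (auto intro!: rat_cong_I[of _ _ _ "a + b" for a b] simp: algebra_simps)
lemma rc_minus: "rat_cong p r x y \<Longrightarrow> rat_cong p r (- x) (- y)"
  by (elim rat_cong_E) (auto intro!: rat_cong_I[of _ _ _ "- z" for z] simp: algebra_simps)
lemma rc_diff: "rat_cong p r x y \<Longrightarrow> rat_cong p r x' y' \<Longrightarrow> rat_cong p r (x - x') (y - y')"
  using rc_add[of r x y "- x'" "- y'"] rc_minus[of r x' y'] by simp
lemma rc_mult_left: "rat_cong p r x y \<Longrightarrow> c \<in> Zp \<Longrightarrow> rat_cong p r (c * x) (c * y)"
  by (elim rat_cong_E) (auto intro!: rat_cong_I[of _ _ _ "c * z" for z] simp: algebra_simps)
lemma rc_mult_right: "rat_cong p r x y \<Longrightarrow> c \<in> Zp \<Longrightarrow> rat_cong p r (x * c) (y * c)"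
  using rc_mult_left[of r x y c] by (simp add: mult.commute)
lemma rc_mult: "rat_cong p r x y \<Longrightarrow> rat_cong p r x' y' \<Longrightarrow> x \<in> Zp \<Longrightarrow> y' \<in> Zp \<Longrightarrow> rat_cong p r (x * x') (y * y')"
  using rc_mult_left[of r x' y' x] rc_mult_right[of r x y y'] rc_trans by blast
lemma rc_Zp: "rat_cong p r x y \<Longrightarrow> y \<in> Zp \<Longrightarrow> x \<in> Zp"
  by (erule rat_cong_E) auto
lemma rc_power: "rat_cong p r x y \<Longrightarrow> y \<in> Zp \<Longrightarrow> rat_cong p r (x ^ n) (y ^ n)"
  by (induction n) (auto intro!: rc_mult dest: rc_Zp)
lemma rc_sum: "(\<And>i. i \<in> A \<Longrightarrow> rat_cong p r (f i) (g i)) \<Longrightarrow> rat_cong p r (sum f A) (sum g A)"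
  by (induction A rule: infinite_finite_induct) (auto intro!: rc_add)
lemma rc_le: "rat_cong p r x y \<Longrightarrow> s \<le> r \<Longrightarrow> rat_cong p s x y"
  by (elim rat_cong_E) (auto intro!: rat_cong_I[of _ _ _ "P ^ (r - s) * z" for z] simp: mult.assoc[symmetric] power_add[symmetric])
text \<open>Only units may be cancelled; this is the reason for tracking them separately from nonzero
numbers.\<close>
lemma rc_cancel: "rat_cong p r (u * x) (u * y) \<Longrightarrow> unit u \<Longrightarrow> rat_cong p r x y"
  using rc_mult_left[of r "u * x" "u * y" "inverse u"] unit_nz[of u] unit_Zp[OF unit_inverse[of u]]
  by (simp add: mult.assoc[symmetric])
lemma rc_P_mult: "rat_cong p r x y \<Longrightarrow> rat_cong p (Suc r) (P * x) (P * y)"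
  by (elim rat_cong_E) (auto intro!: rat_cong_I simp: algebra_simps)
lemma rc_unit: "rat_cong p r x y \<Longrightarrow> r \<ge> 1 \<Longrightarrow> unit y \<Longrightarrow> unit x"
proof (elim rat_cong_E)
  fix z assume "x = y + P ^ r * z" "z \<in> Zp" "r \<ge> 1" "unit y"
  moreover from \<open>r \<ge> 1\<close> have "P ^ r * z = P * (P ^ (r - 1) * z)"
    by (cases r) simp_all
  ultimately show "unit x" using unit_add_P[of y "P ^ (r - 1) * z"] by auto
qed
lemma rc_divide:
  assumes "rat_cong p r x y" "rat_cong p r u v" "unit u" "unit v" "y \<in> Zp"
  shows "rat_cong p r (x / u) (y / v)"
proof -
  have "rat_cong p r (v * x) (u * y)"
    using rc_mult[OF rc_sym[OF assms(2)] assms(1)] assms unit_Zp by blast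
  then have "rat_cong p r ((u * v) * (x / u)) ((u * v) * (y / v))"
    using assms(3,4)[THEN unit_nz] by (simp add: field_simps)
  then show ?thesis using rc_cancel assms by blast
qed
lemma rc0_iff: "rat_cong p r x 0 \<longleftrightarrow> (\<exists>z\<in>Zp. x = P ^ r * z)"
  unfolding rat_cong_def by simp
lemma rc_diff_0: "rat_cong p r x y \<longleftrightarrow> rat_cong p r (x - y) 0"
  unfolding rat_cong_def by simp
lemma rc0_P: "z \<in> Zp \<Longrightarrow> rat_cong p r (P ^ r * z) 0"
  unfolding rc0_iff by blast
lemma rc1_P: "z \<in> Zp \<Longrightarrow> rat_cong p (Suc 0) (P * z) 0"
  unfolding rc0_iff by auto

lemma rc_of_int: "[a = b] (mod int p ^ r) \<Longrightarrow> rat_cong p r (of_int a) (of_int b)"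
proof -
  assume "[a = b] (mod int p ^ r)"
  then obtain c where "a - b = int p ^ r * c" by (metis cong_iff_dvd_diff dvdE)
  then have "of_int a - of_int b = P ^ r * (of_int c :: rat)"
    by (metis of_int_diff of_int_mult of_int_of_nat_eq of_int_power)
  then show ?thesis by (rule rat_cong_I) auto
qed

end

section \<open>The products of 1 + e p / j modulo p cubed\<close>

context padic_prime
begin

text \<open>The exponential series truncated after the quadratic term, which is a homomorphism from
\<open>p \<int>\<^sub>p\<close> to the units modulo \<open>p\<^sup>3\<close> since the neglected terms have valuation at least 3.\<close>
definition E :: "rat \<Rightarrow> rat" where "E x = 1 + x + x\<^sup>2 / 2"

lemma E_Zp: "x \<in> Zp \<Longrightarrow> E x \<in> Zp" unfolding E_def by auto
lemma E_0 [simp]: "E 0 = 1" by (simp add: E_def)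

lemma E_add: "rat_cong p 1 x 0 \<Longrightarrow> rat_cong p 1 y 0 \<Longrightarrow> E x * E y \<simeq>\<^sub>3 E (x + y)"
proof -
  assume "rat_cong p 1 x 0" "rat_cong p 1 y 0"
  then obtain a b where ab: "x = P * a" "y = P * b" "a \<in> Zp" "b \<in> Zp"
    unfolding rc0_iff by auto
  have "E x * E y - E (x + y) = P ^ 3 * (a\<^sup>2 * b / 2 + a * b\<^sup>2 / 2 + P * a\<^sup>2 * b\<^sup>2 / 4)"
    unfolding E_def ab by (simp add: field_simps power2_eq_square power3_eq_cube)
  then show ?thesis by (rule rat_cong_I) (use ab in auto)
qed

lemma E_unit: "rat_cong p 1 x 0 \<Longrightarrow> unit (E x)"
proof -
  assume "rat_cong p 1 x 0"
  then obtain a where a: "x = P * a" "a \<in> Zp" unfolding rc0_iff by auto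
  have "E x = 1 + P * (a + P * a\<^sup>2 / 2)"
    unfolding E_def a by (simp add: field_simps power2_eq_square)
  then show ?thesis using unit_add_P[of 1 "a + P * a\<^sup>2 / 2"] a by auto
qed

lemma E_cong: "rat_cong p r x y \<Longrightarrow> y \<in> Zp \<Longrightarrow> rat_cong p r (E x) (E y)"
  unfolding E_def by (intro rc_add rc_refl rc_divide rc_power) auto

lemma E_inverse: "rat_cong p 1 x 0 \<Longrightarrow> 1 / E x \<simeq>\<^sub>3 E (- x)"
proof -
  assume x: "rat_cong p 1 x 0"
  have "E x * E (- x) \<simeq>\<^sub>3 E (x + - x)" using x rc_minus[OF x] by (intro E_add) auto
  then have "E x * (1 / E x) \<simeq>\<^sub>3 E x * E (- x)"
    using unit_nz[OF E_unit[OF x]] by (simp add: rc_sym)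
  then show ?thesis using rc_cancel E_unit[OF x] by blast
qed

definition H :: "nat \<Rightarrow> rat" where "H N = (\<Sum>j=1..N. 1 / of_nat j)"
definition H2 :: "nat \<Rightarrow> rat" where "H2 N = (\<Sum>j=1..N. 1 / (of_nat j)\<^sup>2)"
text \<open>The quotient of the rising factorial of \<open>1 + e p\<close> by the factorial. It measures how far a
factorial-like product shifted by \<open>e p\<close> is from the unshifted one.\<close>
definition br :: "nat \<Rightarrow> rat \<Rightarrow> rat" where "br N e = (\<Prod>j=1..N. 1 + e * P / of_nat j)"
text \<open>The logarithm of \<open>br N e\<close> modulo \<open>p\<^sup>3\<close>.\<close>
definition lbr :: "nat \<Rightarrow> rat \<Rightarrow> rat" where "lbr N e = e * (P * H N) - e\<^sup>2 / 2 * (P\<^sup>2 * H2 N)"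

lemma H_Zp: "N < p \<Longrightarrow> H N \<in> Zp" unfolding H_def
  by (intro Zp_sum Zp_divide unit_of_nat_less) auto
lemma H2_Zp: "N < p \<Longrightarrow> H2 N \<in> Zp" unfolding H2_def
  by (intro Zp_sum Zp_divide unit_power unit_of_nat_less) auto
lemma lbr_eq: "lbr N e = P * (e * H N - e\<^sup>2 / 2 * (P * H2 N))"
  unfolding lbr_def by (simp add: algebra_simps power2_eq_square)
lemma lbr_0: "N < p \<Longrightarrow> e \<in> Zp \<Longrightarrow> rat_cong p 1 (lbr N e) 0"
  unfolding lbr_eq One_nat_def by (intro rc1_P) (auto intro!: H_Zp H2_Zp)

text \<open>Each factor \<open>1 + p z\<close> is \<open>E (p z - p\<^sup>2 z\<^sup>2 / 2)\<close> modulo \<open>p\<^sup>3\<close>, and the arguments add up.\<close>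
lemma br_E: "N < p \<Longrightarrow> e \<in> Zp \<Longrightarrow> br N e \<simeq>\<^sub>3 E (lbr N e)"
proof (induction N)
  case 0
  show ?case by (simp add: br_def lbr_def H_def H2_def)
next
  case (Suc N)
  define z where "z = e / of_nat (Suc N)"
  have z: "z \<in> Zp" unfolding z_def using Suc.prems by (intro Zp_divide unit_of_nat_less) auto
  define y where "y = P * z - P\<^sup>2 * z\<^sup>2 / 2"
  have y0: "rat_cong p 1 y 0"
  proof -
    have "y = P * (z - P * z\<^sup>2 / 2)" unfolding y_def by (simp add: algebra_simps power2_eq_square)
    then show ?thesis using rc1_P[of "z - P * z\<^sup>2 / 2"] z by auto
  qed
  have yE: "1 + P * z \<simeq>\<^sub>3 E y"
    by (rule rc_sym, rule rat_cong_I[of _ _ _ "- (z ^ 3) / 2 + P * z ^ 4 / 8"])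
       (use z in \<open>auto simp: E_def y_def field_simps power2_eq_square eval_nat_numeral\<close>)
  have "br (Suc N) e = br N e * (1 + P * z)"
    unfolding br_def z_def by (simp add: mult.commute)
  also have "\<dots> \<simeq>\<^sub>3 E (lbr N e) * E y"
    using Suc y0 z by (intro rc_mult yE E_Zp) (auto simp: br_def y_def intro!: Zp_prod unit_of_nat_less)
  also have "\<dots> \<simeq>\<^sub>3 E (lbr N e + y)"
    using Suc.prems y0 by (intro E_add lbr_0) auto
  also have "lbr N e + y = lbr (Suc N) e"
  proof -
    define i :: rat where "i = 1 / of_nat (Suc N)"
    have "H (Suc N) = H N + i" "H2 (Suc N) = H2 N + i\<^sup>2" "z = e * i"
      unfolding H_def H2_def i_def z_def by (simp_all add: power_one_over)
    then show ?thesis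
      unfolding lbr_def y_def by (simp add: field_simps power2_eq_square)
  qed
  finally show ?case .
qed

lemma br_unit: "N < p \<Longrightarrow> e \<in> Zp \<Longrightarrow> unit (br N e)"
  using rc_unit[OF br_E] E_unit[OF lbr_0] by simp
lemma br_cong1: "N < p \<Longrightarrow> e \<in> Zp \<Longrightarrow> br N e \<simeq>\<^sub>1 1"
  using rc_trans[OF rc_le[OF br_E] E_cong[OF lbr_0]] by simp

lemma br_pochhammer: "pochhammer (1 + e * P) N = fact N * br N e"
proof (induction N)
  case (Suc N)
  have "1 + e * P + of_nat N = of_nat (Suc N) * (1 + e * P / of_nat (Suc N))"
    by (simp add: distrib_left del: of_nat_Suc)
  then show ?case by (simp add: pochhammer_Suc Suc br_def)
qed (simp add: br_def)

text \<open>\<open>a\<close> is a logarithm of \<open>x\<close> modulo \<open>p\<^sup>3\<close>. With this relation quotients of products \<open>br\<close> are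
computed by adding their logarithms.\<close>
definition logc :: "rat \<Rightarrow> rat \<Rightarrow> bool" where
  "logc x a \<longleftrightarrow> x \<simeq>\<^sub>3 E a \<and> a \<simeq>\<^sub>1 0"

lemma logc_unit: "logc x a \<Longrightarrow> unit x"
  unfolding logc_def using rc_unit E_unit by auto
lemma cong1_0_Zp: "a \<simeq>\<^sub>1 0 \<Longrightarrow> a \<in> Zp" using rc_Zp by blast
lemma logc_mult: "logc x a \<Longrightarrow> logc y b \<Longrightarrow> logc (x * y) (a + b)"
  unfolding logc_def
  by (meson E_Zp E_add E_unit cong1_0_Zp le_refl numeral_One one_le_numeral rc_Zp rc_add[where y = 0 and y' = 0, simplified] rc_mult rc_trans)
lemma logc_inverse: "logc x a \<Longrightarrow> logc (1 / x) (- a)"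
  using rc_divide[OF rc_refl[of 3 1], of x "E a"] logc_unit[of x a] E_inverse[of a] E_unit[of a] rc_minus[of 1 a 0]
  unfolding logc_def by (auto intro: rc_trans)
lemma logc_divide: "logc x a \<Longrightarrow> logc y b \<Longrightarrow> logc (x / y) (a - b)"
  using logc_mult[of x a "1 / y" "- b"] logc_inverse[of y b] by simp
lemma logc_power2: "logc x a \<Longrightarrow> logc (x\<^sup>2) (2 * a)"
  using logc_mult[of x a x a] by (simp add: power2_eq_square)
lemma logc_br: "N < p \<Longrightarrow> e \<in> Zp \<Longrightarrow> logc (br N e) (lbr N e)"
  unfolding logc_def using br_E lbr_0 by simp
lemma logc_cong: "logc x a \<Longrightarrow> a \<simeq>\<^sub>3 b \<Longrightarrow> logc x b"
  unfolding logc_def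
proof safe
  assume a: "x \<simeq>\<^sub>3 E a" "a \<simeq>\<^sub>1 0" "a \<simeq>\<^sub>3 b"
  show b: "b \<simeq>\<^sub>1 0" using rc_trans[OF rc_sym[OF rc_le[OF a(3), of 1]] a(2)] by simp
  show "x \<simeq>\<^sub>3 E b" using rc_trans[OF a(1) E_cong[OF a(3) cong1_0_Zp[OF b]]] .
qed
lemma logc_cong2: "logc x a \<Longrightarrow> a \<simeq>\<^sub>2 0 \<Longrightarrow> x \<simeq>\<^sub>2 1"
  unfolding logc_def using rc_trans[OF rc_le[of 3 x "E a" 2] E_cong[of 2 a 0]] by simp

end

section \<open>Isolating the denominator divisible by p\<close>

context padic_prime
begin

definition n :: nat where "n = (p - 1) div 2"
abbreviation h :: rat where "h \<equiv> of_nat n"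

lemma p_odd: "odd p" using prime_p p_gt_3 prime_odd_nat by force
lemma p_eq: "p = 2 * n + 1" unfolding n_def using p_odd p_gt_3 by presburger
lemma P_eq: "P = 2 * h + 1" using p_eq by (metis of_nat_1 of_nat_add of_nat_mult of_nat_numeral)
lemma h_eq: "h = (P - 1) / 2" unfolding P_eq by simp
lemma n_less: "n < p" using p_eq by simp

text \<open>The weights \<open>v4\<close> and \<open>v16\<close> agree with \<open>T p\<close> and \<open>T (- p)\<close> modulo \<open>p\<^sup>2\<close> for \<open>k \<le> n\<close>. They arise by replacing
the parameters of \<open>T\<close> with parameters that make the series balanced and terminating at \<open>n\<close>.\<close>
definition v4 :: "nat \<Rightarrow> rat" where
  "v4 k = pochhammer (- h) k * pochhammer (1 / 2) k / (fact k * pochhammer (1 / 2 - h) k)"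
definition v16 :: "nat \<Rightarrow> rat" where
  "v16 k = pochhammer (- h) k * pochhammer (1 / 2 + P) k / (fact k * pochhammer (1 / 2 + P - h) k)"

lemma shift_half: "1 / 2 - h = 1 + (- 1 / 2) * P" "1 / 2 + P - h = 1 + (1 / 2) * P"
  unfolding h_eq by (simp_all add: field_simps)

text \<open>The analogue of \<open>br\<close> for a falling product that starts at \<open>n + f p\<close>.\<close>
definition half_br :: "rat \<Rightarrow> nat \<Rightarrow> rat" where "half_br f k = br n f / br (n - k) f"

lemma pochhammer_half:
  assumes "k \<le> n" "f \<in> Zp"
  shows "pochhammer (- h - f * P) k = (- 1) ^ k * (fact n / fact (n - k)) * half_br f k"
proof -
  have "pochhammer (1 + f * P) (n - k + k) = pochhammer (1 + f * P) (n - k) * pochhammer (1 + f * P + of_nat (n - k)) k"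
    by (rule pochhammer_product')
  then have "fact n * br n f = fact (n - k) * br (n - k) f * pochhammer (1 + f * P + of_nat (n - k)) k"
    using assms(1) by (simp add: br_pochhammer)
  moreover have "br (n - k) f \<noteq> 0" using assms n_less by (intro unit_nz br_unit) auto
  ultimately have 1: "pochhammer (1 + f * P + of_nat (n - k)) k = (fact n / fact (n - k)) * half_br f k"
    unfolding half_br_def by (simp add: field_simps)
  have "pochhammer (- h - f * P) k = pochhammer (- (h + f * P)) k" by simp
  also have "\<dots> = (- 1) ^ k * pochhammer (h + f * P - of_nat k + 1) k" by (rule pochhammer_minus)
  also have "h + f * P - of_nat k + 1 = 1 + f * P + of_nat (n - k)" using assms(1) by (simp add: of_nat_diff)
  finally show ?thesis unfolding 1 by simp
qed

lemma logc_half_br: "f \<in> Zp \<Longrightarrow> logc (half_br f k) (lbr n f - lbr (n - k) f)"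
  unfolding half_br_def by (intro logc_divide logc_br) (use n_less in auto)

lemma unit_half_br: "f \<in> Zp \<Longrightarrow> unit (half_br f k)" using logc_unit logc_half_br by blast

text \<open>The correction factors between \<open>T\<close> and the weights \<open>v4\<close>, \<open>v16\<close>. The shifts add up to 0 in each
of them, which makes the logarithm a multiple of \<open>p\<^sup>2\<close>.\<close>
definition rho4 :: "nat \<Rightarrow> rat" where "rho4 k = br k 1 * (br k (- 1 / 2))\<^sup>2"
definition rho16 :: "nat \<Rightarrow> rat" where
  "rho16 k = (half_br (- 1 / 2) k * half_br (- 1) k / (half_br 0 k * half_br (- 3 / 2) k)) * (br k (- 1) * (br k (1 / 2))\<^sup>2)"

text \<open>With \<open>a = p\<close> the parameter \<open>(1 - a) / 2\<close> equals \<open>- n\<close>, so the series stops at \<open>n\<close>.\<close>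
lemma T_eq_4: "k < p \<Longrightarrow> T P k = v4 k * rho4 k"
proof -
  assume k: "k < p"
  have "br k (- 1 / 2) \<noteq> 0" using k by (intro unit_nz br_unit) auto
  moreover have "(1 - P) / 2 = - h" "1 - P / 2 = 1 + (- 1 / 2) * P" "1 + P = 1 + 1 * P"
    unfolding h_eq by (simp_all add: field_simps)
  ultimately show ?thesis
    unfolding T_def v4_def rho4_def shift_half br_pochhammer
    by (simp only: br_pochhammer) (simp add: field_simps power2_eq_square eval_nat_numeral)
qed

text \<open>With \<open>a = - p\<close> the series stops at \<open>p - 1\<close> rather than at \<open>n\<close>, so the identity is confined to \<open>k \<le> n\<close>. The four parameters near \<open>- n\<close> differ by multiples of \<open>p / 2\<close>.\<close>
lemma T_eq_16: "k \<le> n \<Longrightarrow> T (- P) k = v16 k * rho16 k"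
proof -
  assume k: "k \<le> n"
  then have kp: "k < p" using n_less by simp
  have nz: "br k (1 / 2) \<noteq> 0" "half_br 0 k \<noteq> 0" "half_br (- 3 / 2) k \<noteq> 0" "half_br (- 1 / 2) k \<noteq> 0" "half_br (- 1) k \<noteq> 0"
    using kp by (auto intro!: unit_nz br_unit unit_half_br)
  have e: "(1 + P) / 2 = - h - (- 1) * P" "1 / 2 = - h - (- 1 / 2) * P" "1 / 2 + P = - h - (- 3 / 2) * P"
     "- h = - h - 0 * P" "1 - P = 1 + (- 1) * P" "1 + P / 2 = 1 + (1 / 2) * P"
    unfolding h_eq by (simp_all add: field_simps)
  have z: "0 \<in> Zp" "- 1 \<in> Zp" "- 1 / 2 \<in> Zp" "- 3 / 2 \<in> Zp" by auto
  note ph = pochhammer_half[OF k z(1)] pochhammer_half[OF k z(2)] pochhammer_half[OF k z(3)] pochhammer_half[OF k z(4)]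
  have t: "pochhammer (1 / 2) k = (- 1) ^ k * (fact n / fact (n - k)) * half_br (- 1 / 2) k"
    "pochhammer ((1 + P) / 2) k = (- 1) ^ k * (fact n / fact (n - k)) * half_br (- 1) k"
    "pochhammer (1 / 2 + P) k = (- 1) ^ k * (fact n / fact (n - k)) * half_br (- 3 / 2) k"
    "pochhammer (- h) k = (- 1) ^ k * (fact n / fact (n - k)) * half_br 0 k"
    using ph e by metis+
  have b: "pochhammer (1 - P) k = fact k * br k (- 1)" "pochhammer (1 + P / 2) k = fact k * br k (1 / 2)"
    using br_pochhammer e(5,6) by metis+
  have T: "T (- P) k = pochhammer (1 / 2) k * pochhammer (1 - P) k * pochhammer ((1 + P) / 2) k
     * pochhammer (1 + P / 2) k / fact k ^ 4" unfolding T_def by simp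
  have v: "v16 k = pochhammer (- h) k * pochhammer (1 / 2 + P) k / (fact k * (fact k * br k (1 / 2)))"
    unfolding v16_def shift_half br_pochhammer ..
  show ?thesis unfolding T v t b rho16_def using nz
    by (simp add: field_simps power2_eq_square eval_nat_numeral)
qed

lemma rho4_logc: "k < p \<Longrightarrow> logc (rho4 k) (- 3 / 4 * (P\<^sup>2 * H2 k))"
proof -
  assume k: "k < p"
  have "logc (rho4 k) (lbr k 1 + 2 * lbr k (- 1 / 2))"
    unfolding rho4_def using k by (intro logc_mult logc_power2 logc_br) auto
  also have "lbr k 1 + 2 * lbr k (- 1 / 2) = - 3 / 4 * (P\<^sup>2 * H2 k)"
    unfolding lbr_def by (simp add: field_simps)
  finally show ?thesis .
qed

lemma rho16_logc: "k < p \<Longrightarrow> logc (rho16 k) (- 3 / 4 * (P\<^sup>2 * H2 k) + 1 / 2 * (P\<^sup>2 * H2 n - P\<^sup>2 * H2 (n - k)))"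
proof -
  assume k: "k < p"
  have "logc (rho16 k) (((lbr n (- 1 / 2) - lbr (n - k) (- 1 / 2)) + (lbr n (- 1) - lbr (n - k) (- 1))
      - ((lbr n 0 - lbr (n - k) 0) + (lbr n (- 3 / 2) - lbr (n - k) (- 3 / 2)))) + (lbr k (- 1) + 2 * lbr k (1 / 2)))"
    unfolding rho16_def using k by (intro logc_mult logc_divide logc_power2 logc_br logc_half_br) auto
  also have "((lbr n (- 1 / 2) - lbr (n - k) (- 1 / 2)) + (lbr n (- 1) - lbr (n - k) (- 1))
      - ((lbr n 0 - lbr (n - k) 0) + (lbr n (- 3 / 2) - lbr (n - k) (- 3 / 2)))) + (lbr k (- 1) + 2 * lbr k (1 / 2))
    = - 3 / 4 * (P\<^sup>2 * H2 k) + 1 / 2 * (P\<^sup>2 * H2 n - P\<^sup>2 * H2 (n - k))"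
    unfolding lbr_def by (simp add: field_simps)
  finally show ?thesis .
qed

lemma rho4_cong2: "k < p \<Longrightarrow> rho4 k \<simeq>\<^sub>2 1"
  by (rule logc_cong2[OF rho4_logc]) (auto simp: rc0_iff intro!: bexI[of _ "- 3 / 4 * H2 k"] H2_Zp)

lemma rho16_cong2: "k < p \<Longrightarrow> rho16 k \<simeq>\<^sub>2 1"
  using n_less
  by (intro logc_cong2[OF rho16_logc])
     (auto simp: rc0_iff algebra_simps intro!: bexI[of _ "- 3 / 4 * H2 k + 1 / 2 * (H2 n - H2 (n - k))"] H2_Zp)

lemma Zp_pochhammer: "x \<in> Zp \<Longrightarrow> pochhammer x k \<in> Zp"
  unfolding pochhammer_prod by auto

lemma v4_Zp: "k < p \<Longrightarrow> v4 k \<in> Zp"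
  unfolding v4_def shift_half br_pochhammer
  by (auto intro!: Zp_pochhammer unit_fact br_unit)
lemma v16_Zp: "k < p \<Longrightarrow> v16 k \<in> Zp"
  unfolding v16_def shift_half br_pochhammer
  by (auto intro!: Zp_pochhammer unit_fact br_unit)

text \<open>A summand with a unit denominator carries the factor \<open>p\<close>, so \<open>rho\<close> may be changed modulo \<open>p\<^sup>2\<close>
there. The common value \<open>c\<close> is chosen to be correct at the index with a critical denominator.\<close>
lemma weighted_sum_cong:
  assumes "\<And>k. k \<le> n \<Longrightarrow> v k \<in> Zp" "\<And>k. k \<le> n \<Longrightarrow> rho k \<simeq>\<^sub>2 1" "c \<simeq>\<^sub>2 1"
    and "\<And>k. k \<le> n \<Longrightarrow> unit (d k) \<or> rho k = c"
  shows "P * (\<Sum>k\<le>n. v k * rho k / d k) \<simeq>\<^sub>3 (P * (\<Sum>k\<le>n. v k / d k)) * c"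
proof -
  have "(\<Sum>k\<le>n. P * (v k * rho k / d k)) \<simeq>\<^sub>3 (\<Sum>k\<le>n. P * (v k * c / d k))"
  proof (rule rc_sum)
    fix k assume "k \<in> {..n}"
    then have k: "k \<le> n" by simp
    show "P * (v k * rho k / d k) \<simeq>\<^sub>3 P * (v k * c / d k)"
    proof (cases "rho k = c")
      case False
      then have d: "unit (d k)" using assms(4) k by blast
      have "rho k \<simeq>\<^sub>2 c" using assms(2)[OF k] assms(3) rc_sym rc_trans by blast
      then have "v k * rho k / d k \<simeq>\<^sub>2 v k * c / d k"
        using d assms(1)[OF k] rc_Zp[OF assms(3)] by (intro rc_divide rc_mult_left) auto
      from rc_P_mult[OF this] show ?thesis by simp
    qed simp
  qed
  then show ?thesis by (simp add: sum_distrib_left sum_distrib_right mult_ac)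
qed

lemma sum_v4:
  assumes "z > 0"
  shows "(\<Sum>k\<le>n. v4 k / (z + of_nat k)) = fact n * pochhammer (z + 1 / 2) n / (pochhammer (1 / 2) n * (z * pochhammer (z + 1) n))"
proof -
  have "pochhammer (1 / 2 - h) k \<noteq> 0" if "k \<le> n" for k
    unfolding shift_half br_pochhammer using that n_less by (auto intro!: unit_nz unit_fact br_unit)
  moreover have "pochhammer (1 - 1 / 2 :: rat) n \<noteq> 0" by (simp add: pochhammer_eq_0_iff)
  moreover have "z + of_nat k \<noteq> 0" for k using assms of_nat_0_le_iff[of k, where ?'a = rat] by linarith
  ultimately have "(\<Sum>k\<le>n. pochhammer (- h) k * pochhammer (1 / 2) k / (fact k * pochhammer (1 / 2 - h) k) / (z + of_nat k))
     = fact n * pochhammer (z + 1 - 1 / 2) n / (pochhammer (1 - 1 / 2) n * (z * pochhammer (z + 1) n))"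
    by (intro saalschutz_partial_fractions) auto
  then show ?thesis unfolding v4_def by (simp add: field_simps)
qed

lemma sum_v16:
  assumes "z > 0"
  shows "(\<Sum>k\<le>n. v16 k / (z + of_nat k)) = fact n * pochhammer (z + 1 / 2 - P) n / (pochhammer (1 / 2 - P) n * (z * pochhammer (z + 1) n))"
proof -
  have "pochhammer (1 / 2 + P - h) k \<noteq> 0" if "k \<le> n" for k
    unfolding shift_half br_pochhammer using that n_less by (auto intro!: unit_nz unit_fact br_unit)
  moreover have "pochhammer (1 - (1 / 2 + P)) n \<noteq> 0"
  proof -
    have "1 - (1 / 2 + P) = - h - (1 / 2) * P" unfolding h_eq by (simp add: field_simps)
    then have "pochhammer (1 - (1 / 2 + P)) n = (- 1) ^ n * (fact n / fact (n - n)) * half_br (1 / 2) n"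
      using pochhammer_half[of n "1 / 2"] by auto
    then show ?thesis using unit_nz[OF unit_half_br[of "1 / 2" n]] by auto
  qed
  moreover have "z + of_nat k \<noteq> 0" for k using assms of_nat_0_le_iff[of k, where ?'a = rat] by linarith
  ultimately have "(\<Sum>k\<le>n. pochhammer (- h) k * pochhammer (1 / 2 + P) k / (fact k * pochhammer (1 / 2 + P - h) k) / (z + of_nat k))
     = fact n * pochhammer (z + 1 - (1 / 2 + P)) n / (pochhammer (1 - (1 / 2 + P)) n * (z * pochhammer (z + 1) n))"
    by (intro saalschutz_partial_fractions) auto
  moreover have "z + 1 - (1 / 2 + P) = z + 1 / 2 - P" "1 - (1 / 2 + P) = 1 / 2 - P" by (simp_all add: field_simps)
  ultimately show ?thesis unfolding v16_def by simp
qed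

end

section \<open>Harmonic sums and reflection at p\<close>

context padic_prime
begin

lemma sum_shift_diff:
  fixes g :: "nat \<Rightarrow> rat"
  assumes "m \<le> N"
  shows "(\<Sum>i=1..m. g (N + 1 - i)) = (\<Sum>j=1..N. g j) - (\<Sum>j=1..N - m. g j)"
  using assms
proof (induction m)
  case (Suc m)
  then obtain r where r: "N = Suc m + r" using le_Suc_ex by blast
  have "N - m = Suc (N - Suc m)" using r by simp
  then show ?case using Suc r by simp
qed simp

lemma H_double: "H (2 * m) = H m / 2 + (\<Sum>i=1..m. 1 / (2 * of_nat i - 1))"
  by (induction m) (simp_all add: H_def field_simps)

lemma H2_double: "H2 (2 * m) = H2 m / 4 + (\<Sum>i=1..m. 1 / (2 * of_nat i - 1)\<^sup>2)"
proof (induction m)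
  case (Suc m)
  have "H2 (2 * Suc m) = H2 (2 * m) + 1 / (of_nat (2 * m + 1))\<^sup>2 + 1 / (of_nat (2 * Suc m))\<^sup>2"
    by (simp add: H2_def)
  also have "1 / (of_nat (2 * Suc m))\<^sup>2 = 1 / (of_nat (Suc m))\<^sup>2 / (4 :: rat)"
    by (simp only: of_nat_mult power_mult_distrib) simp
  also have "of_nat (2 * m + 1) = 2 * of_nat (Suc m) - (1 :: rat)" by simp
  finally show ?case using Suc by (simp add: H2_def)
qed (simp add: H2_def)

lemma odd_as_P_minus:
  assumes "1 \<le> i" "i \<le> n"
  shows "2 * of_nat i - 1 = P - 2 * of_nat (n + 1 - i)"
  using assms unfolding P_eq by (simp add: of_nat_diff)

lemma unit_P_minus: "unit x \<Longrightarrow> unit (P - x)"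
  using unit_add_P[of "- x" 1] by auto

text \<open>For \<open>i \<le> n\<close> the odd number \<open>2 i - 1\<close> is \<open>p - 2 (n + 1 - i)\<close>, so the odd part of \<open>H (2 m)\<close> is a
harmonic sum again after expanding in powers of \<open>p\<close>.\<close>
lemma duplication_H:
  assumes "m \<le> n"
  shows "H (2 * m) \<simeq>\<^sub>2 H m / 2 - (H n - H (n - m)) / 2 - P / 4 * (H2 n - H2 (n - m))"
proof -
  have "(\<Sum>i=1..m. 1 / (2 * of_nat i - 1)) = (\<Sum>i=1..m. 1 / (P - 2 * of_nat (n + 1 - i)))"
    using assms by (intro sum.cong refl) (simp add: odd_as_P_minus)
  also have "\<dots> \<simeq>\<^sub>2 (\<Sum>i=1..m. - (1 / of_nat (n + 1 - i)) / 2 - P / 4 * (1 / (of_nat (n + 1 - i))\<^sup>2))"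
  proof (rule rc_sum)
    fix i assume "i \<in> {1..m}"
    then have "0 < n + 1 - i" "n + 1 - i < p" using assms n_less by auto
    then have u: "unit (of_nat (n + 1 - i))" by (rule unit_of_nat_less)
    define l where "l = (of_nat (n + 1 - i) :: rat)"
    have ul: "unit l" using u unfolding l_def .
    then have ul2: "unit (P - 2 * l)" by (intro unit_P_minus unit_mult unit_2)
    have nz: "l \<noteq> 0" "P - 2 * l \<noteq> 0" using unit_nz ul ul2 by blast+
    have "1 / (P - 2 * l) - (- (1 / l) / 2 - P / 4 * (1 / l\<^sup>2)) = P ^ 2 * (1 / (4 * l\<^sup>2 * (P - 2 * l)))"
    proof -
      have "4 * l\<^sup>2 * (P - 2 * l) * (1 / (P - 2 * l) - (- (1 / l) / 2 - P / 4 * (1 / l\<^sup>2)))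
         = 4 * l\<^sup>2 + 2 * l * (P - 2 * l) + P * (P - 2 * l)"
        using nz by (simp add: divide_simps) (simp add: algebra_simps power2_eq_square)
      also have "\<dots> = P ^ 2" by Groebner_Basis.algebra
      finally show ?thesis using nz by (simp add: nonzero_eq_divide_eq mult.commute)
    qed
    then show "1 / (P - 2 * of_nat (n + 1 - i)) \<simeq>\<^sub>2 - (1 / of_nat (n + 1 - i)) / 2 - P / 4 * (1 / (of_nat (n + 1 - i))\<^sup>2)"
      unfolding l_def[symmetric] by (rule rat_cong_I) (use ul ul2 in auto)
  qed
  also have "(\<Sum>i=1..m. - (1 / of_nat (n + 1 - i)) / 2 - P / 4 * (1 / (of_nat (n + 1 - i))\<^sup>2))
     = - (\<Sum>i=1..m. 1 / of_nat (n + 1 - i)) / 2 - P / 4 * (\<Sum>i=1..m. 1 / (of_nat (n + 1 - i))\<^sup>2)"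
    by (simp add: sum_subtractf sum_distrib_left sum_divide_distrib sum_negf)
  also have "\<dots> = - (H n - H (n - m)) / 2 - P / 4 * (H2 n - H2 (n - m))"
    unfolding H_def H2_def using sum_shift_diff[OF assms, of "\<lambda>j. 1 / of_nat j"]
      sum_shift_diff[OF assms, of "\<lambda>j. 1 / (of_nat j)\<^sup>2"] by simp
  finally have "(\<Sum>i=1..m. 1 / (2 * of_nat i - 1)) \<simeq>\<^sub>2 - (H n - H (n - m)) / 2 - P / 4 * (H2 n - H2 (n - m))" .
  from rc_add[OF rc_refl[of 2 "H m / 2"] this] show ?thesis unfolding H_double
    by (simp only: add_diff_eq add_uminus_conv_diff minus_divide_left[symmetric])
qed

lemma duplication_H2:
  assumes "m \<le> n"
  shows "H2 (2 * m) \<simeq>\<^sub>1 H2 m / 4 + (H2 n - H2 (n - m)) / 4"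
proof -
  have "(\<Sum>i=1..m. 1 / (2 * of_nat i - 1)\<^sup>2) = (\<Sum>i=1..m. 1 / (P - 2 * of_nat (n + 1 - i))\<^sup>2)"
    using assms by (intro sum.cong refl) (simp add: odd_as_P_minus)
  also have "\<dots> \<simeq>\<^sub>1 (\<Sum>i=1..m. 1 / (- 2 * of_nat (n + 1 - i))\<^sup>2)"
  proof (rule rc_sum)
    fix i assume "i \<in> {1..m}"
    then have "0 < n + 1 - i" "n + 1 - i < p" using assms n_less by auto
    then have u: "unit (of_nat (n + 1 - i))" by (rule unit_of_nat_less)
    show "1 / (P - 2 * of_nat (n + 1 - i))\<^sup>2 \<simeq>\<^sub>1 1 / (- 2 * of_nat (n + 1 - i))\<^sup>2"
      by (intro rc_divide rc_power rc_refl rat_cong_I[of _ _ _ 1] unit_power unit_P_minus)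
         (use u in \<open>auto intro!: unit_Zp[OF u] simp: unit_uminus\<close>)
  qed
  also have "(\<Sum>i=1..m. 1 / (- 2 * of_nat (n + 1 - i))\<^sup>2) = (\<Sum>i=1..m. 1 / (of_nat (n + 1 - i))\<^sup>2) / (4 :: rat)"
    by (simp add: power_mult_distrib sum_divide_distrib mult.commute)
  also have "\<dots> = (H2 n - H2 (n - m)) / 4"
    unfolding H2_def using sum_shift_diff[OF assms, of "\<lambda>j. 1 / (of_nat j)\<^sup>2"] by simp
  finally show ?thesis unfolding H2_double by (intro rc_add rc_refl)
qed

lemma reflect_sum_diff:
  fixes g :: "nat \<Rightarrow> rat"
  assumes "a + b = p - 1"
  shows "(\<Sum>j=1..p - 1. g j) - (\<Sum>j=1..a. g j) = (\<Sum>i=1..b. g (p - i))"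
proof -
  have e: "p - 1 - b = a" "b \<le> p - 1" "p - 1 + 1 = p" using assms p_pos by auto
  show ?thesis using sum_shift_diff[OF e(2), of g] unfolding e by simp
qed

text \<open>Duplication at \<open>m = n\<close> and the reflection \<open>j \<mapsto> p - j\<close> give two different relations between
the sums up to \<open>n\<close> and \<open>p - 1\<close>, and these have only the trivial solution.\<close>
lemma H2_half: "H2 n \<simeq>\<^sub>1 0" and H2_p_minus_1: "H2 (p - 1) \<simeq>\<^sub>1 0"
proof -
  have pn: "p - 1 = 2 * n" using p_eq by simp
  have a: "H2 (p - 1) \<simeq>\<^sub>1 H2 n / 2"
    using duplication_H2[of n] unfolding pn by (simp add: H2_def)
  have "H2 (p - 1) - H2 n = (\<Sum>i=1..n. 1 / (of_nat (p - i))\<^sup>2)"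
    unfolding H2_def by (rule reflect_sum_diff) (use pn in simp)
  also have "\<dots> = (\<Sum>i=1..n. 1 / (P - of_nat i)\<^sup>2)"
    using n_less by (intro sum.cong refl) (simp add: of_nat_diff)
  also have "\<dots> \<simeq>\<^sub>1 (\<Sum>i=1..n. 1 / (- of_nat i)\<^sup>2)"
  proof (rule rc_sum)
    fix i assume "i \<in> {1..n}"
    then have u: "unit (of_nat i)" using n_less by (intro unit_of_nat_less) auto
    show "1 / (P - of_nat i)\<^sup>2 \<simeq>\<^sub>1 1 / (- of_nat i)\<^sup>2"
      by (intro rc_divide rc_power rc_refl rat_cong_I[of _ _ _ 1] unit_power unit_P_minus)
         (use u in \<open>auto simp: unit_uminus\<close>)
  qed
  also have "\<dots> = H2 n" by (simp add: H2_def)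
  finally have b: "H2 (p - 1) - H2 n \<simeq>\<^sub>1 H2 n" .
  have "(H2 (p - 1) - H2 n) - H2 (p - 1) \<simeq>\<^sub>1 H2 n - H2 n / 2" by (rule rc_diff[OF b a])
  then have "- (H2 n) \<simeq>\<^sub>1 H2 n / 2" by simp
  then have "rat_cong p 1 (- (H2 n) - H2 n / 2) 0" using rc_diff_0 by blast
  then have "rat_cong p 1 ((- 3 / 2) * H2 n) ((- 3 / 2) * 0)" by simp
  then show "H2 n \<simeq>\<^sub>1 0" by (rule rc_cancel) auto
  then have "H2 n / 2 \<simeq>\<^sub>1 0 / 2" by (intro rc_divide) auto
  with a show "H2 (p - 1) \<simeq>\<^sub>1 0" using rc_trans by simp
qed

text \<open>Wolstenholme's congruence modulo \<open>p\<^sup>2\<close>, by pairing \<open>j\<close> with \<open>p - j\<close>.\<close>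
lemma H_p_minus_1: "H (p - 1) \<simeq>\<^sub>2 0"
proof -
  have "H (p - 1) = (\<Sum>i=1..p - 1. 1 / of_nat (p - i))"
    using reflect_sum_diff[of 0 "p - 1" "\<lambda>j. 1 / of_nat j"] by (simp add: H_def)
  also have "\<dots> = (\<Sum>i=1..p - 1. 1 / (P - of_nat i))"
    by (intro sum.cong refl) (auto simp: of_nat_diff)
  finally have "2 * H (p - 1) = (\<Sum>i=1..p - 1. 1 / of_nat i + 1 / (P - of_nat i))"
    by (simp add: H_def sum.distrib)
  also have "\<dots> = P * (\<Sum>i=1..p - 1. 1 / (of_nat i * (P - of_nat i)))"
    unfolding sum_distrib_left
  proof (intro sum.cong refl)
    fix i assume "i \<in> {1..p - 1}"
    then have "unit (of_nat i)" by (intro unit_of_nat_less) auto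
    then have "of_nat i \<noteq> (0 :: rat)" "P - of_nat i \<noteq> 0" using unit_nz unit_P_minus by blast+
    then show "1 / of_nat i + 1 / (P - of_nat i) = P * (1 / (of_nat i * (P - of_nat i)))"
      by (simp add: divide_simps)
  qed
  also have "\<dots> \<simeq>\<^sub>2 P * 0"
    unfolding numeral_2_eq_2
  proof (rule rc_P_mult)
    have "(\<Sum>i=1..p - 1. 1 / (of_nat i * (P - of_nat i))) \<simeq>\<^sub>1 (\<Sum>i=1..p - 1. 1 / (of_nat i * (- of_nat i)))"
    proof (rule rc_sum)
      fix i assume "i \<in> {1..p - 1}"
      then have u: "unit (of_nat i)" by (intro unit_of_nat_less) auto
      show "1 / (of_nat i * (P - of_nat i)) \<simeq>\<^sub>1 1 / (of_nat i * (- of_nat i))"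
        by (intro rc_divide rc_mult_left rc_refl rat_cong_I[of _ _ _ 1] unit_mult unit_P_minus)
           (use u in \<open>auto simp: unit_uminus\<close>)
    qed
    also have "(\<Sum>i=1..p - 1. 1 / (of_nat i * (- of_nat i))) = - H2 (p - 1)"
      by (simp add: H2_def power2_eq_square sum_negf)
    also have "\<dots> \<simeq>\<^sub>1 0" using rc_minus[OF H2_p_minus_1] by simp
    finally show "rat_cong p (Suc 0) (\<Sum>i=1..p - 1. 1 / (of_nat i * (P - of_nat i))) 0" by simp
  qed
  finally have "2 * H (p - 1) \<simeq>\<^sub>2 2 * 0" by simp
  then show ?thesis by (rule rc_cancel) simp
qed

lemma P_rc: "rat_cong p 1 x y \<Longrightarrow> P * x \<simeq>\<^sub>2 P * y" "rat_cong p 2 x y \<Longrightarrow> P * x \<simeq>\<^sub>3 P * y"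
    "rat_cong p 1 x y \<Longrightarrow> P\<^sup>2 * x \<simeq>\<^sub>3 P\<^sup>2 * y"
  using rc_P_mult[of 1 x y] rc_P_mult[of 2 x y] rc_P_mult[OF rc_P_mult[of 1 x y]]
  by (simp_all add: numeral_2_eq_2 numeral_3_eq_3 mult.assoc)

lemma logc_br_p_minus_1: "e \<in> Zp \<Longrightarrow> logc (br (p - 1) e) 0"
proof -
  assume e: "e \<in> Zp"
  have "lbr (p - 1) e \<simeq>\<^sub>3 e * (P * 0) - e\<^sup>2 / 2 * (P\<^sup>2 * 0)"
    unfolding lbr_def using e H2_p_minus_1 H_p_minus_1 by (intro rc_diff rc_mult_left P_rc) auto
  then show ?thesis using logc_cong[OF logc_br[of "p - 1" e]] e p_pos by simp
qed

text \<open>The factors with \<open>j > a\<close> are indexed by \<open>p - i\<close> with \<open>i \<le> b\<close>, and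
\<open>(1 + e p / (p - i)) (1 - p / i) = 1 - (1 + e) p / i\<close>.\<close>
lemma br_reflect:
  assumes "a + b = p - 1" "e \<in> Zp"
  shows "br (p - 1) e * br b (- 1) = br a e * br b (- (1 + e))"
proof -
  have "(\<Prod>j=1..a. 1 + e * P / of_nat j) * (\<Prod>i=1..b. 1 + e * P / of_nat (p - i)) = (\<Prod>j=1..p - 1. 1 + e * P / of_nat j)"
  proof -
    have 1: "(\<Prod>i=1..b. g (p - i)) = (\<Prod>j\<in>{a + 1..p - 1}. g j)" for g :: "nat \<Rightarrow> rat"
      by (rule prod.reindex_bij_witness[of _ "\<lambda>j. p - j" "\<lambda>j. p - j"]) (use assms in auto)
    have 2: "(\<Prod>j=1..p - 1. g j) = (\<Prod>j=1..a. g j) * (\<Prod>j\<in>{a + 1..p - 1}. g j)" for g :: "nat \<Rightarrow> rat"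
    proof -
      have "{1..p - 1} = {1..a} \<union> {a + 1..p - 1}" using assms by auto
      then show ?thesis by (simp only:) (rule prod.union_disjoint, auto)
    qed
    show ?thesis using 1[of "\<lambda>j. 1 + e * P / of_nat j"] 2[of "\<lambda>j. 1 + e * P / of_nat j"] by (simp only:)
  qed
  then have "br (p - 1) e * br b (- 1) = br a e * (\<Prod>i=1..b. (1 + e * P / of_nat (p - i)) * (1 + (- 1) * P / of_nat i))"
    unfolding br_def prod.distrib by (simp add: mult.assoc)
  also have "(\<Prod>i=1..b. (1 + e * P / of_nat (p - i)) * (1 + (- 1) * P / of_nat i)) = br b (- (1 + e))"
    unfolding br_def
  proof (intro prod.cong refl)
    fix i assume i: "i \<in> {1..b}"
    then have ip: "i < p" "i > 0" using assms p_pos by auto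
    then have "of_nat (p - i) = P - of_nat i" by (simp add: of_nat_diff)
    moreover have "P - of_nat i \<noteq> 0" "of_nat i \<noteq> (0 :: rat)" using ip by auto
    ultimately show "(1 + e * P / of_nat (p - i)) * (1 + (- 1) * P / of_nat i) = 1 + (- (1 + e)) * P / of_nat i"
      by (simp add: divide_simps) (simp add: algebra_simps)
  qed
  finally show ?thesis .
qed

lemma fact_reflect:
  assumes "a + b = p - 1"
  shows "(fact (p - 1) :: rat) = (- 1) ^ b * fact a * fact b * br b (- 1)"
proof -
  have P: "P = of_nat a + of_nat b + 1"
  proof -
    have "p = a + b + 1" using assms p_pos by simp
    then have "P = of_nat (a + b + 1)" by (simp only:)
    then show ?thesis by simp
  qed
  have "fact b * br b (- 1) = pochhammer (- (P - 1)) b"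
    by (simp flip: br_pochhammer)
  also have "\<dots> = (- 1) ^ b * pochhammer (P - 1 - of_nat b + 1) b" by (rule pochhammer_minus)
  also have "P - 1 - of_nat b + 1 = 1 + of_nat a" by (simp add: P)
  finally have 1: "fact b * br b (- 1) = (- 1) ^ b * pochhammer (1 + of_nat a) b" .
  have "pochhammer 1 (a + b) = pochhammer 1 a * pochhammer (1 + of_nat a :: rat) b"
    by (rule pochhammer_product')
  then have "fact (p - 1) = fact a * pochhammer (1 + of_nat a :: rat) b"
    unfolding assms by (simp only: pochhammer_fact)
  also have "\<dots> = fact a * ((- 1) ^ b * (fact b * br b (- 1)))"
    unfolding 1 by (simp add: mult.assoc[symmetric] flip: power_mult_distrib)
  finally show ?thesis by (simp only: mult_ac)
qed

text \<open>The three lemmas from here evaluate a Pochhammer symbol that starts near an integer: above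
it, ending just below a multiple of \<open>p\<close>, or running through that multiple.\<close>
lemma pochhammer_up:
  assumes "a + N < p" "e \<in> Zp"
  shows "pochhammer (of_nat a + 1 + e * P) N = fact (a + N) * br (a + N) e / (fact a * br a e)"
proof -
  have "pochhammer (1 + e * P) (a + N) = pochhammer (1 + e * P) a * pochhammer (1 + e * P + of_nat a) N"
    by (rule pochhammer_product')
  moreover have "br a e \<noteq> 0" using assms by (intro unit_nz br_unit) auto
  ultimately show ?thesis unfolding br_pochhammer by (simp add: field_simps)
qed

lemma pochhammer_down:
  "pochhammer (- of_nat a + e * P) a = (- 1) ^ a * (fact a * br a (- e))"
proof -
  have "pochhammer (- of_nat a + e * P) a = pochhammer (- (of_nat a - e * P)) a" by simp
  also have "\<dots> = (- 1) ^ a * pochhammer (of_nat a - e * P - of_nat a + 1) a" by (rule pochhammer_minus)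
  also have "of_nat a - e * P - of_nat a + 1 = 1 + (- e) * P" by simp
  finally show ?thesis unfolding br_pochhammer by simp
qed

lemma pochhammer_through_P:
  "pochhammer (- of_nat a + e * P) (a + Suc b) = (- 1) ^ a * fact a * br a (- e) * (e * P) * (fact b * br b e)"
proof -
  have "pochhammer (- of_nat a + e * P) (a + Suc b)
     = pochhammer (- of_nat a + e * P) a * pochhammer (- of_nat a + e * P + of_nat a) (Suc b)"
    by (rule pochhammer_product')
  also have "pochhammer (- of_nat a + e * P + of_nat a) (Suc b) = e * P * pochhammer (1 + e * P) b"
    by (simp add: pochhammer_rec add.commute)
  finally show ?thesis unfolding br_pochhammer pochhammer_down by (simp add: mult_ac)
qed

end

section \<open>The truncated sums modulo p cubed\<close>

context padic_prime
begin

lemma cong1_1_mult: "x \<simeq>\<^sub>1 1 \<Longrightarrow> y \<simeq>\<^sub>1 1 \<Longrightarrow> x * y \<simeq>\<^sub>1 1"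
  using rc_mult[of 1 x 1 y 1] rc_Zp[of 1 x 1] by auto
lemma cong1_1_divide: "x \<simeq>\<^sub>1 1 \<Longrightarrow> y \<simeq>\<^sub>1 1 \<Longrightarrow> x / y \<simeq>\<^sub>1 1"
  using rc_divide[of 1 x 1 y 1] rc_unit[of 1 y 1] by auto

text \<open>Saalschuetz's theorem at \<open>z = c / 3\<close>; the relevant values of \<open>c\<close> are 1 and 2.\<close>
lemma central_sum_v4:
  assumes c: "c > 0"
  shows "(\<Sum>k\<le>n. v4 k / (3 * of_nat k + c))
     = fact n * pochhammer (c / 3 + 1 / 2) n / (pochhammer (1 / 2) n * (c * pochhammer (c / 3 + 1) n))"
proof -
  have e: "3 * of_nat k + c = (c / 3 + of_nat k) * 3" for k by simp
  have "(\<Sum>k\<le>n. v4 k / (3 * of_nat k + c)) = (\<Sum>k\<le>n. v4 k / (c / 3 + of_nat k)) / 3"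
    unfolding e divide_divide_eq_left[symmetric] sum_divide_distrib ..
  then show ?thesis using sum_v4[of "c / 3"] c by simp
qed

lemma central_sum_v16:
  assumes c: "c > 0"
  shows "(\<Sum>k\<le>n. v16 k / (3 * of_nat k + c))
     = fact n * pochhammer (c / 3 + 1 / 2 - P) n / (pochhammer (1 / 2 - P) n * (c * pochhammer (c / 3 + 1) n))"
proof -
  have e: "3 * of_nat k + c = (c / 3 + of_nat k) * 3" for k by simp
  have "(\<Sum>k\<le>n. v16 k / (3 * of_nat k + c)) = (\<Sum>k\<le>n. v16 k / (c / 3 + of_nat k)) / 3"
    unfolding e divide_divide_eq_left[symmetric] sum_divide_distrib ..
  then show ?thesis using sum_v16[of "c / 3"] c by simp
qed

lemma T_4_zero: "n < k \<Longrightarrow> k < p \<Longrightarrow> T P k = 0"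
  using T_eq_4[of k] pochhammer_of_nat_eq_0_lemma[of n k, where ?'a = rat] by (simp add: v4_def)

lemma sum_T_4: "(\<Sum>k<p. T P k / d k) = (\<Sum>k\<le>n. v4 k * rho4 k / d k)"
proof -
  have "(\<Sum>k<p. T P k / d k) = (\<Sum>k\<le>n. T P k / d k)"
    by (rule sum.mono_neutral_right) (use n_less T_4_zero in auto)
  also have "\<dots> = (\<Sum>k\<le>n. v4 k * rho4 k / d k)"
    using n_less by (intro sum.cong refl) (simp add: T_eq_4)
  finally show ?thesis .
qed

lemma sum_T_16: "(\<Sum>k<p. T (- P) k / d k) = (\<Sum>k\<le>n. v16 k * rho16 k / d k) + (\<Sum>k\<in>{n<..<p}. T (- P) k / d k)"
proof -
  have s: "{..<p} = {..n} \<union> {n<..<p}" using n_less by auto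
  have "(\<Sum>k<p. T (- P) k / d k) = (\<Sum>k\<le>n. T (- P) k / d k) + (\<Sum>k\<in>{n<..<p}. T (- P) k / d k)"
    by (subst s, rule sum.union_disjoint) auto
  also have "(\<Sum>k\<le>n. T (- P) k / d k) = (\<Sum>k\<le>n. v16 k * rho16 k / d k)"
    by (intro sum.cong refl) (simp add: T_eq_16)
  finally show ?thesis .
qed

lemma atLeast0_p: "{0..p - 1} = {..<p}" using p_pos by auto

lemma domb_sums_4:
  "(\<Sum>k=0..p - 1. of_nat (domb k) / 4 ^ k) = P * (\<Sum>k<p. T P k / (3 * of_nat k + 1))"
  "(\<Sum>k=0..p - 1. of_nat k * (of_nat (domb k) / 4 ^ k))
     = - 2 / 3 * (P * (\<Sum>k<p. T P k / (3 * of_nat k + 1))) + (1 / 3 + P) * (P * (\<Sum>k<p. T P k / (3 * of_nat k + 2)))"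
proof -
  show "(\<Sum>k=0..p - 1. of_nat (domb k) / 4 ^ k) = P * (\<Sum>k<p. T P k / (3 * of_nat k + 1))"
    unfolding atLeast0_p by (rule sum_domb_4)
  have "(\<Sum>k<p. T P k / (3 * of_nat k + 1) * (((3 * of_nat k + 1) * P - (of_nat k + 1)) / (3 * of_nat k + 2)))
    = (\<Sum>k<p. - 2 / 3 * (T P k / (3 * of_nat k + 1)) + (1 / 3 + P) * (T P k / (3 * of_nat k + 2)))"
  proof (intro sum.cong refl)
    fix k :: nat
    have "3 * of_nat k + 1 \<noteq> (0 :: rat)" "3 * of_nat k + 2 \<noteq> (0 :: rat)"
      using of_nat_0_le_iff[of k, where ?'a = rat] by linarith+
    then show "T P k / (3 * of_nat k + 1) * (((3 * of_nat k + 1) * P - (of_nat k + 1)) / (3 * of_nat k + 2))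
      = - 2 / 3 * (T P k / (3 * of_nat k + 1)) + (1 / 3 + P) * (T P k / (3 * of_nat k + 2))"
      by (simp add: divide_simps) (simp add: algebra_simps)
  qed
  then show "(\<Sum>k=0..p - 1. of_nat k * (of_nat (domb k) / 4 ^ k))
     = - 2 / 3 * (P * (\<Sum>k<p. T P k / (3 * of_nat k + 1))) + (1 / 3 + P) * (P * (\<Sum>k<p. T P k / (3 * of_nat k + 2)))"
    unfolding atLeast0_p sum_domb_4(2)
    by (simp only: sum.distrib sum_distrib_left[symmetric] distrib_left mult.left_commute[of P])
qed

lemma domb_sums_16:
  "(\<Sum>k=0..p - 1. of_nat (domb k) / 16 ^ k) = P * (\<Sum>k<p. T (- P) k / (3 * of_nat k + 1))"
  "(\<Sum>k=0..p - 1. of_nat k * (of_nat (domb k) / 16 ^ k))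
     = - 1 / 3 * (P * (\<Sum>k<p. T (- P) k / (3 * of_nat k + 1))) + (P - 1 / 3) * (P * (\<Sum>k<p. T (- P) k / (3 * of_nat k + 2)))"
proof -
  show "(\<Sum>k=0..p - 1. of_nat (domb k) / 16 ^ k) = P * (\<Sum>k<p. T (- P) k / (3 * of_nat k + 1))"
    unfolding atLeast0_p by (rule sum_domb_16)
  have "(\<Sum>k<p. T (- P) k / (3 * of_nat k + 1) * (((3 * of_nat k + 1) * P - (2 * of_nat k + 1)) / (3 * of_nat k + 2)))
    = (\<Sum>k<p. - 1 / 3 * (T (- P) k / (3 * of_nat k + 1)) + (P - 1 / 3) * (T (- P) k / (3 * of_nat k + 2)))"
  proof (intro sum.cong refl)
    fix k :: nat
    have "3 * of_nat k + 1 \<noteq> (0 :: rat)" "3 * of_nat k + 2 \<noteq> (0 :: rat)"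
      using of_nat_0_le_iff[of k, where ?'a = rat] by linarith+
    then show "T (- P) k / (3 * of_nat k + 1) * (((3 * of_nat k + 1) * P - (2 * of_nat k + 1)) / (3 * of_nat k + 2))
      = - 1 / 3 * (T (- P) k / (3 * of_nat k + 1)) + (P - 1 / 3) * (T (- P) k / (3 * of_nat k + 2))"
      by (simp add: divide_simps) (simp add: algebra_simps)
  qed
  then show "(\<Sum>k=0..p - 1. of_nat k * (of_nat (domb k) / 16 ^ k))
     = - 1 / 3 * (P * (\<Sum>k<p. T (- P) k / (3 * of_nat k + 1))) + (P - 1 / 3) * (P * (\<Sum>k<p. T (- P) k / (3 * of_nat k + 2)))"
    unfolding atLeast0_p sum_domb_16(2)
    by (simp only: sum.distrib sum_distrib_left[symmetric] distrib_left mult.left_commute[of P])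
qed

text \<open>Beyond \<open>n\<close> two of the Pochhammer symbols have passed a factor divisible by \<open>p\<close>, so these terms
start at \<open>p\<^sup>2\<close>.\<close>
lemma tail_eq:
  assumes "k = n + 1 + j" "k < p"
  shows "T (- P) k = P\<^sup>2 * (pochhammer (1 / 2) n * (pochhammer (h + 1) n * (fact j * br j (1 / 2)) * (fact j * br j 1))
     * br k (- 1) * br k (1 / 2) / (2 * (fact k)\<^sup>2))"
proof -
  have 1: "pochhammer (1 / 2) k = pochhammer (1 / 2) n * (P / 2 * pochhammer (1 + 1 / 2 * P) j)"
  proof -
    have "pochhammer (1 / 2) (n + Suc j) = pochhammer (1 / 2) n * pochhammer (1 / 2 + h) (Suc j)"
      by (rule pochhammer_product')
    also have "1 / 2 + h = P / 2" unfolding P_eq by (simp add: field_simps)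
    finally show ?thesis using assms(1) by (simp add: pochhammer_rec add.commute)
  qed
  have 2: "pochhammer ((1 + P) / 2) k = pochhammer (h + 1) n * (P * pochhammer (1 + 1 * P) j)"
  proof -
    have "pochhammer (h + 1) (n + Suc j) = pochhammer (h + 1) n * pochhammer (h + 1 + h) (Suc j)"
      by (rule pochhammer_product')
    also have "h + 1 + h = P" unfolding P_eq by simp
    finally have "pochhammer (h + 1) k = pochhammer (h + 1) n * (P * pochhammer (1 + 1 * P) j)"
      using assms(1) by (simp add: pochhammer_rec add.commute)
    moreover have q: "(1 + P) / 2 = h + 1" unfolding P_eq by (simp add: field_simps)
    ultimately show ?thesis unfolding q by simp
  qed
  have e: "1 + - P = 1 + (- 1) * P" "1 - - P / 2 = 1 + 1 / 2 * P" "(1 - - P) / 2 = (1 + P) / 2" by simp_all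
  show ?thesis
    unfolding T_def e 1 2 br_pochhammer
    by (simp add: divide_simps) (simp add: power2_eq_square eval_nat_numeral)
qed

lemma tail_Zp:
  assumes "n < k" "k < p"
  obtains u where "T (- P) k = P\<^sup>2 * u" "u \<in> Zp"
proof -
  obtain j where j: "k = n + 1 + j" using assms by (metis Suc_eq_plus1 Suc_leI le_Suc_ex)
  have jp: "j < p" using j assms by simp
  show ?thesis
    by (rule that[OF tail_eq[OF j assms(2)]])
       (use jp assms in \<open>auto intro!: Zp_pochhammer unit_fact unit_Zp[OF br_unit] unit_Zp[OF unit_fact]\<close>)
qed

end

context padic_prime
begin

lemma unit_of_nat_less_3p: "0 < a \<Longrightarrow> a < 3 * p \<Longrightarrow> a \<noteq> p \<Longrightarrow> a \<noteq> 2 * p \<Longrightarrow> unit (of_nat a)"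
  unfolding unit_of_nat_iff
proof
  assume a: "0 < a" "a < 3 * p" "a \<noteq> p" "a \<noteq> 2 * p" and "p dvd a"
  then obtain c where c: "a = p * c" by blast
  with a have "c < 3" "c \<noteq> 0" "c \<noteq> 1" "c \<noteq> 2" by auto
  then show False by linarith
qed

lemma of_nat_3k: "3 * of_nat k + 1 = (of_nat (3 * k + 1) :: rat)" "3 * of_nat k + 2 = (of_nat (3 * k + 2) :: rat)"
  by simp_all

text \<open>The telescoped sum carries the factor \<open>(N + 1) ^ 3\<close>, which is \<open>p\<^sup>3\<close> here.\<close>
lemma weighted_domb_4_cong_0:
  "(\<Sum>k=0..p - 1. (of_nat k + 1) * (3 * of_nat k + 2) * (of_nat (domb k) / 4 ^ k)) \<simeq>\<^sub>3 0"
proof -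
  have "of_nat (p - 1) + 1 = P" using p_pos by (simp add: of_nat_diff)
  then have "(\<Sum>k=0..p - 1. (of_nat k + 1) * (3 * of_nat k + 2) * (of_nat (domb k) / 4 ^ k))
     = P ^ 3 * ((32 * of_nat (domb (p - 1)) - 2 * of_nat (domb (Suc (p - 1)))) / (3 * 4 ^ Suc (p - 1)))"
    using domb_weighted_sum_4[of "p - 1"] by (simp only: atMost_atLeast0)
  also have "\<dots> \<simeq>\<^sub>3 0" by (rule rc0_P) (intro Zp_divide Zp_diff Zp_mult Zp_numeral Zp_of_nat unit_mult unit_power unit_numerals unit_3)
  finally show ?thesis .
qed

lemma weighted_domb_16_cong_0:
  "(\<Sum>k=0..p - 1. of_nat k * (3 * of_nat k + 1) * (of_nat (domb k) / 16 ^ k)) \<simeq>\<^sub>3 0"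
proof -
  have "of_nat (p - 1) + 1 = P" using p_pos by (simp add: of_nat_diff)
  then have "(\<Sum>k=0..p - 1. of_nat k * (3 * of_nat k + 1) * (of_nat (domb k) / 16 ^ k))
     = P ^ 3 * ((8 * of_nat (domb (Suc (p - 1))) - 32 * of_nat (domb (p - 1))) / (3 * 16 ^ Suc (p - 1)))"
    using domb_weighted_sum_16[of "p - 1"] by (simp only: atMost_atLeast0)
  also have "\<dots> \<simeq>\<^sub>3 0" by (rule rc0_P) (intro Zp_divide Zp_diff Zp_mult Zp_numeral Zp_of_nat unit_mult unit_power unit_numerals unit_3)
  finally show ?thesis .
qed

lemma square_sum_4:
  "(\<Sum>k=0..p - 1. of_nat k ^ 2 * (of_nat (domb k) / 4 ^ k)) \<simeq>\<^sub>3
     - (5 * (\<Sum>k=0..p - 1. of_nat k * (of_nat (domb k) / 4 ^ k)) + 2 * (\<Sum>k=0..p - 1. of_nat (domb k) / 4 ^ k)) / 3"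
    (is "?S2 \<simeq>\<^sub>3 - (5 * ?S1 + 2 * ?S0) / 3")
proof -
  have "(\<Sum>k=0..p - 1. (of_nat k + 1) * (3 * of_nat k + 2) * (of_nat (domb k) / 4 ^ k)) = 3 * ?S2 + (5 * ?S1 + 2 * ?S0)"
    unfolding sum_distrib_left sum.distrib[symmetric]
    by (intro sum.cong refl) (simp add: field_simps power2_eq_square)
  then have "3 * ?S2 + (5 * ?S1 + 2 * ?S0) - (5 * ?S1 + 2 * ?S0) \<simeq>\<^sub>3 0 - (5 * ?S1 + 2 * ?S0)"
    using weighted_domb_4_cong_0 by (intro rc_diff) auto
  moreover have "3 * ?S2 + (5 * ?S1 + 2 * ?S0) - (5 * ?S1 + 2 * ?S0) = 3 * ?S2"
    "0 - (5 * ?S1 + 2 * ?S0) = 3 * (- (5 * ?S1 + 2 * ?S0) / 3)" by simp_all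
  ultimately have "3 * ?S2 \<simeq>\<^sub>3 3 * (- (5 * ?S1 + 2 * ?S0) / 3)" by (simp only:)
  then show ?thesis by (rule rc_cancel) simp
qed

lemma square_sum_16:
  "(\<Sum>k=0..p - 1. of_nat k ^ 2 * (of_nat (domb k) / 16 ^ k)) \<simeq>\<^sub>3
     - (\<Sum>k=0..p - 1. of_nat k * (of_nat (domb k) / 16 ^ k)) / 3" (is "?S2 \<simeq>\<^sub>3 - ?S1 / 3")
proof -
  have "(\<Sum>k=0..p - 1. of_nat k * (3 * of_nat k + 1) * (of_nat (domb k) / 16 ^ k)) = 3 * ?S2 + ?S1"
    unfolding sum_distrib_left sum.distrib[symmetric]
    by (intro sum.cong refl) (simp add: field_simps power2_eq_square)
  then have "3 * ?S2 + ?S1 - ?S1 \<simeq>\<^sub>3 0 - ?S1"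
    using weighted_domb_16_cong_0 by (intro rc_diff) auto
  then have "3 * ?S2 \<simeq>\<^sub>3 3 * (- ?S1 / 3)" by simp
  then show ?thesis by (rule rc_cancel) simp
qed

lemma half_parameters: "pochhammer (1 / 2 :: rat) n = pochhammer (- h + (1 / 2) * P) n"
  "pochhammer (1 / 2 - P) n = pochhammer (- h + (- 1 / 2) * P) n"
proof -
  have 1: "- h + (1 / 2) * P = 1 / 2" using h_eq by (simp add: field_simps)
  have 2: "- h + (- 1 / 2) * P = 1 / 2 - P" using h_eq by (simp add: field_simps)
  show "pochhammer (1 / 2 :: rat) n = pochhammer (- h + (1 / 2) * P) n" unfolding 1 ..
  show "pochhammer (1 / 2 - P) n = pochhammer (- h + (- 1 / 2) * P) n" unfolding 2 ..
qed

text \<open>With a unit denominator the tail disappears modulo \<open>p\<^sup>3\<close>.\<close>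
lemma tail_zero:
  assumes "n < k" "k < p" "unit d"
  shows "P * (T (- P) k / d) \<simeq>\<^sub>3 0"
proof -
  obtain u where u: "T (- P) k = P\<^sup>2 * u" "u \<in> Zp" using tail_Zp assms by blast
  have e: "P * (T (- P) k / d) = P ^ 3 * (u / d)" unfolding u by (simp add: eval_nat_numeral)
  show ?thesis unfolding e by (rule rc0_P) (use u assms in auto)
qed

end

section \<open>Primes of the form 6m + 1: evaluating the products\<close>

locale padic_prime_1 = padic_prime +
  fixes m :: nat
  assumes p6: "p = 6 * m + 1"
begin

abbreviation M :: rat where "M \<equiv> of_nat m"
text \<open>The binomial coefficient whose square is the main factor of the sums, and whose first digit
is that of \<open>\<plusminus>2 x\<close>.\<close>
definition C :: rat where "C = of_nat ((3 * m) choose m)"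

lemma n_eq: "n = 3 * m" using p_eq p6 by linarith
lemma m_pos: "m > 0" using p6 p_gt_3 by simp
lemma P_M: "P = 6 * M + 1" by (subst p6) simp
lemma M_pos: "M > 0" using m_pos by simp
lemma C_fact: "C = fact n / (fact m * fact (2 * m))"
  unfolding C_def n_eq by (simp add: binomial_fact)
lemma C_unit: "unit C"
  unfolding C_fact n_eq using p6 by (intro unit_divide unit_mult unit_fact) auto
lemma M_unit: "unit M" using m_pos p6 by (intro unit_of_nat_less) auto

text \<open>The factor \<open>p / 3\<close> of this product belongs to the critical index \<open>2 m\<close>, where
\<open>3 k + 1 = p\<close>; it cancels the factor \<open>p\<close> in front of the sum.\<close>
lemma pochhammer_4_3: "pochhammer (4 / 3) n = fact (2 * m) * br (2 * m) (- 1 / 3) * P * (fact m * br m (1 / 3))"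
proof -
  obtain r where r: "2 * m = Suc r" using m_pos by (metis Suc_pred nat_0_less_mult_iff zero_less_numeral)
  have ne: "n = r + Suc m" using r n_eq by simp
  have rM: "of_nat r = 2 * M - 1"
    using arg_cong[OF r, of "of_nat :: nat \<Rightarrow> rat"] by simp
  have 43: "4 / 3 = - of_nat r + 1 / 3 * P" unfolding rM P_M by (simp add: field_simps)
  have "pochhammer (4 / 3) n = (- 1) ^ r * fact r * br r (- (1 / 3)) * (1 / 3 * P) * (fact m * br m (1 / 3))"
    unfolding 43 ne by (rule pochhammer_through_P)
  also have "(- 1 :: rat) ^ r = - 1" using r by (metis even_Suc even_mult_iff even_numeral power_minus_odd power_one)
  also have "- 1 * fact r * br r (- (1 / 3)) = 3 * (fact (2 * m) * br (2 * m) (- 1 / 3))"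
  proof -
    have "br (2 * m) (- 1 / 3) = br r (- 1 / 3) * (1 + - 1 / 3 * P / of_nat (Suc r))"
      unfolding r br_def by simp
    also have "1 + - 1 / 3 * P / of_nat (Suc r) = - 1 / (3 * of_nat (Suc r))"
      unfolding r[symmetric] P_M using M_pos by (simp add: field_simps)
    finally have "br (2 * m) (- 1 / 3) = br r (- 1 / 3) * (- 1 / (3 * of_nat (Suc r)))" .
    then show ?thesis unfolding r by (simp del: of_nat_Suc)
  qed
  finally show ?thesis by simp
qed

text \<open>Reflection at \<open>p\<close> turns the factorial of \<open>4 m\<close> into those of \<open>n\<close> and \<open>2 m\<close>, which leaves
\<open>C\<^sup>2\<close> and brackets.\<close>
lemma main_product:
  assumes e: "e \<in> Zp" and f: "f \<in> Zp"
  shows "P * (fact n * pochhammer (M + 1 + e * P) n / (pochhammer (- h + f * P) n * pochhammer (4 / 3) n))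
     = C\<^sup>2 * (br n (- 1) * br (p - 1) e
          / (br (2 * m) (- (1 + e)) * br m e * br n (- f) * br (2 * m) (- 1 / 3) * br m (1 / 3)))"
proof -
  have mm: "m + n = 4 * m" "4 * m < p" "2 * m < p" "m < p" using n_eq p6 by auto
  have up: "pochhammer (M + 1 + e * P) n = fact (4 * m) * br (4 * m) e / (fact m * br m e)"
    using pochhammer_up[of m n e] mm e by simp
  have nz: "br (2 * m) (- (1 + e)) \<noteq> 0" "br m e \<noteq> 0" "br n (- f) \<noteq> 0" "br (2 * m) (- 1 / 3) \<noteq> 0"
      "br m (1 / 3) \<noteq> 0" "br (2 * m) (- 1) \<noteq> 0" "br n (- 1) \<noteq> 0"
    using mm n_less e f by (auto intro!: unit_nz br_unit)
  have f4: "fact (4 * m) * fact (2 * m) * br (2 * m) (- 1) = (- 1) ^ n * (fact n)\<^sup>2 * br n (- 1)"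
    using fact_reflect[of "4 * m" "2 * m"] fact_reflect[of n n] p6 p_eq
    by (simp add: power2_eq_square)
  have b4: "br (p - 1) e * br (2 * m) (- 1) = br (4 * m) e * br (2 * m) (- (1 + e))"
    by (rule br_reflect) (use p6 e in auto)
  have F: "fact (4 * m) = (- 1) ^ n * (fact n)\<^sup>2 * br n (- 1) / (fact (2 * m) * br (2 * m) (- 1))"
    using f4 nz by (simp add: field_simps)
  have B: "br (4 * m) e = br (p - 1) e * br (2 * m) (- 1) / br (2 * m) (- (1 + e))"
    using b4 nz by (simp add: field_simps)
  have s: "(- 1) ^ n * (- 1) ^ n = (1 :: rat)" by (simp flip: power_mult_distrib)
  show ?thesis
    unfolding up pochhammer_down pochhammer_4_3 F B C_fact using nz s p_pos
    by (simp add: divide_simps) (simp add: power2_eq_square)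
qed

lemma pochhammer_5_3: "pochhammer (5 / 3) n = fact (5 * m + 1) * br (5 * m + 1) (- 1 / 3) / (fact (2 * m + 1) * br (2 * m + 1) (- 1 / 3))"
proof -
  have e: "5 / 3 = of_nat (2 * m + 1) + 1 + (- 1 / 3) * P" unfolding P_M by (simp add: field_simps)
  have a: "2 * m + 1 + n = 5 * m + 1" "5 * m + 1 < p" using n_eq p6 m_pos by auto
  show ?thesis unfolding e using pochhammer_up[of "2 * m + 1" n "- 1 / 3"] a by auto
qed

text \<open>The numerator passes through a multiple of \<open>p\<close> and nothing cancels it, so the leading term
suffices.\<close>
lemma second_product:
  assumes e: "e \<in> Zp" and f: "f \<in> Zp"
  shows "fact n * pochhammer (1 - M + e * P) n / (pochhammer (- h + f * P) n * (2 * pochhammer (5 / 3) n))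
     \<simeq>\<^sub>2 P * (12 * e / C\<^sup>2)"
proof -
  obtain r where r: "m = Suc r" using m_pos gr0_implies_Suc by blast
  have ne: "n = r + Suc (2 * m)" using r n_eq by simp
  have M1: "1 - M = - of_nat r" by (simp add: r)
  have mm: "m < p" "2 * m < p" "r < p" "5 * m + 1 < p" "2 * m + 1 < p" using p6 r m_pos by auto
  have th: "pochhammer (1 - M + e * P) n = (- 1) ^ r * fact r * br r (- e) * (e * P) * (fact (2 * m) * br (2 * m) e)"
    unfolding M1 ne by (rule pochhammer_through_P)
  have f5: "(- 1) ^ r * fact (5 * m + 1) * fact r * br r (- 1) = (- 1) ^ n * (fact n)\<^sup>2 * br n (- 1)"
    using fact_reflect[of "5 * m + 1" r] fact_reflect[of n n] p6 p_eq r by (simp add: power2_eq_square)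
  have nz: "br r (- 1) \<noteq> 0" "br n (- 1) \<noteq> 0" "br n (- f) \<noteq> 0" "br (5 * m + 1) (- 1 / 3) \<noteq> 0" "br (2 * m + 1) (- 1 / 3) \<noteq> 0"
    using mm n_less e f by (auto intro!: unit_nz br_unit)
  have s: "(- 1) ^ n * (- 1) ^ n = (1 :: rat)" "(- 1) ^ r * (- 1) ^ r = (1 :: rat)" by (simp_all flip: power_mult_distrib)
  have F: "fact (5 * m + 1) = (- 1) ^ n * (- 1) ^ r * (fact n)\<^sup>2 * br n (- 1) / (fact r * br r (- 1))"
  proof -
    have "(- 1) ^ r * ((- 1) ^ r * fact (5 * m + 1) * fact r * br r (- 1)) = (- 1) ^ r * ((- 1) ^ n * (fact n)\<^sup>2 * br n (- 1))"
      unfolding f5 ..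
    then have "((- 1) ^ r * (- 1) ^ r) * (fact (5 * m + 1) * fact r * br r (- 1)) = (- 1) ^ n * (- 1) ^ r * (fact n)\<^sup>2 * br n (- 1)"
      by (simp only: mult_ac)
    then show ?thesis unfolding s using nz by (simp add: field_simps)
  qed
  define B where "B = br r (- e) * br (2 * m) e * br r (- 1) * br (2 * m + 1) (- 1 / 3) / (br n (- 1) * br n (- f) * br (5 * m + 1) (- 1 / 3))"
  have B1: "B \<simeq>\<^sub>1 1"
    unfolding B_def using mm n_less e f by (intro cong1_1_mult cong1_1_divide br_cong1) auto
  have fr: "fact r = fact m / M" "fact (2 * m + 1) = (2 * M + 1) * fact (2 * m)"
    using M_pos by (simp_all add: r)
  have "fact n * pochhammer (1 - M + e * P) n / (pochhammer (- h + f * P) n * (2 * pochhammer (5 / 3) n))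
     = e * P / 2 * ((fact r)\<^sup>2 * fact (2 * m) * fact (2 * m + 1) / (fact n)\<^sup>2) * B"
    unfolding th pochhammer_down pochhammer_5_3 F B_def
    using nz s by (simp add: divide_simps) (simp add: power2_eq_square mult_ac)
  also have "(fact r)\<^sup>2 * fact (2 * m) * fact (2 * m + 1) / (fact n)\<^sup>2 = (2 * M + 1) / (M\<^sup>2 * C\<^sup>2)"
    unfolding fr C_fact using M_pos by (simp add: divide_simps) (simp add: power2_eq_square mult_ac)
  also have "e * P / 2 * ((2 * M + 1) / (M\<^sup>2 * C\<^sup>2)) * B = P * (e * (2 * M + 1) * B / (2 * M\<^sup>2) / C\<^sup>2)"
    by (simp add: field_simps)
  also have "\<dots> \<simeq>\<^sub>2 P * (12 * e / C\<^sup>2)"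
  proof (intro P_rc rc_divide rc_refl)
    have M6: "M \<simeq>\<^sub>1 - 1 / 6" by (rule rat_cong_I[of _ _ _ "1 / 6"]) (auto simp: P_M)
    have "2 * M + 1 \<simeq>\<^sub>1 2 / 3" by (rule rat_cong_I[of _ _ _ "1 / 3"]) (auto simp: P_M)
    then have "e * (2 * M + 1) * B / (2 * M\<^sup>2) \<simeq>\<^sub>1 e * (2 / 3) * 1 / (2 * (- 1 / 6)\<^sup>2)"
      using e M_unit rc_Zp[OF B1]
      by (intro rc_divide rc_mult_left rc_power M6 rc_mult[OF rc_mult_left B1]) auto
    then show "e * (2 * M + 1) * B / (2 * M\<^sup>2) \<simeq>\<^sub>1 12 * e" by (simp add: power2_eq_square)
  qed (use C_unit e in auto)
  finally show ?thesis .
qed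

lemma duplication_relation: "P * H (2 * m) + P * H n - P * H m - P\<^sup>2 * H2 (2 * m) / 2 \<simeq>\<^sub>3 0"
  and H2_relation: "P\<^sup>2 * H2 m - 5 * (P\<^sup>2 * H2 (2 * m)) \<simeq>\<^sub>3 0"
  and H2_n_relation: "P\<^sup>2 * H2 n \<simeq>\<^sub>3 0"
proof -
  have nm: "n - m = 2 * m" "m \<le> n" using n_eq by auto
  have z: "H2 n \<simeq>\<^sub>1 0" by (rule H2_half)
  have "H (2 * m) - (H m / 2 - (H n - H (2 * m)) / 2 - P / 4 * (H2 n - H2 (2 * m))) \<simeq>\<^sub>2 0"
    using duplication_H[of m] nm rc_diff_0 by simp
  then have 1: "P * (2 * (H (2 * m) - (H m / 2 - (H n - H (2 * m)) / 2 - P / 4 * (H2 n - H2 (2 * m))))) \<simeq>\<^sub>3 P * (2 * 0)"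
    by (intro P_rc rc_mult_left) auto
  show n3: "P\<^sup>2 * H2 n \<simeq>\<^sub>3 0" using P_rc(3)[OF z] by simp
  have "P\<^sup>2 * H2 n / 2 \<simeq>\<^sub>3 0 / 2" using n3 by (intro rc_divide) auto
  from rc_diff[OF 1 this]
  have "P * (2 * (H (2 * m) - (H m / 2 - (H n - H (2 * m)) / 2 - P / 4 * (H2 n - H2 (2 * m))))) - P\<^sup>2 * H2 n / 2 \<simeq>\<^sub>3 0"
    by simp
  also have "P * (2 * (H (2 * m) - (H m / 2 - (H n - H (2 * m)) / 2 - P / 4 * (H2 n - H2 (2 * m))))) - P\<^sup>2 * H2 n / 2
     = P * H (2 * m) + P * H n - P * H m - P\<^sup>2 * H2 (2 * m) / 2"
    by (simp add: field_simps power2_eq_square)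
  finally show "P * H (2 * m) + P * H n - P * H m - P\<^sup>2 * H2 (2 * m) / 2 \<simeq>\<^sub>3 0" .
  have "H2 (2 * m) \<simeq>\<^sub>1 H2 m / 4 + (H2 n - H2 (2 * m)) / 4" using duplication_H2[of m] nm by simp
  then have "H2 (2 * m) - (H2 m / 4 + (H2 n - H2 (2 * m)) / 4) \<simeq>\<^sub>1 0" using rc_diff_0 by simp
  then have 2: "P\<^sup>2 * (- 4 * (H2 (2 * m) - (H2 m / 4 + (H2 n - H2 (2 * m)) / 4))) \<simeq>\<^sub>3 P\<^sup>2 * (- 4 * 0)"
    by (intro P_rc(3) rc_mult_left) auto
  have "P\<^sup>2 * (- 4 * (H2 (2 * m) - (H2 m / 4 + (H2 n - H2 (2 * m)) / 4))) - P\<^sup>2 * H2 n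
     = P\<^sup>2 * H2 m - 5 * (P\<^sup>2 * H2 (2 * m))"
    by (simp add: field_simps)
  with rc_diff[OF 2 n3] show "P\<^sup>2 * H2 m - 5 * (P\<^sup>2 * H2 (2 * m)) \<simeq>\<^sub>3 0" by simp
qed

text \<open>Half of the logarithm of \<open>S\<^sub>0 / C\<^sup>2\<close>; the same number is the logarithm of \<open>- J / C\<close>.\<close>
definition lam :: rat where "lam = lbr n (- 1 / 2) - lbr (2 * m) (- 1 / 3) - lbr m (- 1 / 6)"

text \<open>All the congruences between logarithms that are needed follow from three linear relations among
the harmonic sums up to \<open>m\<close>, \<open>2 m\<close> and \<open>n = 3 m\<close>.\<close>
lemma cong_combination:
  assumes "x - y = a * (P * H (2 * m) + P * H n - P * H m - P\<^sup>2 * H2 (2 * m) / 2)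
      + b * (P\<^sup>2 * H2 m - 5 * (P\<^sup>2 * H2 (2 * m))) + c * (P\<^sup>2 * H2 n)"
    and "a \<in> Zp" "b \<in> Zp" "c \<in> Zp"
  shows "x \<simeq>\<^sub>3 y"
proof -
  have "x - y \<simeq>\<^sub>3 a * 0 + b * 0 + c * 0"
    unfolding assms(1) using assms(2-4)
    by (intro rc_add rc_mult_left duplication_relation H2_relation H2_n_relation)
  then show ?thesis using rc_diff_0 by simp
qed

text \<open>The bracket factors of the two truncated sums, including the correction factor at the critical
index.\<close>
definition X4 :: rat where
  "X4 = br n (- 1) * br (p - 1) (- 1 / 6)
     / (br (2 * m) (- (1 + - 1 / 6)) * br m (- 1 / 6) * br n (- (1 / 2)) * br (2 * m) (- 1 / 3) * br m (1 / 3)) * rho4 (2 * m)"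
definition X16 :: rat where
  "X16 = br n (- 1) * br (p - 1) (- 7 / 6)
     / (br (2 * m) (- (1 + - 7 / 6)) * br m (- 7 / 6) * br n (- (- 1 / 2)) * br (2 * m) (- 1 / 3) * br m (1 / 3)) * rho16 (2 * m)"

text \<open>The coefficients of the combination are determined by comparing the harmonic sums on both
sides.\<close>
lemma logc_X4: "logc X4 (2 * lam)"
proof (rule logc_cong)
  have mm: "m < p" "2 * m < p" "n < p" "p - 1 < p" using p6 n_less by auto
  show "logc X4 ((lbr n (- 1) + 0) - (lbr (2 * m) (- (1 + - 1 / 6)) + lbr m (- 1 / 6) + lbr n (- (1 / 2))
      + lbr (2 * m) (- 1 / 3) + lbr m (1 / 3)) + - 3 / 4 * (P\<^sup>2 * H2 (2 * m)))"
    unfolding X4_def using mm by (intro logc_mult logc_divide logc_br logc_br_p_minus_1 rho4_logc) auto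
  show "(lbr n (- 1) + 0) - (lbr (2 * m) (- (1 + - 1 / 6)) + lbr m (- 1 / 6) + lbr n (- (1 / 2))
      + lbr (2 * m) (- 1 / 3) + lbr m (1 / 3)) + - 3 / 4 * (P\<^sup>2 * H2 (2 * m)) \<simeq>\<^sub>3 2 * lam"
    by (rule cong_combination[where a = "1 / 2" and b = "1 / 24" and c = "- 1 / 8"])
       (auto simp: lam_def lbr_def field_simps power2_eq_square)
qed

lemma logc_X16: "logc X16 (2 * lam)"
proof (rule logc_cong)
  have mm: "m < p" "2 * m < p" "n < p" "p - 1 < p" using p6 n_less by auto
  have nm: "n - 2 * m = m" using n_eq by simp
  have "logc (rho16 (2 * m)) (- 3 / 4 * (P\<^sup>2 * H2 (2 * m)) + 1 / 2 * (P\<^sup>2 * H2 n - P\<^sup>2 * H2 m))"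
    using rho16_logc[of "2 * m"] mm unfolding nm by simp
  then show "logc X16 ((lbr n (- 1) + 0) - (lbr (2 * m) (- (1 + - 7 / 6)) + lbr m (- 7 / 6) + lbr n (- (- 1 / 2))
      + lbr (2 * m) (- 1 / 3) + lbr m (1 / 3)) + (- 3 / 4 * (P\<^sup>2 * H2 (2 * m)) + 1 / 2 * (P\<^sup>2 * H2 n - P\<^sup>2 * H2 m)))"
    unfolding X16_def using mm by (intro logc_mult logc_divide logc_br logc_br_p_minus_1) auto
  show "(lbr n (- 1) + 0) - (lbr (2 * m) (- (1 + - 7 / 6)) + lbr m (- 7 / 6) + lbr n (- (- 1 / 2))
      + lbr (2 * m) (- 1 / 3) + lbr m (1 / 3)) + (- 3 / 4 * (P\<^sup>2 * H2 (2 * m)) + 1 / 2 * (P\<^sup>2 * H2 n - P\<^sup>2 * H2 m)) \<simeq>\<^sub>3 2 * lam"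
    by (rule cong_combination[where a = "- 1 / 2" and b = "5 / 24" and c = "3 / 8"])
       (auto simp: lam_def lbr_def field_simps power2_eq_square)
qed

end

context padic_prime_1
begin

lemma central_parameters: "1 / 3 + 1 / 2 = M + 1 + (- 1 / 6) * P" "1 / 3 + 1 / 2 - P = M + 1 + (- 7 / 6) * P"
    "2 / 3 + 1 / 2 = 1 - M + (1 / 6) * P" "2 / 3 + 1 / 2 - P = 1 - M + (- 5 / 6) * P"
  using P_M by linarith+

lemma unit_3k_1:
  assumes "k < p" "k \<noteq> 2 * m"
  shows "unit (3 * of_nat k + 1)"
proof -
  have "3 * k + 1 \<noteq> 2 * p" by (simp only: p6) presburger
  then show ?thesis
    unfolding of_nat_3k using assms p6 by (intro unit_of_nat_less_3p) linarith+
qed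

lemma unit_3k_2:
  assumes "k < p" "k \<noteq> 4 * m"
  shows "unit (3 * of_nat k + 2)"
proof -
  have "3 * k + 2 \<noteq> p" by (simp only: p6) presburger
  then show ?thesis
    unfolding of_nat_3k using assms p6 by (intro unit_of_nat_less_3p) linarith+
qed

lemma domb_sum_4: "(\<Sum>k=0..p - 1. of_nat (domb k) / 4 ^ k) \<simeq>\<^sub>3 C\<^sup>2 * X4"
proof -
  have "(\<Sum>k=0..p - 1. of_nat (domb k) / 4 ^ k) = P * (\<Sum>k\<le>n. v4 k * rho4 k / (3 * of_nat k + 1))"
    unfolding domb_sums_4(1) sum_T_4 ..
  also have "\<dots> \<simeq>\<^sub>3 (P * (\<Sum>k\<le>n. v4 k / (3 * of_nat k + 1))) * rho4 (2 * m)"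
  proof (rule weighted_sum_cong)
    fix k assume "k \<le> n"
    then have k: "k < p" using n_less by simp
    then show "v4 k \<in> Zp" "rho4 k \<simeq>\<^sub>2 1" by (auto intro: v4_Zp rho4_cong2)
    show "unit (3 * of_nat k + 1) \<or> rho4 k = rho4 (2 * m)" using unit_3k_1[OF k] by auto
  qed (rule rho4_cong2, use p6 in linarith)
  also have "(P * (\<Sum>k\<le>n. v4 k / (3 * of_nat k + 1))) * rho4 (2 * m) = C\<^sup>2 * X4"
  proof -
    have "(\<Sum>k\<le>n. v4 k / (3 * of_nat k + 1)) = fact n * pochhammer (M + 1 + (- 1 / 6) * P) n
       / (pochhammer (- h + (1 / 2) * P) n * pochhammer (4 / 3) n)"
      using central_sum_v4[of 1] unfolding half_parameters central_parameters by simp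
    then have "P * (\<Sum>k\<le>n. v4 k / (3 * of_nat k + 1)) = C\<^sup>2 * (br n (- 1) * br (p - 1) (- 1 / 6)
     / (br (2 * m) (- (1 + - 1 / 6)) * br m (- 1 / 6) * br n (- (1 / 2)) * br (2 * m) (- 1 / 3) * br m (1 / 3)))"
      using main_product[of "- 1 / 6" "1 / 2"] by auto
    then show ?thesis unfolding X4_def by (simp only: mult.assoc)
  qed
  finally show ?thesis .
qed

text \<open>The tail does not contribute modulo \<open>p\<^sup>3\<close>: all its denominators \<open>3 k + 1\<close> are units.\<close>
lemma domb_sum_16: "(\<Sum>k=0..p - 1. of_nat (domb k) / 16 ^ k) \<simeq>\<^sub>3 C\<^sup>2 * X16"
proof -
  have "(\<Sum>k=0..p - 1. of_nat (domb k) / 16 ^ k) = P * (\<Sum>k\<le>n. v16 k * rho16 k / (3 * of_nat k + 1))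
      + (\<Sum>k\<in>{n<..<p}. P * (T (- P) k / (3 * of_nat k + 1)))"
    unfolding domb_sums_16(1) sum_T_16 distrib_left sum_distrib_left ..
  also have "\<dots> \<simeq>\<^sub>3 (P * (\<Sum>k\<le>n. v16 k / (3 * of_nat k + 1))) * rho16 (2 * m) + (\<Sum>k\<in>{n<..<p}. 0)"
  proof (intro rc_add rc_sum weighted_sum_cong)
    fix k assume "k \<le> n"
    then have k: "k < p" using n_less by simp
    then show "v16 k \<in> Zp" "rho16 k \<simeq>\<^sub>2 1" by (auto intro: v16_Zp rho16_cong2)
    show "unit (3 * of_nat k + 1) \<or> rho16 k = rho16 (2 * m)" using unit_3k_1[OF k] by auto
  next
    fix k assume "k \<in> {n<..<p}"
    then show "P * (T (- P) k / (3 * of_nat k + 1)) \<simeq>\<^sub>3 0"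
      using n_eq by (intro tail_zero unit_3k_1) auto
  qed (rule rho16_cong2, use p6 in linarith)
  also have "(P * (\<Sum>k\<le>n. v16 k / (3 * of_nat k + 1))) * rho16 (2 * m) + (\<Sum>k\<in>{n<..<p}. 0) = C\<^sup>2 * X16"
  proof -
    have "(\<Sum>k\<le>n. v16 k / (3 * of_nat k + 1)) = fact n * pochhammer (M + 1 + (- 7 / 6) * P) n
       / (pochhammer (- h + (- 1 / 2) * P) n * pochhammer (4 / 3) n)"
      using central_sum_v16[of 1] unfolding half_parameters central_parameters by simp
    then have "P * (\<Sum>k\<le>n. v16 k / (3 * of_nat k + 1)) = C\<^sup>2 * (br n (- 1) * br (p - 1) (- 7 / 6)
     / (br (2 * m) (- (1 + - 7 / 6)) * br m (- 7 / 6) * br n (- (- 1 / 2)) * br (2 * m) (- 1 / 3) * br m (1 / 3)))"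
      using main_product[of "- 7 / 6" "- 1 / 2"] by auto
    then show ?thesis unfolding X16_def by (simp only: mult.assoc sum.neutral_const add_0_right)
  qed
  finally show ?thesis .
qed

lemma second_sum_4: "P * (\<Sum>k<p. T P k / (3 * of_nat k + 2)) \<simeq>\<^sub>3 P\<^sup>2 * (2 / C\<^sup>2)"
proof -
  have "P * (\<Sum>k<p. T P k / (3 * of_nat k + 2)) = P * (\<Sum>k\<le>n. v4 k * rho4 k / (3 * of_nat k + 2))"
    unfolding sum_T_4 ..
  also have "\<dots> \<simeq>\<^sub>3 (P * (\<Sum>k\<le>n. v4 k / (3 * of_nat k + 2))) * 1"
  proof (rule weighted_sum_cong)
    fix k assume "k \<le> n"
    then have k: "k < p" "k \<noteq> 4 * m" using n_less n_eq m_pos by auto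
    then show "v4 k \<in> Zp" "rho4 k \<simeq>\<^sub>2 1" by (auto intro: v4_Zp rho4_cong2)
    show "unit (3 * of_nat k + 2) \<or> rho4 k = 1" using unit_3k_2[OF k] by auto
  qed auto
  also have "(P * (\<Sum>k\<le>n. v4 k / (3 * of_nat k + 2))) * 1 \<simeq>\<^sub>3 P * (P * (12 * (1 / 6) / C\<^sup>2))"
  proof -
    have "(\<Sum>k\<le>n. v4 k / (3 * of_nat k + 2)) = fact n * pochhammer (1 - M + (1 / 6) * P) n
       / (pochhammer (- h + (1 / 2) * P) n * (2 * pochhammer (5 / 3) n))"
      using central_sum_v4[of 2] unfolding half_parameters central_parameters by simp
    also have "\<dots> \<simeq>\<^sub>2 P * (12 * (1 / 6) / C\<^sup>2)" by (rule second_product) auto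
    finally have "P * (\<Sum>k\<le>n. v4 k / (3 * of_nat k + 2)) \<simeq>\<^sub>3 P * (P * (12 * (1 / 6) / C\<^sup>2))"
      by (rule P_rc(2))
    then show ?thesis by (simp only: mult_1_right)
  qed
  finally show ?thesis by (simp add: power2_eq_square mult.assoc)
qed

text \<open>At \<open>k = 4 m\<close> the denominator \<open>3 k + 2\<close> is \<open>2 p\<close>, so this is the one term of the tail that
survives modulo \<open>p\<^sup>3\<close>. Only its residue modulo \<open>p\<close> is needed after removing \<open>p\<^sup>2\<close>; the value
9 comes from \<open>m \<equiv> - 1 / 6\<close>.\<close>
lemma critical_tail: "P * (T (- P) (4 * m) / (3 * of_nat (4 * m) + 2)) \<simeq>\<^sub>3 P\<^sup>2 * (9 / C\<^sup>2)"
proof -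
  obtain r where r: "m = Suc r" using m_pos gr0_implies_Suc by blast
  have mm: "m < p" "2 * m < p" "r < p" "4 * m < p" using p6 r m_pos by auto
  have k: "4 * m = n + 1 + r" using r n_eq by simp
  have nz: "br (2 * m) (- 1) \<noteq> 0" "br n (- 1) \<noteq> 0"
    using mm n_less by (auto intro!: unit_nz br_unit)
  have f4: "fact (4 * m) * fact (2 * m) * br (2 * m) (- 1) = (- 1) ^ n * (fact n)\<^sup>2 * br n (- 1)"
    using fact_reflect[of "4 * m" "2 * m"] fact_reflect[of n n] p6 p_eq by (simp add: power2_eq_square)
  have F: "fact (4 * m) = (- 1) ^ n * (fact n)\<^sup>2 * br n (- 1) / (fact (2 * m) * br (2 * m) (- 1))"
    using f4 nz by (simp add: field_simps)
  have p1: "pochhammer (1 / 2) n = (- 1) ^ n * (fact n * br n (- (1 / 2)))"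
    unfolding half_parameters by (rule pochhammer_down)
  have p2: "pochhammer (h + 1) n = (- 1) ^ n * fact n * br n (- 1)"
  proof -
    have "pochhammer 1 (n + n) = pochhammer 1 n * pochhammer (1 + h) n" by (rule pochhammer_product')
    then have "fact (n + n) = fact n * pochhammer (h + 1) n" by (simp only: pochhammer_fact add.commute)
    moreover have "fact (n + n) = (- 1) ^ n * fact n * fact n * br n (- 1)"
    proof -
      have pn: "p - 1 = n + n" using p_eq by simp
      show ?thesis using fact_reflect[of n n] unfolding pn by simp
    qed
    ultimately have "fact n * pochhammer (h + 1) n = fact n * ((- 1) ^ n * fact n * br n (- 1))" by simp
    then show ?thesis by (rule mult_left_cancel[THEN iffD1, rotated]) simp
  qed
  have s: "(- 1) ^ n * (- 1) ^ n = (1 :: rat)" by (simp flip: power_mult_distrib)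
  define B where "B = br n (- (1 / 2)) * br r (1 / 2) * br r 1 * br (4 * m) (- 1) * br (4 * m) (1 / 2)
     * (br (2 * m) (- 1) * br (2 * m) (- 1)) / br n (- 1)"
  have B1: "B \<simeq>\<^sub>1 1"
    unfolding B_def using mm n_less by (intro cong1_1_mult cong1_1_divide br_cong1) auto
  have fr: "fact r = fact m / M" using M_pos by (simp_all add: r)
  have "T (- P) (4 * m) = P\<^sup>2 * (pochhammer (1 / 2) n * (pochhammer (h + 1) n * (fact r * br r (1 / 2)) * (fact r * br r 1))
     * br (4 * m) (- 1) * br (4 * m) (1 / 2) / (2 * (fact (4 * m))\<^sup>2))"
    by (rule tail_eq[OF k mm(4)])
  also have "\<dots> = P\<^sup>2 * ((fact r)\<^sup>2 * (fact (2 * m))\<^sup>2 / (2 * (fact n)\<^sup>2) * B)"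
    unfolding p1 p2 F B_def using nz s by (simp add: divide_simps) (simp add: power2_eq_square power4_eq_xxxx mult_ac)
  also have "(fact r)\<^sup>2 * (fact (2 * m))\<^sup>2 / (2 * (fact n)\<^sup>2) * B = B / (2 * M\<^sup>2) / C\<^sup>2"
    unfolding fr C_fact using M_pos by (simp add: divide_simps)
  finally have "P * (T (- P) (4 * m) / (3 * of_nat (4 * m) + 2)) = P\<^sup>2 * (B / (2 * M\<^sup>2) / 2 / C\<^sup>2)"
  proof -
    assume a: "T (- P) (4 * m) = P\<^sup>2 * (B / (2 * M\<^sup>2) / C\<^sup>2)"
    have "3 * of_nat (4 * m) + 2 = 2 * P" unfolding P_M by simp
    then show ?thesis unfolding a by (simp only:) simp
  qed
  also have "\<dots> \<simeq>\<^sub>3 P\<^sup>2 * (9 / C\<^sup>2)"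
  proof (intro P_rc rc_divide rc_refl)
    \<comment> \<open>only residues modulo \<open>p\<close> matter here: all the brackets are 1 and \<open>6 m = p - 1\<close>\<close>
    have M6: "M \<simeq>\<^sub>1 - 1 / 6" by (rule rat_cong_I[of _ _ _ "1 / 6"]) (auto simp: P_M)
    have "B / (2 * M\<^sup>2) / 2 \<simeq>\<^sub>1 1 / (2 * (- 1 / 6)\<^sup>2) / 2"
      using M_unit by (intro rc_divide rc_mult_left rc_power M6 B1 rc_refl) auto
    then show "B / (2 * M\<^sup>2) / 2 \<simeq>\<^sub>1 9" by (simp add: power2_eq_square)
  qed (use C_unit in auto)
  finally show ?thesis .
qed

text \<open>The sum up to \<open>n\<close> contributes \<open>- 10 p\<^sup>2 / C\<^sup>2\<close> and the critical term of the tail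
\<open>9 p\<^sup>2 / C\<^sup>2\<close>.\<close>
lemma second_sum_16: "P * (\<Sum>k<p. T (- P) k / (3 * of_nat k + 2)) \<simeq>\<^sub>3 P\<^sup>2 * (- 1 / C\<^sup>2)"
proof -
  have m4: "4 * m \<in> {n<..<p}" using n_eq m_pos p6 by auto
  have "P * (\<Sum>k<p. T (- P) k / (3 * of_nat k + 2)) = P * (\<Sum>k\<le>n. v16 k * rho16 k / (3 * of_nat k + 2))
      + (\<Sum>k\<in>{n<..<p}. P * (T (- P) k / (3 * of_nat k + 2)))"
    unfolding sum_T_16 distrib_left sum_distrib_left ..
  also have "\<dots> \<simeq>\<^sub>3 (P * (\<Sum>k\<le>n. v16 k / (3 * of_nat k + 2))) * 1
      + (\<Sum>k\<in>{n<..<p}. if k = 4 * m then P\<^sup>2 * (9 / C\<^sup>2) else 0)"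
  proof (intro rc_add rc_sum weighted_sum_cong)
    fix k assume "k \<le> n"
    then have k: "k < p" "k \<noteq> 4 * m" using n_less n_eq m_pos by auto
    then show "v16 k \<in> Zp" "rho16 k \<simeq>\<^sub>2 1" by (auto intro: v16_Zp rho16_cong2)
    show "unit (3 * of_nat k + 2) \<or> rho16 k = 1" using unit_3k_2[OF k] by auto
  next
    fix k assume "k \<in> {n<..<p}"
    then have k: "n < k" "k < p" by auto
    show "P * (T (- P) k / (3 * of_nat k + 2)) \<simeq>\<^sub>3 (if k = 4 * m then P\<^sup>2 * (9 / C\<^sup>2) else 0)"
    proof (cases "k = 4 * m")
      case True
      show ?thesis unfolding True using critical_tail by (simp only: if_True simp_thms)
    next
      case False
      have "P * (T (- P) k / (3 * of_nat k + 2)) \<simeq>\<^sub>3 0"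
        by (rule tail_zero[OF k unit_3k_2[OF k(2) False]])
      then show ?thesis using False by (simp only: if_False)
    qed
  qed auto
  also have "(\<Sum>k\<in>{n<..<p}. if k = 4 * m then P\<^sup>2 * (9 / C\<^sup>2) else 0) = P\<^sup>2 * (9 / C\<^sup>2)"
    using m4 by simp
  also have "(P * (\<Sum>k\<le>n. v16 k / (3 * of_nat k + 2))) * 1 + P\<^sup>2 * (9 / C\<^sup>2)
      \<simeq>\<^sub>3 P * (P * (12 * (- 5 / 6) / C\<^sup>2)) + P\<^sup>2 * (9 / C\<^sup>2)"
  proof (intro rc_add rc_refl)
    have "(\<Sum>k\<le>n. v16 k / (3 * of_nat k + 2)) = fact n * pochhammer (1 - M + (- 5 / 6) * P) n
       / (pochhammer (- h + (- 1 / 2) * P) n * (2 * pochhammer (5 / 3) n))"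
      using central_sum_v16[of 2] unfolding half_parameters central_parameters by simp
    also have "\<dots> \<simeq>\<^sub>2 P * (12 * (- 5 / 6) / C\<^sup>2)" by (rule second_product) auto
    finally have "P * (\<Sum>k\<le>n. v16 k / (3 * of_nat k + 2)) \<simeq>\<^sub>3 P * (P * (12 * (- 5 / 6) / C\<^sup>2))"
      by (rule P_rc(2))
    then show "(P * (\<Sum>k\<le>n. v16 k / (3 * of_nat k + 2))) * 1 \<simeq>\<^sub>3 P * (P * (12 * (- 5 / 6) / C\<^sup>2))"
      by (simp only: mult_1_right)
  qed
  finally show ?thesis by (simp add: power2_eq_square field_simps)
qed

lemma P3_cong: "z \<in> Zp \<Longrightarrow> P * (P\<^sup>2 * z) \<simeq>\<^sub>3 0"
  using rc0_P[of z 3] by (simp add: power3_eq_cube power2_eq_square mult.assoc)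

text \<open>Here \<open>a\<close> and \<open>c\<close> stand for the values of \<open>S\<^sub>0\<close> modulo \<open>p\<^sup>3\<close> and of \<open>C\<^sup>2\<close> modulo \<open>p\<close>,
which are expressed through \<open>x\<close> later.\<close>
lemma square_domb_sum_4:
  assumes a: "C\<^sup>2 * X4 \<simeq>\<^sub>3 a" and c: "C\<^sup>2 \<simeq>\<^sub>1 c" "unit c"
  shows "(\<Sum>k=0..p - 1. of_nat k ^ 2 * (of_nat (domb k) / 4 ^ k)) \<simeq>\<^sub>3 4 / 9 * a - 10 / 9 * (P\<^sup>2 / c)"
proof -
  have s0: "P * (\<Sum>k<p. T P k / (3 * of_nat k + 1)) \<simeq>\<^sub>3 a"
    using domb_sum_4 a rc_trans unfolding domb_sums_4(1) by blast
  have q: "P * (\<Sum>k<p. T P k / (3 * of_nat k + 2)) \<simeq>\<^sub>3 P\<^sup>2 * (2 / c)"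
    by (rule rc_trans[OF second_sum_4], intro P_rc rc_divide rc_refl c) (use C_unit c in auto)
  have "(\<Sum>k=0..p - 1. of_nat k ^ 2 * (of_nat (domb k) / 4 ^ k)) \<simeq>\<^sub>3
     - (5 * (\<Sum>k=0..p - 1. of_nat k * (of_nat (domb k) / 4 ^ k)) + 2 * (\<Sum>k=0..p - 1. of_nat (domb k) / 4 ^ k)) / 3"
    by (rule square_sum_4)
  also have "\<dots> = 4 / 9 * (P * (\<Sum>k<p. T P k / (3 * of_nat k + 1)))
      + (- 5 / 9 - 5 / 3 * P) * (P * (\<Sum>k<p. T P k / (3 * of_nat k + 2)))"
    unfolding domb_sums_4 by (simp add: field_simps)
  also have "\<dots> \<simeq>\<^sub>3 4 / 9 * a + (- 5 / 9 - 5 / 3 * P) * (P\<^sup>2 * (2 / c))"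
    by (intro rc_add rc_mult_left s0 q) auto
  also have "\<dots> = (4 / 9 * a - 10 / 9 * (P\<^sup>2 / c)) + P * (P\<^sup>2 * (- 10 / 3 / c))"
    using unit_nz[OF c(2)] by (simp add: field_simps)
  also have "\<dots> \<simeq>\<^sub>3 (4 / 9 * a - 10 / 9 * (P\<^sup>2 / c)) + 0"
    using c(2) by (intro rc_add rc_refl P3_cong) auto
  finally show ?thesis by simp
qed

lemma square_domb_sum_16:
  assumes a: "C\<^sup>2 * X16 \<simeq>\<^sub>3 a" and c: "C\<^sup>2 \<simeq>\<^sub>1 c" "unit c"
  shows "(\<Sum>k=0..p - 1. of_nat k ^ 2 * (of_nat (domb k) / 16 ^ k)) \<simeq>\<^sub>3 a / 9 - P\<^sup>2 / (9 * c)"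
proof -
  have s0: "P * (\<Sum>k<p. T (- P) k / (3 * of_nat k + 1)) \<simeq>\<^sub>3 a"
    using domb_sum_16 a rc_trans unfolding domb_sums_16(1) by blast
  have q: "P * (\<Sum>k<p. T (- P) k / (3 * of_nat k + 2)) \<simeq>\<^sub>3 P\<^sup>2 * (- 1 / c)"
    by (rule rc_trans[OF second_sum_16], intro P_rc rc_divide rc_refl c) (use C_unit c in auto)
  have "(\<Sum>k=0..p - 1. of_nat k ^ 2 * (of_nat (domb k) / 16 ^ k)) \<simeq>\<^sub>3
     - (\<Sum>k=0..p - 1. of_nat k * (of_nat (domb k) / 16 ^ k)) / 3"
    by (rule square_sum_16)
  also have "\<dots> = 1 / 9 * (P * (\<Sum>k<p. T (- P) k / (3 * of_nat k + 1)))
      + (1 / 9 - 1 / 3 * P) * (P * (\<Sum>k<p. T (- P) k / (3 * of_nat k + 2)))"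
    unfolding domb_sums_16 by (simp add: field_simps)
  also have "\<dots> \<simeq>\<^sub>3 1 / 9 * a + (1 / 9 - 1 / 3 * P) * (P\<^sup>2 * (- 1 / c))"
    by (intro rc_add rc_mult_left s0 q) auto
  also have "\<dots> = (a / 9 - P\<^sup>2 / (9 * c)) + P * (P\<^sup>2 * (1 / 3 / c))"
    using unit_nz[OF c(2)] by (simp add: field_simps)
  also have "\<dots> \<simeq>\<^sub>3 (a / 9 - P\<^sup>2 / (9 * c)) + 0"
    using c(2) by (intro rc_add rc_refl P3_cong) auto
  finally show ?thesis by simp
qed

end

section \<open>Quadratic character sums and power sums\<close>

context padic_prime
begin

abbreviation q :: int where "q \<equiv> int p"

lemma q_gt_3: "q > 3" using p_gt_3 by simp
lemma q_eq: "q = 2 * int n + 1" using p_eq by linarith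

text \<open>The Legendre symbol modulo \<open>p\<close>.\<close>
definition chi :: "int \<Rightarrow> int" where "chi u = Legendre u q"

lemma chi_cong: "[chi u = u ^ n] (mod q)"
  using euler_criterion[of p u] prime_p p_gt_3 unfolding chi_def n_def by simp

lemma chi_values: "chi u \<in> {- 1, 0, 1}" unfolding chi_def Legendre_def by simp
lemma chi_0_iff: "chi u = 0 \<longleftrightarrow> q dvd u" unfolding chi_def Legendre_def by (simp add: cong_0_iff)

lemma cong_small_eq: "[a = b] (mod q) \<Longrightarrow> \<bar>a - b\<bar> < q \<Longrightarrow> a = b"
  by (metis cong_iff_dvd_diff dvd_imp_le_int abs_of_nat diff_eq_diff_eq diff_self linorder_not_less right_minus_eq)

lemma chi_abs: "\<bar>chi u\<bar> \<le> 1" using chi_values[of u] by auto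

lemma chi_eqI: "[u ^ n = v] (mod q) \<Longrightarrow> v \<in> {- 1, 0, 1} \<Longrightarrow> chi u = v"
  using cong_small_eq[of "chi u" v] cong_trans[OF chi_cong] chi_values[of u] q_gt_3 by fastforce

lemma chi_period: "[u = v] (mod q) \<Longrightarrow> chi u = chi v"
  by (rule chi_eqI[OF cong_trans[OF cong_pow cong_sym[OF chi_cong]] chi_values])

lemma chi_mult: "chi (u * v) = chi u * chi v"
proof (rule chi_eqI)
  show "[(u * v) ^ n = chi u * chi v] (mod q)"
    unfolding power_mult_distrib by (intro cong_mult cong_sym[OF chi_cong])
  show "chi u * chi v \<in> {- 1, 0, 1}" using chi_values[of u] chi_values[of v] by auto
qed

lemma chi_power: "chi (u ^ Suc k) = chi u ^ Suc k"
  by (induction k) (simp_all add: chi_mult)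

definition g :: int where "g = int (SOME x. residue_primroot p x)"

lemma g_primroot: obtains x where "g = int x" "residue_primroot p x"
  using someI_ex[OF prime_primitive_root_exists[of p]] prime_p prime_gt_1_nat[OF prime_p] unfolding g_def by blast

lemma g_power_1_iff: "[g ^ d = 1] (mod q) \<longleftrightarrow> (p - 1) dvd d"
proof -
  obtain x where x: "g = int x" "residue_primroot p x" by (rule g_primroot)
  have "[g ^ d = 1] (mod q) \<longleftrightarrow> [x ^ d = 1] (mod p)"
    unfolding x by (metis cong_int_iff of_nat_1 of_nat_power)
  also have "\<dots> \<longleftrightarrow> ord p x dvd d" by (rule ord_divides)
  finally show ?thesis using x(2) prime_p by (simp add: residue_primroot_def totient_prime)
qed

lemma g_not_dvd: "\<not> q dvd g"
proof
  assume "q dvd g"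
  then have "q dvd g ^ (p - 1)" using p_gt_3 by (metis dvd_power dvd_trans zero_less_diff One_nat_def Suc_lessD numeral_3_eq_3)
  moreover have "[g ^ (p - 1) = 1] (mod q)" by (simp add: g_power_1_iff)
  ultimately have "q dvd 1" using cong_dvd_iff by blast
  then show False using q_gt_3 by simp
qed

text \<open>Sums over nonzero residues become sums over exponents, for functions that depend on the residue
only.\<close>
lemma generator_sum:
  fixes F :: "int \<Rightarrow> 'a :: comm_monoid_add"
  assumes "\<And>x y. [x = y] (mod q) \<Longrightarrow> F x = F y"
  shows "(\<Sum>t\<in>{1..<q}. F t) = (\<Sum>e<p - 1. F (g ^ e))"
proof -
  obtain x where x: "g = int x" "residue_primroot p x" by (rule g_primroot)
  have "bij_betw (\<lambda>i. x ^ i mod p) {..<totient p} (totatives p)"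
    using x(2) p_gt_3 by (intro residue_primroot_is_generator) auto
  then have b: "bij_betw (\<lambda>i. x ^ i mod p) {..<p - 1} {0<..<p}"
    using prime_p by (simp add: totient_prime totatives_prime)
  have "(\<Sum>e<p - 1. F (g ^ e)) = (\<Sum>e<p - 1. F (int (x ^ e mod p)))"
    by (intro sum.cong refl assms) (simp add: x cong_def of_nat_mod)
  also have "\<dots> = (\<Sum>t\<in>{0<..<p}. F (int t))"
    by (rule sum.reindex_bij_betw[OF b])
  also have "\<dots> = (\<Sum>t\<in>{1..<q}. F t)"
    by (rule sum.reindex_bij_witness[of _ nat int]) auto
  finally show ?thesis ..
qed

lemma full_sum: "(\<Sum>t\<in>{0..<q}. F t) = F 0 + (\<Sum>t\<in>{1..<q}. F t)" for F :: "int \<Rightarrow> 'a :: comm_monoid_add"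
proof -
  have "{0..<q} = insert 0 {1..<q}" using q_gt_3 by auto
  then show ?thesis by simp
qed

lemma mult_reindex:
  fixes F :: "int \<Rightarrow> 'a :: comm_monoid_add"
  assumes F: "\<And>x y. [x = y] (mod q) \<Longrightarrow> F x = F y" and s: "\<not> q dvd s"
  shows "(\<Sum>t\<in>{0..<q}. F (t * s)) = (\<Sum>t\<in>{0..<q}. F t)"
proof -
  have inj: "inj_on (\<lambda>t. (t * s) mod q) {0..<q}"
  proof (rule inj_onI)
    fix x y assume xy: "x \<in> {0..<q}" "y \<in> {0..<q}" "(x * s) mod q = (y * s) mod q"
    then have "q dvd (x - y) * s" by (simp add: mod_eq_dvd_iff left_diff_distrib)
    then have "[x = y] (mod q)" using s dvd_mult_int by (simp add: cong_iff_dvd_diff)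
    then show "x = y" using xy by (intro cong_small_eq) auto
  qed
  have "(\<lambda>t. (t * s) mod q) ` {0..<q} \<subseteq> {0..<q}" using q_gt_3 by auto
  then have "bij_betw (\<lambda>t. (t * s) mod q) {0..<q} {0..<q}"
    using inj endo_inj_surj[of "{0..<q}"] by (simp add: bij_betw_def)
  from sum.reindex_bij_betw[OF this, of F]
  have "(\<Sum>t\<in>{0..<q}. F ((t * s) mod q)) = (\<Sum>t\<in>{0..<q}. F t)" .
  moreover have "F ((t * s) mod q) = F (t * s)" for t by (rule F) (simp add: cong_def)
  ultimately show ?thesis by simp
qed

lemma lift_cong:
  assumes "[a = b] (mod q ^ Suc k)"
  shows "[a ^ p = b ^ p] (mod q ^ Suc (Suc k))"
proof -
  have ab: "[a = b] (mod q)" using assms by (metis cong_modulus_mult power_Suc)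
  have "[(\<Sum>i<p. b ^ (p - Suc i) * a ^ i) = (\<Sum>i<p. b ^ (p - Suc i) * b ^ i)] (mod q)"
    by (intro cong_sum cong_mult cong_pow cong_refl ab)
  also have "(\<Sum>i<p. b ^ (p - Suc i) * b ^ i) = (\<Sum>i<p. b ^ (p - 1))"
    by (intro sum.cong refl) (simp flip: power_add)
  also have "[\<dots> = 0] (mod q)" by (simp add: cong_0_iff)
  finally have "q dvd (\<Sum>i<p. b ^ (p - Suc i) * a ^ i)" by (simp add: cong_0_iff)
  moreover have "q ^ Suc k dvd a - b" using assms by (simp add: cong_iff_dvd_diff)
  ultimately have "q ^ Suc k * q dvd (a - b) * (\<Sum>i<p. b ^ (p - Suc i) * a ^ i)" by (intro mult_dvd_mono)
  then have "q ^ Suc (Suc k) dvd a ^ p - b ^ p" by (simp only: power_diff_sumr2 power_Suc2)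
  then show ?thesis by (simp add: cong_iff_dvd_diff)
qed

text \<open>Hence \<open>t ^ p\<^sup>2\<close> modulo \<open>p\<^sup>3\<close> depends on \<open>t\<close> modulo \<open>p\<close> only: it is the Teichmueller
representative of \<open>t\<close> to this precision.\<close>
lemma lift_cong_p2: "[a = b] (mod q) \<Longrightarrow> [a ^ p\<^sup>2 = b ^ p\<^sup>2] (mod q ^ 3)"
  using lift_cong[OF lift_cong[of a b 0]] by (simp add: power2_eq_square power_mult numeral_3_eq_3)

lemma fermat_int: "\<not> q dvd a \<Longrightarrow> [a ^ (p - 1) = 1] (mod q)"
proof -
  assume "\<not> q dvd a"
  moreover have "coprime a q \<longleftrightarrow> \<not> q dvd a" using prime_int_p by (meson coprime_commute prime_imp_coprime coprime_absorb_left not_prime_unit)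
  ultimately have c: "coprime a q" by blast
  have "chi a ^ 2 = 1" using chi_values[of a] chi_0_iff[of a] \<open>\<not> q dvd a\<close> by auto
  then have "[(a ^ n) ^ 2 = 1] (mod q)" using cong_pow[OF chi_cong[of a], of 2] by (metis cong_sym)
  moreover have "p - 1 = n * 2" using p_eq by simp
  ultimately show ?thesis by (simp add: power_mult)
qed

lemma power_p: "[a ^ p = a] (mod q)"
proof (cases "q dvd a")
  case True
  then show ?thesis using p_pos by (metis cong_0_iff cong_def dvd_power dvd_trans)
next
  case False
  have "a ^ p = a ^ (p - 1) * a" using p_pos by (metis Suc_pred' power_Suc2)
  with cong_mult[OF fermat_int[OF False] cong_refl[of a]] show ?thesis by simp
qed

lemma power_p2: "[a ^ p\<^sup>2 = a] (mod q)"
  using cong_trans[OF cong_pow[OF power_p[of a], of p] power_p[of a]] by (simp add: power2_eq_square power_mult)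

text \<open>The lifted residues form the group of \<open>(p - 1)\<close>-st roots of unity modulo \<open>p\<^sup>3\<close>, so the sum is
geometric. Unless \<open>p - 1\<close> divides \<open>j\<close>, it vanishes because the ratio is not congruent to 1 even modulo \<open>p\<close>.\<close>
lemma power_sum:
  "[(\<Sum>t\<in>{1..<q}. (t ^ p\<^sup>2) ^ j) = (if (p - 1) dvd j then q - 1 else 0)] (mod q ^ 3)"
proof -
  define x where "x = (g ^ p\<^sup>2) ^ j"
  have F: "((u ^ p\<^sup>2) ^ j) mod q ^ 3 = ((v ^ p\<^sup>2) ^ j) mod q ^ 3" if "[u = v] (mod q)" for u v
    using cong_pow[OF lift_cong_p2[OF that], of j] by (simp add: cong_def)
  have "[(\<Sum>t\<in>{1..<q}. (t ^ p\<^sup>2) ^ j) = (\<Sum>t\<in>{1..<q}. ((t ^ p\<^sup>2) ^ j) mod q ^ 3)] (mod q ^ 3)"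
    by (intro cong_sum) (simp add: cong_def)
  also have "(\<Sum>t\<in>{1..<q}. ((t ^ p\<^sup>2) ^ j) mod q ^ 3) = (\<Sum>e<p - 1. (((g ^ e) ^ p\<^sup>2) ^ j) mod q ^ 3)"
    by (rule generator_sum) (rule F)
  also have "[\<dots> = (\<Sum>e<p - 1. x ^ e)] (mod q ^ 3)"
    by (intro cong_sum) (simp add: cong_def x_def flip: power_mult, simp add: mult_ac)
  finally have S: "[(\<Sum>t\<in>{1..<q}. (t ^ p\<^sup>2) ^ j) = (\<Sum>e<p - 1. x ^ e)] (mod q ^ 3)" .
  have "[(g ^ (p - 1)) ^ p\<^sup>2 = 1 ^ p\<^sup>2] (mod q ^ 3)" by (rule lift_cong_p2) (simp add: g_power_1_iff)
  then have "[((g ^ (p - 1)) ^ p\<^sup>2) ^ j = 1] (mod q ^ 3)" using cong_pow by fastforce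
  then have xp: "[x ^ (p - 1) = 1] (mod q ^ 3)" unfolding x_def by (simp add: mult_ac flip: power_mult)
  have xg: "[x = g ^ j] (mod q)" unfolding x_def by (intro cong_pow power_p2)
  show ?thesis
  proof (cases "(p - 1) dvd j")
    case True
    then obtain i where "j = (p - 1) * i" by blast
    then have "x = ((g ^ (p - 1)) ^ p\<^sup>2) ^ i" unfolding x_def by (simp add: mult_ac flip: power_mult)
    moreover have "[((g ^ (p - 1)) ^ p\<^sup>2) ^ i = 1] (mod q ^ 3)"
      using cong_pow[OF \<open>[(g ^ (p - 1)) ^ p\<^sup>2 = 1 ^ p\<^sup>2] (mod q ^ 3)\<close>, of i] by simp
    ultimately have "[x = 1] (mod q ^ 3)" by simp
    then have "[(\<Sum>e<p - 1. x ^ e) = (\<Sum>e<p - 1. 1 ^ e)] (mod q ^ 3)" by (intro cong_sum cong_pow)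
    then show ?thesis using S True p_pos by (simp add: of_nat_diff) (metis cong_trans)
  next
    case False
    have "\<not> q dvd x - 1"
    proof
      assume "q dvd x - 1"
      then have "[x = 1] (mod q)" by (simp add: cong_iff_dvd_diff)
      then have "[g ^ j = 1] (mod q)" using xg cong_sym cong_trans by blast
      with False show False by (simp add: g_power_1_iff)
    qed
    then have "coprime (q ^ 3) (x - 1)" using prime_int_p by (simp add: prime_imp_coprime)
    moreover have "q ^ 3 dvd (x - 1) * (\<Sum>e<p - 1. x ^ e)"
      using xp by (simp add: cong_iff_dvd_diff power_diff_1_eq)
    ultimately have "q ^ 3 dvd (\<Sum>e<p - 1. x ^ e)" by (simp add: coprime_dvd_mult_right_iff)
    then show ?thesis using S False by (simp add: cong_0_iff) (metis cong_dvd_iff)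
  qed
qed

lemma power_sum_mod_p:
  assumes "k \<le> 2 * n"
  shows "[(\<Sum>t\<in>{0..<q}. t ^ k) = (if k = 2 * n then - 1 else 0)] (mod q)"
proof (cases "k = 0")
  case True
  then show ?thesis using q_gt_3 q_eq by (auto simp: cong_0_iff)
next
  case False
  have pn: "p - 1 = 2 * n" using p_eq by simp
  have d: "(p - 1) dvd k \<longleftrightarrow> k = 2 * n" unfolding pn using assms False dvd_imp_le by auto
  have "(\<Sum>t\<in>{0..<q}. t ^ k) = (\<Sum>t\<in>{1..<q}. t ^ k)" using False by (simp add: full_sum)
  also have "[\<dots> = (\<Sum>t\<in>{1..<q}. (t ^ p\<^sup>2) ^ k)] (mod q)"
    by (intro cong_sum cong_pow cong_sym[OF power_p2])
  also have "[(\<Sum>t\<in>{1..<q}. (t ^ p\<^sup>2) ^ k) = (if (p - 1) dvd k then q - 1 else 0)] (mod q)"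
    using power_sum[of k] by (rule cong_dvd_modulus) (simp add: numeral_3_eq_3)
  also have "[(if (p - 1) dvd k then q - 1 else 0) = (if k = 2 * n then - 1 else 0)] (mod q)"
    unfolding d by (simp add: cong_iff_dvd_diff)
  finally show ?thesis .
qed

lemma chi_sum_0: "(\<Sum>t\<in>{0..<q}. chi t) = 0"
proof (rule cong_small_eq)
  have "n > 0" using p_eq p_gt_3 by simp
  have "[(\<Sum>t\<in>{0..<q}. chi t) = (\<Sum>t\<in>{0..<q}. t ^ n)] (mod q)" by (intro cong_sum chi_cong)
  also have "[(\<Sum>t\<in>{0..<q}. t ^ n) = 0] (mod q)" using power_sum_mod_p[of n] \<open>n > 0\<close> by simp
  finally show "[(\<Sum>t\<in>{0..<q}. chi t) = 0] (mod q)" .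
  have "\<bar>\<Sum>t\<in>{0..<q}. chi t\<bar> = \<bar>\<Sum>t\<in>{1..<q}. chi t\<bar>"
    using chi_0_iff[of 0] by (simp add: full_sum)
  also have "\<dots> \<le> (\<Sum>t\<in>{1..<q}. \<bar>chi t\<bar>)" by (rule sum_abs)
  also have "\<dots> \<le> (\<Sum>t\<in>{1..<q}. 1)" by (intro sum_mono chi_abs)
  also have "\<dots> < q" using q_gt_3 by simp
  finally show "\<bar>(\<Sum>t\<in>{0..<q}. chi t) - 0\<bar> < q" by simp
qed

text \<open>Expanding by Euler's criterion determines the sum modulo \<open>p\<close>, since only the top power of \<open>r\<close>
survives. The trivial bound on the number of nonzero terms then leaves one possibility.\<close>
lemma chi_correlation:
  "(\<Sum>r\<in>{0..<q}. chi ((r + u) * (r + v))) = (if [u = v] (mod q) then q - 1 else - 1)"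
proof -
  let ?S = "\<Sum>r\<in>{0..<q}. chi ((r + u) * (r + v))"
  have "[?S = (\<Sum>r\<in>{0..<q}. ((r + u) * (r + v)) ^ n)] (mod q)" by (intro cong_sum chi_cong)
  also have "(\<Sum>r\<in>{0..<q}. ((r + u) * (r + v)) ^ n)
     = (\<Sum>r\<in>{0..<q}. \<Sum>i\<le>n. \<Sum>j\<le>n. int (n choose i) * u ^ (n - i) * (int (n choose j) * v ^ (n - j)) * r ^ (i + j))"
    unfolding power_mult_distrib binomial_ring sum_product
    by (intro sum.cong refl) (simp add: power_add mult_ac)
  also have "\<dots> = (\<Sum>i\<le>n. \<Sum>j\<le>n. int (n choose i) * u ^ (n - i) * (int (n choose j) * v ^ (n - j)) * (\<Sum>r\<in>{0..<q}. r ^ (i + j)))"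
    unfolding sum_distrib_left by (subst sum.swap, intro sum.cong refl, subst sum.swap) simp
  also have "[\<dots> = (\<Sum>i\<le>n. \<Sum>j\<le>n. int (n choose i) * u ^ (n - i) * (int (n choose j) * v ^ (n - j)) * (if i + j = 2 * n then - 1 else 0))] (mod q)"
    by (intro cong_sum cong_mult cong_refl power_sum_mod_p) auto
  also have "(\<Sum>i\<le>n. \<Sum>j\<le>n. int (n choose i) * u ^ (n - i) * (int (n choose j) * v ^ (n - j)) * (if i + j = 2 * n then - 1 else 0))
     = (\<Sum>i\<le>n. \<Sum>j\<le>n. if i = n then if j = n then - 1 else 0 else 0)"
    by (intro sum.cong refl) auto
  also have "\<dots> = - 1"
  proof -
    have "(\<Sum>j\<le>n. if i = n then if j = n then - 1 else 0 else 0) = (if i = n then - 1 else (0 :: int))" for i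
      by simp
    then show ?thesis by simp
  qed
  finally have c: "[?S = - 1] (mod q)" .
  \<comment> \<open>the zeros of the two factors, which are removed to sharpen the trivial bound\<close>
  define z where "z w = (- w) mod q" for w
  have z: "z w \<in> {0..<q}" "q dvd z w + w" for w
    unfolding z_def using q_gt_3 by (auto simp: dvd_eq_mod_eq_0 mod_add_left_eq)
  show ?thesis
  proof (cases "[u = v] (mod q)")
    case True
    have sq: "chi ((r + u) * (r + v)) = chi (r + u) ^ 2" for r
      using chi_period[of "r + v" "r + u"] True by (simp add: chi_mult power2_eq_square cong_add cong_sym)
    have b: "0 \<le> chi ((r + u) * (r + v))" "chi ((r + u) * (r + v)) \<le> 1" for r
      unfolding sq using chi_values[of "r + u"] by auto
    have "?S = chi ((z u + u) * (z u + v)) + (\<Sum>r\<in>{0..<q} - {z u}. chi ((r + u) * (r + v)))"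
      by (rule sum.remove) (use z in auto)
    also have "chi ((z u + u) * (z u + v)) = 0" using z by (simp add: chi_0_iff)
    also have "(\<Sum>r\<in>{0..<q} - {z u}. chi ((r + u) * (r + v))) \<le> (\<Sum>r\<in>{0..<q} - {z u}. 1)"
      by (intro sum_mono b)
    also have "\<dots> = q - 1" using z(1)[of u] q_gt_3 by (simp add: card_Diff_singleton)
    finally have "?S \<le> q - 1" by simp
    moreover have "?S \<ge> 0" by (intro sum_nonneg b)
    moreover have "[?S = q - 1] (mod q)"
    proof -
      have "q dvd ?S - (- 1) - q" using c by (simp only: cong_iff_dvd_diff dvd_diff dvd_refl)
      moreover have "?S - (- 1) - q = ?S - (q - 1)" by simp
      ultimately show ?thesis by (simp only: cong_iff_dvd_diff)
    qed
    ultimately show ?thesis using cong_small_eq[of ?S "q - 1"] True by auto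
  next
    case False
    have ne: "z u \<noteq> z v" using False cong_minus_minus_iff[of u v q]
      unfolding z_def cong_def by simp
    have "?S = chi ((z u + u) * (z u + v)) + (\<Sum>r\<in>{0..<q} - {z u}. chi ((r + u) * (r + v)))"
      by (rule sum.remove) (use z in auto)
    also have "(\<Sum>r\<in>{0..<q} - {z u}. chi ((r + u) * (r + v)))
      = chi ((z v + u) * (z v + v)) + (\<Sum>r\<in>{0..<q} - {z u} - {z v}. chi ((r + u) * (r + v)))"
      by (rule sum.remove) (use z ne in auto)
    finally have "?S = (\<Sum>r\<in>{0..<q} - {z u} - {z v}. chi ((r + u) * (r + v)))"
      using z by (simp add: chi_0_iff[THEN iffD2])
    also have "\<bar>\<dots>\<bar> \<le> (\<Sum>r\<in>{0..<q} - {z u} - {z v}. \<bar>chi ((r + u) * (r + v))\<bar>)" by (rule sum_abs)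
    also have "\<dots> \<le> (\<Sum>r\<in>{0..<q} - {z u} - {z v}. 1)" by (intro sum_mono chi_abs)
    also have "\<dots> = q - 2" using z(1)[of u] z(1)[of v] ne q_gt_3 by (simp add: card_Diff_singleton)
    finally have "\<bar>?S\<bar> \<le> q - 2" .
    then have "?S = - 1" using c by (intro cong_small_eq) auto
    then show ?thesis using False by simp
  qed
qed

end

section \<open>The cubic family of character sums\<close>

context padic_prime
begin

text \<open>For \<open>r\<close> prime to \<open>p\<close> this is, up to sign, the trace of Frobenius of the elliptic curve \<open>y\<^sup>2 = t\<^sup>3 + r\<close>.\<close>
definition S :: "int \<Rightarrow> int" where "S r = (\<Sum>t\<in>{0..<q}. chi (t ^ 3 + r))"

lemma S_period: "[r = s] (mod q) \<Longrightarrow> S r = S s"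
  unfolding S_def by (intro sum.cong refl chi_period cong_add cong_refl)

text \<open>Substituting \<open>t s\<close> for \<open>t\<close>: curves that differ by a sixth power are isomorphic, by a cube they are
quadratic twists.\<close>
lemma S_scale: "\<not> q dvd s \<Longrightarrow> S (r * s ^ 3) = chi s * S r"
proof -
  assume s: "\<not> q dvd s"
  have "S (r * s ^ 3) = (\<Sum>t\<in>{0..<q}. chi ((t * s) ^ 3 + r * s ^ 3))"
    unfolding S_def
    by (rule mult_reindex[OF _ s, symmetric]) (intro chi_period cong_add cong_pow cong_refl)
  also have "\<dots> = (\<Sum>t\<in>{0..<q}. chi s * chi (t ^ 3 + r))"
  proof (intro sum.cong refl)
    fix t
    have "(t * s) ^ 3 + r * s ^ 3 = s ^ Suc 2 * (t ^ 3 + r)"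
      by (simp add: algebra_simps power_mult_distrib numeral_3_eq_3)
    then have "chi ((t * s) ^ 3 + r * s ^ 3) = chi s ^ Suc 2 * chi (t ^ 3 + r)"
      by (simp only: chi_mult chi_power)
    also have "chi s ^ Suc 2 = chi s" using chi_values[of s] by auto
    finally show "chi ((t * s) ^ 3 + r * s ^ 3) = chi s * chi (t ^ 3 + r)" .
  qed
  finally show ?thesis unfolding S_def by (simp add: sum_distrib_left)
qed

lemma chi_g: "chi g = - 1"
proof -
  have "chi g \<noteq> 1"
  proof
    assume "chi g = 1"
    then have "[g ^ n = 1] (mod q)" using chi_cong[of g] by (simp add: cong_sym)
    then have "(p - 1) dvd n" by (simp only: g_power_1_iff)
    moreover have "p - 1 = 2 * n" using p_eq by simp
    ultimately have "2 * n dvd n" by (simp only:)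
    moreover have "n > 0" using p_eq p_gt_3 by simp
    ultimately show False using dvd_imp_le by fastforce
  qed
  then show ?thesis using chi_values[of g] chi_0_iff[of g] g_not_dvd by auto
qed

lemma sum_period_3:
  fixes F :: "nat \<Rightarrow> int"
  assumes "\<And>e. F (e + 3) = F e"
  shows "(\<Sum>e<3 * k. F e) = int k * (F 0 + F 1 + F 2)"
proof (induction k)
  case (Suc k)
  have s: "F (3 * k + i) = F i" for i k
    by (induction k) (simp_all add: assms algebra_simps, metis assms add.commute add.left_commute)
  have "(\<Sum>e<3 * Suc k. F e) = (\<Sum>e<3 * k. F e) + F (3 * k + 0) + F (3 * k + 1) + F (3 * k + 2)"
    by (simp add: eval_nat_numeral)
  then show ?case unfolding s Suc by (simp add: algebra_simps)
qed simp

end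

context padic_prime_1
begin

lemma p_minus_1: "p - 1 = 6 * m" by (simp only: p6)

definition w :: int where "w = g ^ (2 * m)"

lemma w_cube: "[w ^ 3 = 1] (mod q)"
proof -
  have "w ^ 3 = g ^ (p - 1)" unfolding w_def p_minus_1 by (simp flip: power_mult)
  then show ?thesis by (simp add: g_power_1_iff)
qed

lemma w_ne: "\<not> [w = 1] (mod q)" "\<not> [w ^ 2 = 1] (mod q)"
proof -
  have "w ^ 2 = g ^ (4 * m)" unfolding w_def by (simp flip: power_mult)
  moreover have "\<not> (p - 1) dvd 2 * m" "\<not> (p - 1) dvd 4 * m"
    unfolding p_minus_1 using m_pos by (auto dest!: dvd_imp_le)
  ultimately show "\<not> [w = 1] (mod q)" "\<not> [w ^ 2 = 1] (mod q)"
    unfolding w_def by (simp_all only: g_power_1_iff not_False_eq_True)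
qed

lemma cube_cong_iff: "[u ^ 3 = t ^ 3] (mod q) \<longleftrightarrow> [u = t] (mod q) \<or> [u = w * t] (mod q) \<or> [u = w ^ 2 * t] (mod q)"
proof -
  have "q dvd (w - 1) * (w ^ 2 + w + 1)"
  proof -
    have "(w - 1) * (w ^ 2 + w + 1) = w ^ 3 - 1" by (simp add: algebra_simps power2_eq_square power3_eq_cube)
    then show ?thesis using w_cube by (simp add: cong_iff_dvd_diff)
  qed
  then have w: "q dvd w ^ 2 + w + 1" using w_ne(1) by (simp add: dvd_mult_int cong_iff_dvd_diff)
  have "u ^ 3 - t ^ 3 - (u - t) * ((u - w * t) * (u - w ^ 2 * t))
     = (w ^ 2 + w + 1) * ((u - t) * (u * t + t ^ 2 * (1 - w)))"
    by Groebner_Basis.algebra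
  then have "q dvd u ^ 3 - t ^ 3 - (u - t) * ((u - w * t) * (u - w ^ 2 * t))" using w by (metis dvd_mult2)
  then have "q dvd u ^ 3 - t ^ 3 \<longleftrightarrow> q dvd (u - t) * ((u - w * t) * (u - w ^ 2 * t))"
    by (metis cong_dvd_iff cong_iff_dvd_diff)
  then show ?thesis by (simp add: dvd_mult_int cong_iff_dvd_diff)
qed

text \<open>As \<open>p \<equiv> 1 (mod 3)\<close>, the cube roots of unity \<open>1\<close>, \<open>w\<close>, \<open>w\<^sup>2\<close> permute the solutions.\<close>
lemma cube_fiber:
  assumes t: "\<not> q dvd t"
  shows "card {u \<in> {0..<q}. [u ^ 3 = t ^ 3] (mod q)} = 3"
proof -
  have eq: "{u \<in> {0..<q}. [u ^ 3 = t ^ 3] (mod q)} = {t mod q, (w * t) mod q, (w ^ 2 * t) mod q}"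
    unfolding cube_cong_iff using q_gt_3 by (auto simp: cong_def)
  have "q dvd (a - b) * t \<longleftrightarrow> q dvd a - b" for a b using t by (simp add: dvd_mult_int)
  then have c: "(a * t) mod q = (b * t) mod q \<longleftrightarrow> [a = b] (mod q)" for a b
    by (simp add: mod_eq_dvd_iff cong_iff_dvd_diff left_diff_distrib)
  have "\<not> [w ^ 2 = w] (mod q)"
  proof
    assume "[w ^ 2 = w] (mod q)"
    then have "[w * w ^ 2 = w * w] (mod q)" by (rule cong_scalar_left)
    then have "[w ^ 3 = w ^ 2] (mod q)" by (simp add: power2_eq_square power3_eq_cube mult.assoc)
    then have "[w ^ 2 = w ^ 3] (mod q)" by (rule cong_sym)
    with w_cube w_ne(2) show False using cong_trans by blast
  qed
  then show ?thesis
    unfolding eq using c[of 1 w] c[of 1 "w ^ 2"] c[of "w ^ 2" w] w_ne by (auto simp: cong_sym_eq card_insert_if)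
qed

lemma S_0: "S 0 = 0"
proof -
  have "chi (t ^ 3) = chi t" for t
    using chi_power[of t 2] chi_values[of t] by (auto simp: numeral_3_eq_3)
  then show ?thesis unfolding S_def using chi_sum_0 by simp
qed

text \<open>Second moment by orthogonality: after exchanging the sums, the pairs \<open>(t, u)\<close> with equal cubes
are counted.\<close>
lemma S_square_sum: "(\<Sum>r\<in>{0..<q}. S r ^ 2) = 2 * q * (q - 1)"
proof -
  have "(\<Sum>r\<in>{0..<q}. S r ^ 2) = (\<Sum>r\<in>{0..<q}. \<Sum>t\<in>{0..<q}. \<Sum>u\<in>{0..<q}. chi ((r + t ^ 3) * (r + u ^ 3)))"
    unfolding S_def power2_eq_square sum_product by (simp add: chi_mult add.commute)
  also have "\<dots> = (\<Sum>t\<in>{0..<q}. \<Sum>r\<in>{0..<q}. \<Sum>u\<in>{0..<q}. chi ((r + t ^ 3) * (r + u ^ 3)))"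
    by (rule sum.swap)
  also have "\<dots> = (\<Sum>t\<in>{0..<q}. \<Sum>u\<in>{0..<q}. \<Sum>r\<in>{0..<q}. chi ((r + t ^ 3) * (r + u ^ 3)))"
    by (rule sum.cong[OF refl sum.swap])
  also have "\<dots> = (\<Sum>t\<in>{0..<q}. \<Sum>u\<in>{0..<q}. (if [u ^ 3 = t ^ 3] (mod q) then q else 0) - 1)"
    unfolding chi_correlation by (intro sum.cong refl) (simp add: cong_sym_eq)
  also have "\<dots> = (\<Sum>t\<in>{0..<q}. q * int (card {u \<in> {0..<q}. [u ^ 3 = t ^ 3] (mod q)}) - q)"
  proof (intro sum.cong refl)
    fix t
    have "(\<Sum>u\<in>{0..<q}. if [u ^ 3 = t ^ 3] (mod q) then q else 0) = (\<Sum>u\<in>{u \<in> {0..<q}. [u ^ 3 = t ^ 3] (mod q)}. q)"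
      by (rule sum.inter_filter[symmetric]) simp
    then show "(\<Sum>u\<in>{0..<q}. (if [u ^ 3 = t ^ 3] (mod q) then q else 0) - 1)
      = q * int (card {u \<in> {0..<q}. [u ^ 3 = t ^ 3] (mod q)}) - q"
      by (simp add: sum_subtractf)
  qed
  also have "\<dots> = q * int (card {u \<in> {0..<q}. [u ^ 3 = 0 ^ 3] (mod q)}) - q
      + (\<Sum>t\<in>{1..<q}. q * int (card {u \<in> {0..<q}. [u ^ 3 = t ^ 3] (mod q)}) - q)"
    by (rule full_sum)
  also have "(\<Sum>t\<in>{1..<q}. q * int (card {u \<in> {0..<q}. [u ^ 3 = t ^ 3] (mod q)}) - q) = (\<Sum>t\<in>{1..<q}. q * 3 - q)"
    by (intro sum.cong refl) (subst cube_fiber, auto dest: zdvd_imp_le)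
  also have "{u \<in> {0..<q}. [u ^ 3 = 0 ^ 3] (mod q)} = {0}"
    using prime_int_p q_gt_3 by (auto simp: cong_0_iff prime_dvd_power_iff dest: zdvd_imp_le)
  also have "q * int (card {0::int}) - q + (\<Sum>t\<in>{1..<q}. q * 3 - q) = 2 * q * (q - 1)"
    using q_gt_3 by (simp add: algebra_simps)
  finally show ?thesis .
qed

text \<open>The correlation with the symbol itself; this is the orthogonality relation that makes the three
values below sum to 0.\<close>
lemma chi_S_sum: "(\<Sum>r\<in>{0..<q}. chi r * S r) = 0"
proof -
  have "(\<Sum>r\<in>{0..<q}. chi r * S r) = (\<Sum>t\<in>{0..<q}. \<Sum>r\<in>{0..<q}. chi ((r + 0) * (r + t ^ 3)))"
    unfolding S_def sum_distrib_left by (subst sum.swap) (simp add: chi_mult add.commute)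
  also have "\<dots> = (\<Sum>t\<in>{0..<q}. if t = 0 then q - 1 else - 1)"
  proof (intro sum.cong refl)
    fix t assume "t \<in> {0..<q}"
    then have "[0 = t ^ 3] (mod q) \<longleftrightarrow> t = 0"
      using prime_int_p by (auto simp: cong_sym_eq[of 0] cong_0_iff prime_dvd_power_iff dest: zdvd_imp_le)
    then show "(\<Sum>r\<in>{0..<q}. chi ((r + 0) * (r + t ^ 3))) = (if t = 0 then q - 1 else - 1)"
      unfolding chi_correlation by simp
  qed
  also have "\<dots> = 0" unfolding full_sum using q_gt_3 by simp
  finally show ?thesis .
qed

text \<open>Representatives of the three classes modulo cubes up to sign. Every value \<open>S (g ^ e)\<close> is one of
these or its negative.\<close>
definition Sa :: int where "Sa = S 1"
definition Sb :: int where "Sb = S (g ^ 2)"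
definition Sc :: int where "Sc = S (g ^ 4)"

lemma S_g_3: "S (g ^ (e + 3)) = - S (g ^ e)"
  using S_scale[OF g_not_dvd, of "g ^ e"] chi_g by (simp add: power_add)

lemma q_m: "q = 6 * int m + 1" using p6 by linarith

lemma Sabc_squares: "Sa ^ 2 + Sb ^ 2 + Sc ^ 2 = 6 * q"
proof -
  have "(\<Sum>r\<in>{1..<q}. S r ^ 2) = (\<Sum>e<p - 1. S (g ^ e) ^ 2)"
    by (rule generator_sum) (simp add: S_period)
  also have "\<dots> = (\<Sum>e<3 * (2 * m). S (g ^ e) ^ 2)" unfolding p_minus_1 by simp
  also have "\<dots> = int (2 * m) * (S (g ^ 0) ^ 2 + S (g ^ 1) ^ 2 + S (g ^ 2) ^ 2)"
    by (rule sum_period_3) (simp add: S_g_3)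
  also have "S (g ^ 1) ^ 2 = Sc ^ 2" unfolding Sc_def using S_g_3[of 1] by simp
  finally have "int (2 * m) * (Sa ^ 2 + Sb ^ 2 + Sc ^ 2) = 2 * q * (q - 1)"
    using S_square_sum full_sum[of "\<lambda>r. S r ^ 2"] S_0 unfolding Sa_def Sb_def by (simp add: add_ac)
  also have "\<dots> = int (2 * m) * (6 * q)" by (simp add: q_m)
  finally show ?thesis using m_pos by simp
qed

lemma Sabc_sum: "Sa + Sb + Sc = 0"
proof -
  have "(\<Sum>r\<in>{1..<q}. chi r * S r) = (\<Sum>e<p - 1. chi (g ^ e) * S (g ^ e))"
    by (rule generator_sum) (metis S_period chi_period)
  also have "\<dots> = (\<Sum>e<3 * (2 * m). chi (g ^ e) * S (g ^ e))" unfolding p_minus_1 by simp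
  also have "\<dots> = int (2 * m) * (chi (g ^ 0) * S (g ^ 0) + chi (g ^ 1) * S (g ^ 1) + chi (g ^ 2) * S (g ^ 2))"
  proof (rule sum_period_3)
    fix e
    have "chi (g ^ (e + 3)) = - chi (g ^ e)"
      by (simp add: power_add chi_mult chi_g numeral_3_eq_3)
    then show "chi (g ^ (e + 3)) * S (g ^ (e + 3)) = chi (g ^ e) * S (g ^ e)" by (simp add: S_g_3)
  qed
  also have "chi (g ^ 1) * S (g ^ 1) = Sc" unfolding Sc_def using S_g_3[of 1] chi_g by simp
  also have "chi (g ^ 2) = 1" by (simp add: power2_eq_square chi_mult chi_g)
  also have "chi (g ^ 0) = 1" by (rule chi_eqI) auto
  finally have "int (2 * m) * (Sa + Sc + Sb) = 0"
    using chi_S_sum full_sum[of "\<lambda>r. chi r * S r"] S_0 unfolding Sa_def Sb_def by simp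
  then show ?thesis using m_pos by simp
qed

text \<open>The symbols are odd, except at the three cube roots of \<open>- 1\<close>, and \<open>p - 3\<close> is even.\<close>
lemma Sa_even: "even Sa"
proof -
  let ?Z = "{t \<in> {0..<q}. [t ^ 3 = (- 1) ^ 3] (mod q)}"
  have z: "q dvd t ^ 3 + 1 \<longleftrightarrow> [t ^ 3 = (- 1) ^ 3] (mod q)" for t
    by (simp add: cong_iff_dvd_diff)
  have "even (chi u - (if q dvd u then 0 else 1))" for u
    using chi_values[of u] chi_0_iff[of u] by auto
  then have "even (\<Sum>t\<in>{0..<q}. chi (t ^ 3 + 1) - (if q dvd t ^ 3 + 1 then 0 else 1))"
    by (intro dvd_sum) auto
  moreover have "(\<Sum>t\<in>{0..<q}. if q dvd t ^ 3 + 1 then 0 else (1::int)) = q - 3"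
  proof -
    have "(\<Sum>t\<in>{0..<q}. if q dvd t ^ 3 + 1 then 0 else (1::int)) = (\<Sum>t\<in>{0..<q}. 1 - (if [t ^ 3 = (- 1) ^ 3] (mod q) then 1 else 0))"
      unfolding z by (intro sum.cong refl) simp
    also have "\<dots> = q - (\<Sum>t\<in>{0..<q}. if [t ^ 3 = (- 1) ^ 3] (mod q) then 1 else 0)"
      by (simp add: sum_subtractf)
    also have "(\<Sum>t\<in>{0..<q}. if [t ^ 3 = (- 1) ^ 3] (mod q) then 1 else (0::int)) = (\<Sum>t\<in>?Z. 1)"
      by (rule sum.inter_filter[symmetric]) simp
    also have "\<dots> = 3"
      using cube_fiber[of "- 1"] q_gt_3 by simp
    finally show ?thesis .
  qed
  ultimately have "even (Sa - (q - 3))" unfolding Sa_def S_def by (simp add: sum_subtractf)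
  moreover have "even (q - 3)" using q_eq by simp
  ultimately show ?thesis by simp
qed

text \<open>The left hand side is the norm of an Eisenstein integer, so up to the ramified prime above 3 the
character sums provide an element of norm \<open>p\<close>.\<close>
lemma Sab_norm: "Sa ^ 2 + Sa * Sb + Sb ^ 2 = 3 * q"
proof -
  have c: "Sc = - Sa - Sb" using Sabc_sum by simp
  have "2 * (Sa ^ 2 + Sa * Sb + Sb ^ 2) = 2 * (3 * q)"
    using Sabc_squares unfolding c by (simp add: power2_eq_square algebra_simps)
  then show ?thesis by simp
qed

text \<open>From the norm equation \<open>p = x'\<^sup>2 + 3 y'\<^sup>2\<close> with \<open>Sa = 2 x'\<close>; uniqueness of such a
representation of a prime follows from Brahmagupta's identity.\<close>
lemma Sa_square:
  assumes xy: "q = x ^ 2 + 3 * y ^ 2"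
  shows "Sa ^ 2 = 4 * x ^ 2"
proof -
  obtain x' where x': "Sa = 2 * x'" using Sa_even by blast
  \<comment> \<open>completing the square in the norm equation\<close>
  have e: "(Sb + x') ^ 2 + 3 * x' ^ 2 = 3 * q"
    using Sab_norm unfolding x' by (simp add: power2_eq_square algebra_simps)
  then have "3 dvd (Sb + x') ^ 2" by presburger
  then have "3 dvd Sb + x'" using prime_dvd_power[of "3 :: int"] by (simp add: prime_dvd_power_iff)
  then obtain y' where y': "Sb + x' = 3 * y'" by blast
  have xy': "q = x' ^ 2 + 3 * y' ^ 2" using e unfolding y' by (simp add: power_mult_distrib)
  \<comment> \<open>two representations coincide up to signs: \<open>p\<close> divides one of these factors, which is too small to be nonzero\<close>
  have "q dvd (x * y' - x' * y) * (x * y' + x' * y)"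
  proof -
    have "(x * y' - x' * y) * (x * y' + x' * y) = q * (y' ^ 2 - y ^ 2)"
      using xy xy' by Groebner_Basis.algebra
    then show ?thesis by simp
  qed
  then have "q dvd x * y' - x' * y \<or> q dvd x * y' + x' * y" by (simp add: dvd_mult_int)
  \<comment> \<open>the sign \<open>s\<close> covers both factors at once\<close>
  then obtain s :: int where s: "s ^ 2 = 1" "q dvd x * y' - s * x' * y"
  proof
    assume "q dvd x * y' - x' * y" then show thesis by (intro that[of 1]) auto
  next
    assume "q dvd x * y' + x' * y" then show thesis by (intro that[of "- 1"]) auto
  qed
  define d where "d = x * y' - s * x' * y"
  have n: "(x * s * x' + 3 * y * y') ^ 2 + 3 * d ^ 2 = q ^ 2"
    unfolding d_def using xy xy' s(1) by Groebner_Basis.algebra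
  have "d = 0"
  proof (rule ccontr)
    assume "d \<noteq> 0"
    then have "q \<le> \<bar>d\<bar>" using s(2) q_gt_3 unfolding d_def[symmetric] by (metis dvd_imp_le_int abs_of_nat)
    then have "q ^ 2 \<le> d ^ 2" using q_gt_3 by (metis abs_le_square_iff abs_of_nat)
    moreover have "3 * d ^ 2 \<le> q ^ 2" using n zero_le_power2[of "x * s * x' + 3 * y * y'"] by linarith
    moreover have "q ^ 2 > 0" using q_gt_3 by simp
    ultimately show False by linarith
  qed
  then have "(x * y' - s * x' * y) * (x * y' + s * x' * y) = 0" unfolding d_def by simp
  then have "q * (y' ^ 2 - y ^ 2) = 0" using xy xy' s(1) by Groebner_Basis.algebra
  then have "y' ^ 2 = y ^ 2" using q_gt_3 by simp
  then have "x' ^ 2 = x ^ 2" using xy xy' by simp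
  then show ?thesis unfolding x' by (simp add: power_mult_distrib)
qed

end

section \<open>The cubic character sum modulo p cubed\<close>

context padic_prime_1
begin

text \<open>The quintic polynomial \<open>(15 y - 10 y\<^sup>3 + 3 y\<^sup>5) / 8\<close> has the value \<open>s\<close> to third order at \<open>s = 1\<close> and
\<open>s = - 1\<close>, so evaluating it at \<open>y = u ^ n\<close>, which is \<open>\<plusminus>1\<close> modulo \<open>p\<close>, gives the sign modulo
\<open>p\<^sup>3\<close>. If \<open>p\<close> divides \<open>u\<close>, then \<open>p\<^sup>3\<close> already divides \<open>y\<close> as \<open>n \<ge> 3\<close>.\<close>
lemma chi_cong_p3: "[8 * chi u = 15 * u ^ (3 * m) - 10 * u ^ (9 * m) + 3 * u ^ (15 * m)] (mod q ^ 3)"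
proof -
  define y where "y = u ^ n"
  define s where "s = chi u"
  have pw: "u ^ (3 * m) = y" "u ^ (9 * m) = y ^ 3" "u ^ (15 * m) = y ^ 5"
    unfolding y_def n_eq by (simp_all flip: power_mult)
  have ys: "q dvd y - s" using chi_cong[of u] unfolding y_def s_def by (simp add: cong_iff_dvd_diff dvd_diff_commute)
  have "q ^ 3 dvd 15 * y - 10 * y ^ 3 + 3 * y ^ 5 - 8 * s"
  proof (cases "s = 0")
    case True
    then have "q dvd u" using chi_0_iff s_def by simp
    then have "q ^ n dvd y" unfolding y_def by (rule dvd_power_same)
    moreover have "q ^ 3 dvd q ^ n" using n_eq m_pos by (intro le_imp_power_dvd) auto
    ultimately have "q ^ 3 dvd y" using dvd_trans by blast
    then have "q ^ 3 dvd y * (15 - 10 * y ^ 2 + 3 * y ^ 4)" by simp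
    moreover have "y * (15 - 10 * y ^ 2 + 3 * y ^ 4) = 15 * y - 10 * y ^ 3 + 3 * y ^ 5 - 8 * s"
      unfolding True by (simp add: algebra_simps eval_nat_numeral)
    ultimately show ?thesis by simp
  next
    case False
    then have s1: "s ^ 2 = 1" using chi_values[of u] s_def by auto
    \<comment> \<open>the triple zero at \<open>y = s\<close>, with \<open>s\<^sup>2 = 1\<close>\<close>
    have "q ^ 3 dvd (y - s) ^ 3 * (3 * y ^ 2 + 9 * s * y + 8)" using ys by (simp add: dvd_power_same)
    moreover have "(y - s) ^ 3 * (3 * y ^ 2 + 9 * s * y + 8) = 15 * y - 10 * y ^ 3 + 3 * y ^ 5 - 8 * s"
      using s1 by Groebner_Basis.algebra
    ultimately show ?thesis by simp
  qed
  then show ?thesis unfolding pw s_def[symmetric] by (simp add: cong_iff_dvd_diff dvd_diff_commute)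
qed

text \<open>In the binomial expansion only the exponents \<open>3 j\<close> divisible by \<open>p - 1 = 6 m\<close> survive. The summand
for \<open>t = 0\<close> is separate.\<close>
lemma power_sum_shifted:
  assumes L: "2 * m * L \<le> B" "B < 2 * m * Suc L"
  shows "[(\<Sum>t\<in>{0..<q}. ((t ^ p\<^sup>2) ^ 3 + R) ^ B)
     = R ^ B + (q - 1) * (\<Sum>l\<le>L. int (B choose (2 * m * l)) * R ^ (B - 2 * m * l))] (mod q ^ 3)"
proof -
  have d: "(p - 1) dvd 3 * j \<longleftrightarrow> 2 * m dvd j" for j
  proof -
    have "p - 1 = 3 * (2 * m)" using p_minus_1 by simp
    then show ?thesis by (simp only: dvd_mult_cancel_left) simp
  qed
  have "(\<Sum>t\<in>{1..<q}. ((t ^ p\<^sup>2) ^ 3 + R) ^ B) = (\<Sum>j\<le>B. int (B choose j) * R ^ (B - j) * (\<Sum>t\<in>{1..<q}. (t ^ p\<^sup>2) ^ (3 * j)))"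
    unfolding binomial_ring sum_distrib_left
    by (subst sum.swap) (simp add: mult_ac flip: power_mult)
  also have "[(\<Sum>j\<le>B. int (B choose j) * R ^ (B - j) * (\<Sum>t\<in>{1..<q}. (t ^ p\<^sup>2) ^ (3 * j)))
     = (\<Sum>j\<le>B. int (B choose j) * R ^ (B - j) * (if (p - 1) dvd 3 * j then q - 1 else 0))] (mod q ^ 3)"
    by (intro cong_sum cong_mult cong_refl power_sum)
  also have "(\<Sum>j\<le>B. int (B choose j) * R ^ (B - j) * (if (p - 1) dvd 3 * j then q - 1 else 0))
     = (\<Sum>j\<in>{j \<in> {..B}. 2 * m dvd j}. int (B choose j) * R ^ (B - j) * (q - 1))"
    unfolding d by (subst sum.inter_filter) (auto intro!: sum.cong)
  also have "\<dots> = (\<Sum>l\<le>L. int (B choose (2 * m * l)) * R ^ (B - 2 * m * l) * (q - 1))"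
  proof (rule sum.reindex_bij_witness[of _ "\<lambda>l. 2 * m * l" "\<lambda>j. j div (2 * m)"])
    fix j assume j: "j \<in> {j \<in> {..B}. 2 * m dvd j}"
    then obtain i where i: "j = 2 * m * i" by blast
    show "2 * m * (j div (2 * m)) = j" using j by simp
    have "2 * m * i < 2 * m * Suc L" using i j L(2) by simp
    then have "i < Suc L" by (rule mult_left_less_imp_less) simp
    then show "j div (2 * m) \<in> {..L}" using m_pos unfolding i by simp
  next
    fix l assume "l \<in> {..L}"
    then have "2 * m * l \<le> 2 * m * L" by simp
    then have "2 * m * l \<le> B" using L(1) by (rule le_trans)
    then show "2 * m * l \<in> {j \<in> {..B}. 2 * m dvd j}" by simp
  qed (use m_pos in auto)
  also have "\<dots> = (q - 1) * (\<Sum>l\<le>L. int (B choose (2 * m * l)) * R ^ (B - 2 * m * l))"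
    by (simp add: sum_distrib_left mult_ac)
  finally have "[(\<Sum>t\<in>{1..<q}. ((t ^ p\<^sup>2) ^ 3 + R) ^ B)
     = (q - 1) * (\<Sum>l\<le>L. int (B choose (2 * m * l)) * R ^ (B - 2 * m * l))] (mod q ^ 3)" .
  then have "[R ^ B + (\<Sum>t\<in>{1..<q}. ((t ^ p\<^sup>2) ^ 3 + R) ^ B)
     = R ^ B + (q - 1) * (\<Sum>l\<le>L. int (B choose (2 * m * l)) * R ^ (B - 2 * m * l))] (mod q ^ 3)"
    by (intro cong_add cong_refl)
  then show ?thesis unfolding full_sum using p_pos by (simp add: power_0_left)
qed

lemma power_sum_root:
  assumes L: "2 * m * L \<le> B" "B < 2 * m * Suc L" and B: "[R ^ B = 1] (mod q ^ 3)" and R: "[R ^ (6 * m) = 1] (mod q ^ 3)"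
  shows "[(\<Sum>t\<in>{0..<q}. ((t ^ p\<^sup>2) ^ 3 + R) ^ B)
     = 1 + (q - 1) * (\<Sum>l\<le>L. int (B choose (2 * m * l)) * ((R ^ (2 * m)) ^ 2) ^ l)] (mod q ^ 3)"
proof -
  have "[R ^ (B - 2 * m * l) = ((R ^ (2 * m)) ^ 2) ^ l] (mod q ^ 3)" if "l \<le> L" for l
  proof -
    have le: "2 * m * l \<le> B" using L(1) that by (meson le_trans mult_le_mono2)
    have "[R ^ (B - 2 * m * l) * (R ^ (6 * m)) ^ l = R ^ (B - 2 * m * l) * 1 ^ l] (mod q ^ 3)"
      by (intro cong_mult cong_refl cong_pow R)
    then have 1: "[R ^ (B - 2 * m * l) = R ^ (B - 2 * m * l) * (R ^ (6 * m)) ^ l] (mod q ^ 3)" by (simp add: cong_sym)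
    have "B - 2 * m * l + 6 * m * l = B + 4 * m * l" using le by simp
    then have "R ^ (B - 2 * m * l) * (R ^ (6 * m)) ^ l = R ^ B * ((R ^ (2 * m)) ^ 2) ^ l"
      by (simp flip: power_mult power_add) (simp add: mult_ac add.commute)
    also have "[R ^ B * ((R ^ (2 * m)) ^ 2) ^ l = 1 * ((R ^ (2 * m)) ^ 2) ^ l] (mod q ^ 3)"
      by (intro cong_mult cong_refl B)
    finally show ?thesis using 1 cong_trans by fastforce
  qed
  then have "[R ^ B + (q - 1) * (\<Sum>l\<le>L. int (B choose (2 * m * l)) * R ^ (B - 2 * m * l))
     = 1 + (q - 1) * (\<Sum>l\<le>L. int (B choose (2 * m * l)) * ((R ^ (2 * m)) ^ 2) ^ l)] (mod q ^ 3)"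
    by (intro cong_add cong_mult cong_refl cong_sum B) auto
  with power_sum_shifted[OF L] show ?thesis by (rule cong_trans)
qed

text \<open>The integers \<open>Y0\<close>, \<open>Y1\<close>, \<open>Y2\<close> are the coefficients of the expansion of \<open>8 * S R\<close> in
powers of the cube root of unity attached to \<open>R\<close>, for the exponents \<open>3 m\<close>, \<open>9 m\<close>, \<open>15 m\<close>
of the quintic polynomial.\<close>
definition Y0 :: int where "Y0 = 8 + (q - 1) * (15 - 10 * (1 + int ((9 * m) choose (6 * m)))
    + 3 * (1 + int ((15 * m) choose (6 * m)) + int ((15 * m) choose (12 * m))))"
definition Y1 :: int where "Y1 = (q - 1) * (15 * int ((3 * m) choose (2 * m))
    - 10 * (int ((9 * m) choose (2 * m)) + int ((9 * m) choose (8 * m)))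
    + 3 * (int ((15 * m) choose (2 * m)) + int ((15 * m) choose (8 * m)) + int ((15 * m) choose (14 * m))))"
definition Y2 :: int where "Y2 = (q - 1) * (- 10 * int ((9 * m) choose (4 * m))
    + 3 * (int ((15 * m) choose (4 * m)) + int ((15 * m) choose (10 * m))))"

text \<open>Collecting the surviving binomial coefficients by the residue of their index modulo 3, since
\<open>\<theta> ^ 3 \<equiv> 1\<close>.\<close>
lemma S_expansion:
  assumes R: "[R ^ (3 * m) = 1] (mod q ^ 3)"
  defines "\<theta> \<equiv> R ^ (2 * m)"
  shows "[8 * S R = Y0 + Y1 * \<theta> ^ 2 + Y2 * \<theta>] (mod q ^ 3)"
proof -
  let ?X = "\<lambda>t. (t ^ p\<^sup>2) ^ 3 + R"
  let ?s = "\<lambda>B L. 1 + (q - 1) * (\<Sum>l\<le>L. int (B choose (2 * m * l)) * (\<theta> ^ 2) ^ l)"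
  have RB: "[R ^ (3 * m * k) = 1] (mod q ^ 3)" for k
    using cong_pow[OF R, of k] by (simp add: power_mult)
  have e1: "8 * S R = (\<Sum>t\<in>{0..<q}. 8 * chi (?X t))"
    unfolding S_def sum_distrib_left
    by (intro sum.cong refl arg_cong[where f = "\<lambda>x. 8 * x"] chi_period cong_add cong_pow cong_refl cong_sym[OF power_p2])
  have c1: "[(\<Sum>t\<in>{0..<q}. 8 * chi (?X t))
     = (\<Sum>t\<in>{0..<q}. 15 * ?X t ^ (3 * m) - 10 * ?X t ^ (9 * m) + 3 * ?X t ^ (15 * m))] (mod q ^ 3)"
    by (intro cong_sum chi_cong_p3)
  have e2: "(\<Sum>t\<in>{0..<q}. 15 * ?X t ^ (3 * m) - 10 * ?X t ^ (9 * m) + 3 * ?X t ^ (15 * m))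
     = 15 * (\<Sum>t\<in>{0..<q}. ?X t ^ (3 * m)) - 10 * (\<Sum>t\<in>{0..<q}. ?X t ^ (9 * m)) + 3 * (\<Sum>t\<in>{0..<q}. ?X t ^ (15 * m))"
    by (simp only: sum.distrib sum_subtractf sum_distrib_left)
  have c2: "[15 * (\<Sum>t\<in>{0..<q}. ?X t ^ (3 * m)) - 10 * (\<Sum>t\<in>{0..<q}. ?X t ^ (9 * m)) + 3 * (\<Sum>t\<in>{0..<q}. ?X t ^ (15 * m))
     = 15 * ?s (3 * m) 1 - 10 * ?s (9 * m) 4 + 3 * ?s (15 * m) 7] (mod q ^ 3)"
  proof -
    have k: "3 * m * 2 = 6 * m" "3 * m * 3 = 9 * m" "3 * m * 5 = 15 * m" by simp_all
    note R6 = RB[of 2, unfolded k] and R9 = RB[of 3, unfolded k] and R15 = RB[of 5, unfolded k]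
    have L1: "2 * m * 1 \<le> 3 * m" "3 * m < 2 * m * Suc 1"
      and L4: "2 * m * 4 \<le> 9 * m" "9 * m < 2 * m * Suc 4"
      and L7: "2 * m * 7 \<le> 15 * m" "15 * m < 2 * m * Suc 7"
      using m_pos by simp_all
    show ?thesis
      unfolding \<theta>_def
      by (rule cong_add[OF cong_diff[OF cong_mult[OF cong_refl power_sum_root[OF L1 R R6]]
            cong_mult[OF cong_refl power_sum_root[OF L4 R9 R6]]]
            cong_mult[OF cong_refl power_sum_root[OF L7 R15 R6]]])
  qed
  \<comment> \<open>the quotient when the powers of \<open>\<theta>\<close> are reduced by \<open>\<theta> ^ 3 - 1\<close>\<close>
  define c where "c = ((q - 1) * (
        - 10 * (int ((9 * m) choose (4 * m)) * \<theta> + int ((9 * m) choose (6 * m)) * (\<theta> ^ 3 + 1) + int ((9 * m) choose (8 * m)) * \<theta> ^ 2 * (\<theta> ^ 3 + 1))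
        + 3 * (int ((15 * m) choose (4 * m)) * \<theta> + int ((15 * m) choose (6 * m)) * (\<theta> ^ 3 + 1) + int ((15 * m) choose (8 * m)) * \<theta> ^ 2 * (\<theta> ^ 3 + 1)
           + int ((15 * m) choose (10 * m)) * \<theta> * (\<theta> ^ 6 + \<theta> ^ 3 + 1) + int ((15 * m) choose (12 * m)) * (\<theta> ^ 9 + \<theta> ^ 6 + \<theta> ^ 3 + 1)
           + int ((15 * m) choose (14 * m)) * \<theta> ^ 2 * (\<theta> ^ 9 + \<theta> ^ 6 + \<theta> ^ 3 + 1))))"
  have e3: "15 * ?s (3 * m) 1 - 10 * ?s (9 * m) 4 + 3 * ?s (15 * m) 7
     = Y0 + Y1 * \<theta> ^ 2 + Y2 * \<theta> + (\<theta> ^ 3 - 1) * c"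
  proof -
    have sums: "(\<Sum>l\<le>1. f l) = f 0 + f 1" "(\<Sum>l\<le>4. f l) = f 0 + f 1 + f 2 + f 3 + f 4"
      "(\<Sum>l\<le>7. f l) = f 0 + f 1 + f 2 + f 3 + f 4 + f 5 + f 6 + f 7" for f :: "nat \<Rightarrow> int"
      by (simp_all add: eval_nat_numeral)
    have idx: "2 * m * 0 = 0" "2 * m * 1 = 2 * m" "2 * m * 2 = 4 * m" "2 * m * 3 = 6 * m" "2 * m * 4 = 8 * m"
      "2 * m * 5 = 10 * m" "2 * m * 6 = 12 * m" "2 * m * 7 = 14 * m" by simp_all
    show ?thesis
      unfolding c_def sums idx binomial_n_0 of_nat_1 Y0_def Y1_def Y2_def by Groebner_Basis.algebra
  qed
  have c3: "[Y0 + Y1 * \<theta> ^ 2 + Y2 * \<theta> + (\<theta> ^ 3 - 1) * c = Y0 + Y1 * \<theta> ^ 2 + Y2 * \<theta> + (1 - 1) * c] (mod q ^ 3)"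
  proof (intro cong_add cong_mult cong_diff cong_refl)
    have "\<theta> ^ 3 = R ^ (3 * m * 2)" unfolding \<theta>_def by (simp flip: power_mult)
    then show "[\<theta> ^ 3 = 1] (mod q ^ 3)" using RB[of 2] by simp
  qed
  show ?thesis
    using cong_trans[OF cong_trans[OF c1[folded e1, unfolded e2] c2, unfolded e3] c3] by simp
qed

text \<open>The expansions of \<open>Sa\<close>, \<open>Sb\<close>, \<open>Sc\<close> form a finite Fourier transform over the cube roots of unity.
The relation \<open>Sa + Sb + Sc = 0\<close> forces \<open>Y0 \<equiv> 0\<close>, and the norm equation is
\<open>3 Y1 Y2 \<equiv> 3 * 64 p\<close> in terms of the transform. So \<open>Y1 / 8\<close> and \<open>Y2 / 8\<close> play the role of the
two Frobenius eigenvalues.\<close>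
lemma Y_relations: "[Y0 = 0] (mod q ^ 3)" "[Y1 * Y2 = 64 * q] (mod q ^ 3)" "[8 * Sa = Y1 + Y2] (mod q ^ 3)"
proof -
  define G where "G = g ^ p\<^sup>2"
  define \<theta> where "\<theta> = (G ^ 2) ^ (2 * m)"
  have Gg: "[G = g] (mod q)" unfolding G_def by (rule power_p2)
  have "[(g ^ (p - 1)) ^ p\<^sup>2 = 1 ^ p\<^sup>2] (mod q ^ 3)" by (rule lift_cong_p2) (simp add: g_power_1_iff)
  then have G6: "[G ^ (6 * m) = 1] (mod q ^ 3)" unfolding G_def p_minus_1 by (simp add: mult_ac flip: power_mult)
  have Sb: "Sb = S (G ^ 2)" "Sc = S (G ^ 4)" unfolding Sb_def Sc_def
    by (intro S_period cong_pow cong_sym[OF Gg])+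
  have a: "[8 * Sa = Y0 + Y1 + Y2] (mod q ^ 3)" using S_expansion[of 1] unfolding Sa_def by simp
  have b: "[8 * Sb = Y0 + Y1 * \<theta> ^ 2 + Y2 * \<theta>] (mod q ^ 3)"
    unfolding Sb \<theta>_def by (rule S_expansion) (use G6 in \<open>simp flip: power_mult\<close>)
  have "(G ^ 4) ^ (2 * m) = \<theta> ^ 2" unfolding \<theta>_def by (simp flip: power_mult)
  moreover have "[(G ^ 4) ^ (3 * m) = 1] (mod q ^ 3)"
    using cong_pow[OF G6, of 2] by (simp flip: power_mult)
  ultimately have c: "[8 * Sc = Y0 + Y1 * (\<theta> ^ 2) ^ 2 + Y2 * \<theta> ^ 2] (mod q ^ 3)"
    using S_expansion[of "G ^ 4"] Sb(2) by simp
  have t3: "q ^ 3 dvd \<theta> ^ 3 - 1"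
    using cong_pow[OF G6, of 2] unfolding \<theta>_def by (simp add: cong_iff_dvd_diff flip: power_mult)
  have "\<not> q dvd \<theta> - 1"
  proof
    assume "q dvd \<theta> - 1"
    then have "[\<theta> = 1] (mod q)" by (simp add: cong_iff_dvd_diff)
    moreover have "[\<theta> = (g ^ 2) ^ (2 * m)] (mod q)" unfolding \<theta>_def by (intro cong_pow Gg)
    moreover have "(g ^ 2) ^ (2 * m) = w ^ 2" unfolding w_def by (simp flip: power_mult)
    ultimately show False using w_ne(2) cong_sym cong_trans by metis
  qed
  then have "coprime (q ^ 3) (\<theta> - 1)" using prime_int_p by (simp add: prime_imp_coprime)
  moreover have "\<theta> ^ 3 - 1 = (\<theta> - 1) * (\<theta> ^ 2 + \<theta> + 1)" by (simp add: algebra_simps eval_nat_numeral)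
  ultimately have t: "q ^ 3 dvd \<theta> ^ 2 + \<theta> + 1" using t3 by (simp add: coprime_dvd_mult_right_iff)
  have c3: "coprime (q ^ 3) 3"
    using prime_int_p q_gt_3 by (metis coprime_power_left_iff prime_imp_coprime zdvd_not_zless zero_less_numeral)
  have "q ^ 3 dvd 8 * (Sa + Sb + Sc) - (Y0 + Y1 + Y2 + (Y0 + Y1 * \<theta> ^ 2 + Y2 * \<theta>) + (Y0 + Y1 * (\<theta> ^ 2) ^ 2 + Y2 * \<theta> ^ 2))"
    using cong_add[OF cong_add[OF a b] c] by (simp add: cong_iff_dvd_diff algebra_simps)
  then have 1: "q ^ 3 dvd Y0 + Y1 + Y2 + (Y0 + Y1 * \<theta> ^ 2 + Y2 * \<theta>) + (Y0 + Y1 * (\<theta> ^ 2) ^ 2 + Y2 * \<theta> ^ 2)"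
    by (simp only: Sabc_sum mult_zero_right diff_0 dvd_minus_iff)
  have "3 * Y0 = Y0 + Y1 + Y2 + (Y0 + Y1 * \<theta> ^ 2 + Y2 * \<theta>) + (Y0 + Y1 * (\<theta> ^ 2) ^ 2 + Y2 * \<theta> ^ 2)
     - (\<theta> ^ 2 + \<theta> + 1) * (Y1 * (\<theta> ^ 2 - \<theta> + 1) + Y2)" by Groebner_Basis.algebra
  then have "q ^ 3 dvd 3 * Y0" using 1 t by (metis dvd_diff dvd_mult2)
  then have "q ^ 3 dvd Y0" using c3 by (simp add: coprime_dvd_mult_right_iff)
  then show y0: "[Y0 = 0] (mod q ^ 3)" by (simp add: cong_0_iff)
  have z: "[Y0 + u = u] (mod q ^ 3)" for u using cong_add[OF y0 cong_refl[of u]] by simp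
  show a': "[8 * Sa = Y1 + Y2] (mod q ^ 3)" using cong_trans[OF a] z[of "Y1 + Y2"] by (simp add: add.assoc)
  have b': "[8 * Sb = Y1 * \<theta> ^ 2 + Y2 * \<theta>] (mod q ^ 3)"
    using cong_trans[OF b] z[of "Y1 * \<theta> ^ 2 + Y2 * \<theta>"] by (simp add: add.assoc)
  have "[(8 * Sa) ^ 2 + (8 * Sa) * (8 * Sb) + (8 * Sb) ^ 2
     = (Y1 + Y2) ^ 2 + (Y1 + Y2) * (Y1 * \<theta> ^ 2 + Y2 * \<theta>) + (Y1 * \<theta> ^ 2 + Y2 * \<theta>) ^ 2] (mod q ^ 3)"
    by (intro cong_add cong_mult cong_pow a' b')
  moreover have "(8 * Sa) ^ 2 + (8 * Sa) * (8 * Sb) + (8 * Sb) ^ 2 = 3 * (64 * q)"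
    using Sab_norm by (simp add: power_mult_distrib algebra_simps)
  moreover have "(Y1 + Y2) ^ 2 + (Y1 + Y2) * (Y1 * \<theta> ^ 2 + Y2 * \<theta>) + (Y1 * \<theta> ^ 2 + Y2 * \<theta>) ^ 2
     = 3 * (Y1 * Y2) + (\<theta> ^ 2 + \<theta> + 1) * (Y1 ^ 2 * (\<theta> ^ 2 - \<theta> + 1) + Y2 ^ 2 + Y1 * Y2 * (2 * \<theta> - 1))"
    by Groebner_Basis.algebra
  ultimately have "q ^ 3 dvd 3 * (64 * q) - (3 * (Y1 * Y2) + (\<theta> ^ 2 + \<theta> + 1) * (Y1 ^ 2 * (\<theta> ^ 2 - \<theta> + 1) + Y2 ^ 2 + Y1 * Y2 * (2 * \<theta> - 1)))"
    by (simp only: cong_iff_dvd_diff)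
  moreover have "q ^ 3 dvd (\<theta> ^ 2 + \<theta> + 1) * (Y1 ^ 2 * (\<theta> ^ 2 - \<theta> + 1) + Y2 ^ 2 + Y1 * Y2 * (2 * \<theta> - 1))"
    using t by (rule dvd_mult2)
  ultimately have "q ^ 3 dvd 3 * (64 * q) - (3 * (Y1 * Y2) + (\<theta> ^ 2 + \<theta> + 1) * (Y1 ^ 2 * (\<theta> ^ 2 - \<theta> + 1) + Y2 ^ 2 + Y1 * Y2 * (2 * \<theta> - 1)))
      + (\<theta> ^ 2 + \<theta> + 1) * (Y1 ^ 2 * (\<theta> ^ 2 - \<theta> + 1) + Y2 ^ 2 + Y1 * Y2 * (2 * \<theta> - 1))"
    by (rule dvd_add)
  then have "q ^ 3 dvd 3 * (64 * q - Y1 * Y2)" by (simp add: algebra_simps)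
  then have "q ^ 3 dvd 64 * q - Y1 * Y2" by (simp only: coprime_dvd_mult_right_iff[OF c3])
  then show "[Y1 * Y2 = 64 * q] (mod q ^ 3)" by (simp add: cong_iff_dvd_diff dvd_diff_commute)
qed

end

section \<open>Expansion to second order in p\<close>

context padic_prime
begin

text \<open>Second order expansions in \<open>p\<close> whose coefficients may contain harmonic sums. These are kept as
formal coefficients, since comparing them is a matter of polynomial identities.\<close>
definition quad :: "rat \<Rightarrow> rat \<Rightarrow> rat \<Rightarrow> rat \<Rightarrow> bool" where
  "quad x c0 c1 c2 \<longleftrightarrow> x \<simeq>\<^sub>3 c0 + P * c1 + P\<^sup>2 * c2 \<and> c0 \<in> Zp \<and> c1 \<in> Zp \<and> c2 \<in> Zp"

lemma quad_Zp: "quad x a b c \<Longrightarrow> x \<in> Zp"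
proof -
  assume q: "quad x a b c"
  then have "x \<simeq>\<^sub>3 a + P * b + P\<^sup>2 * c" "a + P * b + P\<^sup>2 * c \<in> Zp" unfolding quad_def by auto
  then show "x \<in> Zp" by (rule rc_Zp)
qed

lemma quad_const: "c \<in> Zp \<Longrightarrow> quad c c 0 0" unfolding quad_def by simp

lemma quad_linear: "a \<in> Zp \<Longrightarrow> b \<in> Zp \<Longrightarrow> quad (a + b * P) a b 0"
  unfolding quad_def by (simp add: mult.commute)

lemma quad_add: "quad x a b c \<Longrightarrow> quad y d e f \<Longrightarrow> quad (x + y) (a + d) (b + e) (c + f)"
proof -
  assume x: "quad x a b c" and y: "quad y d e f"
  have "x + y \<simeq>\<^sub>3 (a + P * b + P\<^sup>2 * c) + (d + P * e + P\<^sup>2 * f)"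
    using x y unfolding quad_def by (intro rc_add) auto
  also have "(a + P * b + P\<^sup>2 * c) + (d + P * e + P\<^sup>2 * f) = (a + d) + P * (b + e) + P\<^sup>2 * (c + f)"
    by (simp add: algebra_simps)
  finally show ?thesis using x y unfolding quad_def by auto
qed

lemma quad_mult: "quad x a b c \<Longrightarrow> quad y d e f \<Longrightarrow> quad (x * y) (a * d) (a * e + b * d) (a * f + b * e + c * d)"
proof -
  assume x: "quad x a b c" and y: "quad y d e f"
  have z: "a \<in> Zp" "b \<in> Zp" "c \<in> Zp" "d \<in> Zp" "e \<in> Zp" "f \<in> Zp" using x y unfolding quad_def by auto
  have "x * y \<simeq>\<^sub>3 (a + P * b + P\<^sup>2 * c) * (d + P * e + P\<^sup>2 * f)"
    using x y quad_Zp[OF x] z unfolding quad_def by (intro rc_mult) auto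
  also have "\<dots> \<simeq>\<^sub>3 a * d + P * (a * e + b * d) + P\<^sup>2 * (a * f + b * e + c * d)"
    by (rule rat_cong_I[of _ _ _ "b * f + c * e + P * (c * f)"])
       (use z in \<open>auto simp: algebra_simps power2_eq_square power3_eq_cube\<close>)
  finally show ?thesis using z unfolding quad_def by auto
qed

lemma quad_minus: "quad x a b c \<Longrightarrow> quad (- x) (- a) (- b) (- c)"
  using quad_mult[OF quad_const[of "- 1"]] by fastforce

lemma quad_E:
  assumes "logc x (P * l + P\<^sup>2 * k)" "l \<in> Zp" "k \<in> Zp"
  shows "quad x 1 l (k + l\<^sup>2 / 2)"
proof -
  have "x \<simeq>\<^sub>3 E (P * l + P\<^sup>2 * k)" using assms unfolding logc_def by simp
  also have "\<dots> \<simeq>\<^sub>3 1 + P * l + P\<^sup>2 * (k + l\<^sup>2 / 2)"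
    by (rule rat_cong_I[of _ _ _ "l * k + P * k\<^sup>2 / 2"])
       (use assms in \<open>auto simp: E_def field_simps power2_eq_square power3_eq_cube\<close>)
  finally show ?thesis using assms unfolding quad_def by auto
qed

lemma quad_cong: "quad x a b c \<Longrightarrow> quad y a b c \<Longrightarrow> x \<simeq>\<^sub>3 y"
  unfolding quad_def using rc_trans rc_sym by blast

lemma fact_p_plus: "fact (p + a) = fact p * (fact a * br a 1)"
proof -
  have "pochhammer 1 (p + a) = pochhammer 1 p * pochhammer (1 + P) a" by (rule pochhammer_product')
  then show ?thesis using br_pochhammer[of 1 a] by (simp add: pochhammer_fact)
qed

lemma fact_2p_plus: "fact (2 * p + a) = 2 * br (p - 1) 1 * (fact p)\<^sup>2 * (fact a * br a 2)"
proof -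
  have "pochhammer (1 :: rat) (2 * p + a) = pochhammer 1 (2 * p) * pochhammer (1 + of_nat (2 * p)) a" by (rule pochhammer_product')
  then have 1: "fact (2 * p + a) = fact (2 * p) * (fact a * br a 2)"
    using br_pochhammer[of 2 a] by (simp add: pochhammer_fact)
  have "pochhammer (1 + 1 * P) (Suc (p - 1)) = pochhammer (1 + 1 * P) (p - 1) * (1 + 1 * P + of_nat (p - 1))"
    by (rule pochhammer_Suc)
  also have "1 + 1 * P + of_nat (p - 1) = 2 * P" using p_pos by (simp add: of_nat_diff)
  finally have 2: "pochhammer (1 + P) p = fact (p - 1) * br (p - 1) 1 * (2 * P)"
    using p_pos br_pochhammer[of 1 "p - 1"] by simp
  have "pochhammer (1 :: rat) (p + p) = pochhammer 1 p * pochhammer (1 + P) p" by (rule pochhammer_product')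
  then have "fact (p + p) = fact p * (fact (p - 1) * br (p - 1) 1 * (2 * P))"
    by (simp only: 2 pochhammer_fact[symmetric])
  moreover have "fact p = P * fact (p - 1)" using p_pos by (rule fact_reduce)
  moreover have "2 * p = p + p" by simp
  ultimately have "fact (2 * p) = 2 * br (p - 1) 1 * (fact p)\<^sup>2"
    by (simp only: power2_eq_square mult_ac)
  then show ?thesis unfolding 1 by (simp only:)
qed

end

context padic_prime_1
begin

text \<open>Writing \<open>9 m = p + n - 1\<close> and \<open>15 m = 2 p + n - 2\<close> brings the factorials next to multiples of
\<open>p\<close>. The linear factors correct the offsets \<open>- 1\<close> and \<open>- 2\<close>.\<close>
lemma binomials_with_small_bottom:
  assumes ab: "a + b = n"
  shows "of_nat ((9 * m) choose a) * (3 * M + P) = C * (fact m * fact (2 * m) / (fact a * fact b)) * (of_nat b + P) * (br n 1 / br b 1)"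
    and "of_nat ((15 * m) choose a) * ((3 * M + 2 * P - 1) * (3 * M + 2 * P))
       = C * (fact m * fact (2 * m) / (fact a * fact b)) * ((of_nat b + 2 * P - 1) * (of_nat b + 2 * P)) * (br n 2 / br b 2)"
proof -
  have bp: "b < p" using ab n_less by simp
  have nz: "br b 1 \<noteq> 0" "br b 2 \<noteq> 0" using bp by (auto intro!: unit_nz br_unit)
  have h3: "h = 3 * M" by (simp add: n_eq)
  have hab: "of_nat a + of_nat b = (3 * M :: rat)" using arg_cong[OF ab, of "of_nat :: nat \<Rightarrow> rat"] h3 by simp
  have f1: "fact (9 * m) * (3 * M + P) = fact p * (fact n * br n 1)"
  proof -
    have "fact (p + n) = (3 * M + P) * fact (9 * m)"
    proof -
      have "p + n = Suc (9 * m)" using p6 n_eq by simp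
      then have "fact (p + n) = of_nat (p + n) * (fact (9 * m) :: rat)" by (metis fact_Suc)
      then show ?thesis using h3 by (simp add: add.commute)
    qed
    then show ?thesis unfolding fact_p_plus by (simp add: mult_ac)
  qed
  have l1: "9 * m - a + 1 = p + b" "a \<le> 9 * m" using ab n_eq p6 by auto
  have f2: "fact (9 * m - a) * (of_nat b + P) = fact p * (fact b * br b 1)"
  proof -
    have "p + b = Suc (9 * m - a)" using l1 by simp
    then have "fact (p + b) = of_nat (p + b) * (fact (9 * m - a) :: rat)" by (metis fact_Suc)
    then show ?thesis unfolding fact_p_plus by (simp add: mult_ac add.commute)
  qed
  have bpos: "of_nat b + P \<noteq> 0" "3 * M + P \<noteq> 0" using p_pos M_pos by (auto simp: add_nonneg_eq_0_iff)
  have "of_nat ((9 * m) choose a) = fact (9 * m) / (fact a * (fact (9 * m - a) :: rat))"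
    using l1(2) by (rule binomial_fact)
  moreover have "fact (9 * m) = fact p * (fact n * br n 1) / (3 * M + P)"
    using f1 bpos by (simp add: field_simps)
  moreover have "fact (9 * m - a) = fact p * (fact b * br b 1) / (of_nat b + P)"
    using f2 bpos by (simp add: field_simps)
  ultimately show "of_nat ((9 * m) choose a) * (3 * M + P) = C * (fact m * fact (2 * m) / (fact a * fact b)) * (of_nat b + P) * (br n 1 / br b 1)"
    unfolding C_fact using bpos nz by (simp add: divide_simps) (simp add: mult_ac)
  have g1: "fact (15 * m) * ((3 * M + 2 * P - 1) * (3 * M + 2 * P)) = 2 * br (p - 1) 1 * (fact p)\<^sup>2 * (fact n * br n 2)"
  proof -
    have s: "2 * p + n = Suc (Suc (15 * m))" using p6 n_eq by simp
    have "fact (2 * p + n) = of_nat (2 * p + n) * (of_nat (Suc (15 * m)) * (fact (15 * m) :: rat))"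
      unfolding s by (simp only: fact_Suc of_nat_mult)
    moreover have "of_nat (Suc (15 * m)) = 3 * M + 2 * P - (1 :: rat)"
      using arg_cong[OF s, of "of_nat :: nat \<Rightarrow> rat"] h3 by simp
    ultimately show ?thesis unfolding fact_2p_plus[symmetric] using h3 by (simp add: mult_ac add.commute)
  qed
  have l2: "a \<le> 15 * m" and s2: "2 * p + b = Suc (Suc (15 * m - a))" using ab n_eq p6 by auto
  have g2: "fact (15 * m - a) * ((of_nat b + 2 * P - 1) * (of_nat b + 2 * P)) = 2 * br (p - 1) 1 * (fact p)\<^sup>2 * (fact b * br b 2)"
  proof -
    have "fact (2 * p + b) = of_nat (2 * p + b) * (of_nat (Suc (15 * m - a)) * (fact (15 * m - a) :: rat))"
      unfolding s2 by (simp only: fact_Suc of_nat_mult)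
    moreover have "of_nat (Suc (15 * m - a)) = of_nat b + 2 * P - (1 :: rat)"
      using arg_cong[OF s2, of "of_nat :: nat \<Rightarrow> rat"] by simp
    ultimately show ?thesis unfolding fact_2p_plus[symmetric] by (simp add: mult_ac add.commute)
  qed
  define X where "X = (of_nat b + 2 * P - 1) * (of_nat b + 2 * P)"
  define Y where "Y = (3 * M + 2 * P - 1) * (3 * M + 2 * P)"
  have P1: "P > 1" using p_gt_3 by simp
  have b0: "(0::rat) \<le> of_nat b" by simp
  have XY: "X \<noteq> 0" "Y \<noteq> 0" unfolding X_def Y_def using P1 b0 M_pos by (auto simp: mult_eq_0_iff)
  have W: "2 * br (p - 1) 1 * (fact p)\<^sup>2 \<noteq> 0" using unit_nz[OF br_unit[of "p - 1" 1]] p_pos by simp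
  define Z where "Z = 2 * br (p - 1) 1 * (fact p)\<^sup>2"
  have "of_nat ((15 * m) choose a) = fact (15 * m) / (fact a * (fact (15 * m - a) :: rat))"
    using l2 by (rule binomial_fact)
  moreover have "fact (15 * m) = Z * (fact n * br n 2) / Y"
    using g1 XY unfolding Y_def Z_def by (simp add: field_simps)
  moreover have "fact (15 * m - a) = Z * (fact b * br b 2) / X"
    using g2 XY unfolding X_def Z_def by (simp add: field_simps)
  ultimately show "of_nat ((15 * m) choose a) * ((3 * M + 2 * P - 1) * (3 * M + 2 * P))
       = C * (fact m * fact (2 * m) / (fact a * fact b)) * ((of_nat b + 2 * P - 1) * (of_nat b + 2 * P)) * (br n 2 / br b 2)"
    unfolding C_fact X_def[symmetric] Y_def[symmetric] using XY nz W unfolding Z_def[symmetric] by (simp add: divide_simps) (simp add: mult_ac)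
qed

text \<open>Here the lower index \<open>8 m = p + 2 m - 1\<close> and its complement \<open>7 m = p + m - 1\<close> both lie above
\<open>p\<close>, hence the factor 2 from \<open>(2 p)! / (p!)\<^sup>2\<close>.\<close>
lemma central_binomial_15:
  "of_nat ((15 * m) choose (8 * m)) * ((3 * M + 2 * P - 1) * (3 * M + 2 * P))
     = C * (2 * br (p - 1) 1) * ((M + P) * (2 * M + P)) * (br n 2 / (br m 1 * br (2 * m) 1))"
proof -
  have mp: "m < p" "2 * m < p" using p6 by auto
  have nz: "br m 1 \<noteq> 0" "br (2 * m) 1 \<noteq> 0" using mp by (auto intro!: unit_nz br_unit)
  have h3: "h = 3 * M" by (simp add: n_eq)
  have g1: "fact (15 * m) * ((3 * M + 2 * P - 1) * (3 * M + 2 * P)) = 2 * br (p - 1) 1 * (fact p)\<^sup>2 * (fact n * br n 2)"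
  proof -
    have s: "2 * p + n = Suc (Suc (15 * m))" using p6 n_eq by simp
    have "fact (2 * p + n) = of_nat (2 * p + n) * (of_nat (Suc (15 * m)) * (fact (15 * m) :: rat))"
      unfolding s by (simp only: fact_Suc of_nat_mult)
    moreover have "of_nat (Suc (15 * m)) = 3 * M + 2 * P - (1 :: rat)"
      using arg_cong[OF s, of "of_nat :: nat \<Rightarrow> rat"] h3 by simp
    ultimately show ?thesis unfolding fact_2p_plus[symmetric] using h3 by (simp add: mult_ac add.commute)
  qed
  have g: "fact k * (of_nat b + P) = fact p * (fact b * br b 1)" if "p + b = Suc k" for k b
  proof -
    have "fact (p + b) = of_nat (p + b) * (fact k :: rat)" using that by (metis fact_Suc)
    then show ?thesis unfolding fact_p_plus by (simp add: mult_ac add.commute)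
  qed
  have g7: "fact (7 * m) * (M + P) = fact p * (fact m * br m 1)" by (rule g) (simp add: p6)
  have g8: "fact (8 * m) * (2 * M + P) = fact p * (fact (2 * m) * br (2 * m) 1)" using g[of "2 * m" "8 * m"] p6 by simp
  have P1: "P > 1" using p_gt_3 by simp
  have XY: "M + P \<noteq> 0" "2 * M + P \<noteq> 0" "(3 * M + 2 * P - 1) * (3 * M + 2 * P) \<noteq> 0"
    using P1 M_pos by (auto simp: mult_eq_0_iff)
  define X where "X = M + P" define X' where "X' = 2 * M + P"
  define Y where "Y = (3 * M + 2 * P - 1) * (3 * M + 2 * P)"
  note D = X_def[symmetric] X'_def[symmetric] Y_def[symmetric]
  have "15 * m - 8 * m = 7 * m" "8 * m \<le> 15 * m" by simp_all
  then have "of_nat ((15 * m) choose (8 * m)) = fact (15 * m) / (fact (8 * m) * (fact (7 * m) :: rat))"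
    using binomial_fact[of "8 * m" "15 * m", where ?'a = rat] by simp
  moreover have "fact (15 * m) = 2 * br (p - 1) 1 * (fact p)\<^sup>2 * (fact n * br n 2) / Y"
    using g1 XY unfolding D by (simp add: field_simps)
  moreover have "fact (7 * m) = fact p * (fact m * br m 1) / X"
    using g7 XY unfolding D by (simp add: field_simps)
  moreover have "fact (8 * m) = fact p * (fact (2 * m) * br (2 * m) 1) / X'"
    using g8 XY unfolding D by (simp add: field_simps)
  ultimately show ?thesis
    unfolding C_fact D using XY[unfolded D] nz by (simp add: divide_simps) (simp add: power2_eq_square mult_ac)
qed

lemma quad_cong_eq:
  "quad x a b c \<Longrightarrow> quad y d e f \<Longrightarrow> a = d \<Longrightarrow> b = e \<Longrightarrow> c = f \<Longrightarrow> x \<simeq>\<^sub>3 y"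
  using quad_cong by blast

lemma quad_coeffs: "quad x a b c \<Longrightarrow> a = d \<Longrightarrow> b = e \<Longrightarrow> c = f \<Longrightarrow> quad x d e f"
  by simp

text \<open>The denominators \<open>3 m + p\<close> and \<open>(3 m + 2 p - 1) (3 m + 2 p)\<close> of the binomial
coefficients, written as polynomials in \<open>p\<close>.\<close>
definition D1 :: rat where "D1 = - 1 / 2 + 3 / 2 * P"
definition D2 :: rat where "D2 = (- 3 / 2 + 5 / 2 * P) * (- 1 / 2 + 5 / 2 * P)"
definition bracket_sum :: rat where
  "bracket_sum = (- 1 + 1 * P) * (15 * (D1 * D2)
     + (- 10) * (D2 * ((- 1 / 6 + 7 / 6 * P) * (br n 1 / br m 1) + (- 1 / 3 + 4 / 3 * P) * (br n 1 / br (2 * m) 1)))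
     + 3 * (D1 * ((- 7 / 6 + 13 / 6 * P) * (- 1 / 6 + 13 / 6 * P) * (br n 2 / br m 2)
         + (- 4 / 3 + 7 / 3 * P) * (- 1 / 3 + 7 / 3 * P) * (br n 2 / br (2 * m) 2)
         + 2 * ((- 1 / 6 + 7 / 6 * P) * (- 1 / 3 + 4 / 3 * P)) * (br (p - 1) 1 * (br n 2 / (br m 1 * br (2 * m) 1))))))"

lemma Y1_eq: "D1 * D2 * of_int Y1 = C * bracket_sum"
proof -
  have lin: "3 * M + P = D1" "(3 * M + 2 * P - 1) * (3 * M + 2 * P) = D2"
    "M + P = - 1 / 6 + 7 / 6 * P" "2 * M + P = - 1 / 3 + 4 / 3 * P" "M + 2 * P - 1 = - 7 / 6 + 13 / 6 * P"
    "M + 2 * P = - 1 / 6 + 13 / 6 * P" "2 * M + 2 * P - 1 = - 4 / 3 + 7 / 3 * P" "2 * M + 2 * P = - 1 / 3 + 7 / 3 * P"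
  proof -
    have 1: "3 * M + 2 * P - 1 = - 3 / 2 + 5 / 2 * P" "3 * M + 2 * P = - 1 / 2 + 5 / 2 * P" using P_M by linarith+
    then show "(3 * M + 2 * P - 1) * (3 * M + 2 * P) = D2" unfolding D2_def by (simp only:)
  qed (use P_M in \<open>unfold D1_def, linarith+\<close>)
  have nf: "fact m * fact (2 * m) / (fact (2 * m) * fact m) = (1 :: rat)" "fact m * fact (2 * m) / (fact m * fact (2 * m)) = (1 :: rat)"
    by simp_all
  have ab: "2 * m + m = n" "m + 2 * m = n" using n_eq by simp_all
  have of2: "of_nat (2 * m) = 2 * M" by simp
  note b1 = binomials_with_small_bottom[OF ab(1), unfolded nf lin mult_1_right]
  note b2 = binomials_with_small_bottom[OF ab(2), unfolded nf of2 lin mult_1_right]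
  note b3 = central_binomial_15[unfolded lin]
  have sym: "(9 * m) choose (8 * m) = (9 * m) choose m" "(15 * m) choose (14 * m) = (15 * m) choose m"
    "(3 * m) choose (2 * m) = (3 * m) choose m"
    using binomial_symmetric[of m "9 * m"] binomial_symmetric[of m "15 * m"] binomial_symmetric[of m "3 * m"] by simp_all
  define B91 B92 B151 B152 B158 :: rat
    where B: "B91 = of_nat ((9 * m) choose m)" "B92 = of_nat ((9 * m) choose (2 * m))"
      "B151 = of_nat ((15 * m) choose m)" "B152 = of_nat ((15 * m) choose (2 * m))" "B158 = of_nat ((15 * m) choose (8 * m))"
  have Y: "of_int Y1 = (P - 1) * (15 * C - 10 * (B92 + B91) + 3 * (B152 + B158 + B151))"
    unfolding Y1_def sym B C_def by simp
  have "D1 * D2 * of_int Y1 = (P - 1) * (15 * (D1 * D2) * C - 10 * D2 * (B92 * D1 + B91 * D1)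
      + 3 * D1 * (B152 * D2 + B158 * D2 + B151 * D2))"
    unfolding Y by (simp add: algebra_simps)
  also have "\<dots> = C * bracket_sum"
  proof -
    define r3 r4 where r: "r3 = br n 2 / (br m 1 * br (2 * m) 1)" "r4 = br (p - 1) 1"
    show ?thesis
      unfolding B b1 b2 b3 bracket_sum_def r[symmetric] by (simp add: field_simps)
  qed
  finally show ?thesis .
qed

text \<open>After expanding both sides to second order in \<open>p\<close> the coefficients agree identically as polynomials
in the harmonic sums up to \<open>m\<close>, \<open>2 m\<close> and \<open>n\<close>.\<close>
lemma bracket_sum_cong: "bracket_sum \<simeq>\<^sub>3 - (8 * (D1 * D2) * E lam)"
proof -
  have mp: "m < p" "2 * m < p" "n < p" "p - 1 < p" using p6 n_less by auto
  have z: "H n \<in> Zp" "H m \<in> Zp" "H (2 * m) \<in> Zp" "H2 n \<in> Zp" "H2 m \<in> Zp" "H2 (2 * m) \<in> Zp"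
    using mp by (auto intro: H_Zp H2_Zp)
  have q1: "quad (br n e / br k e) 1 (e * (H n - H k)) (- (e\<^sup>2 / 2 * (H2 n - H2 k)) + (e * (H n - H k))\<^sup>2 / 2)"
    if "k < p" "e \<in> Zp" for k e
  proof (rule quad_E)
    have "logc (br n e / br k e) (lbr n e - lbr k e)" using that mp by (intro logc_divide logc_br) auto
    also have "lbr n e - lbr k e = P * (e * (H n - H k)) + P\<^sup>2 * (- (e\<^sup>2 / 2 * (H2 n - H2 k)))"
      unfolding lbr_def by (simp add: field_simps)
    finally show "logc (br n e / br k e) (P * (e * (H n - H k)) + P\<^sup>2 * (- (e\<^sup>2 / 2 * (H2 n - H2 k))))" .
  qed (use that z mp in \<open>auto intro!: H_Zp H2_Zp\<close>)
  have q2: "quad (br (p - 1) 1 * (br n 2 / (br m 1 * br (2 * m) 1))) 1 (2 * H n - H m - H (2 * m))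
     ((- 2 * H2 n + H2 m / 2 + H2 (2 * m) / 2) + (2 * H n - H m - H (2 * m))\<^sup>2 / 2)"
  proof (rule quad_E)
    have "logc (br (p - 1) 1 * (br n 2 / (br m 1 * br (2 * m) 1))) (0 + (lbr n 2 - (lbr m 1 + lbr (2 * m) 1)))"
      using mp by (intro logc_divide logc_mult logc_br logc_br_p_minus_1) auto
    also have "0 + (lbr n 2 - (lbr m 1 + lbr (2 * m) 1))
      = P * (2 * H n - H m - H (2 * m)) + P\<^sup>2 * (- 2 * H2 n + H2 m / 2 + H2 (2 * m) / 2)"
      unfolding lbr_def by (simp add: field_simps)
    finally show "logc (br (p - 1) 1 * (br n 2 / (br m 1 * br (2 * m) 1)))
      (P * (2 * H n - H m - H (2 * m)) + P\<^sup>2 * (- 2 * H2 n + H2 m / 2 + H2 (2 * m) / 2))" .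
  qed (use z in auto)
  have q3: "quad (E lam) 1 (- H n / 2 + H (2 * m) / 3 + H m / 6)
     ((- H2 n / 8 + H2 (2 * m) / 18 + H2 m / 72) + (- H n / 2 + H (2 * m) / 3 + H m / 6)\<^sup>2 / 2)"
  proof (rule quad_E)
    have e: "lam = P * (- H n / 2 + H (2 * m) / 3 + H m / 6) + P\<^sup>2 * (- H2 n / 8 + H2 (2 * m) / 18 + H2 m / 72)"
      unfolding lam_def lbr_def by (simp add: field_simps power2_eq_square)
    have "lam = P * (- H n / 2 + H (2 * m) / 3 + H m / 6 + P * (- H2 n / 8 + H2 (2 * m) / 18 + H2 m / 72))"
      unfolding e by (simp add: algebra_simps power2_eq_square)
    then have "lam \<simeq>\<^sub>1 0"
      using rc1_P[of "- H n / 2 + H (2 * m) / 3 + H m / 6 + P * (- H2 n / 8 + H2 (2 * m) / 18 + H2 m / 72)"] z by auto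
    then show "logc (E lam) (P * (- H n / 2 + H (2 * m) / 3 + H m / 6) + P\<^sup>2 * (- H2 n / 8 + H2 (2 * m) / 18 + H2 m / 72))"
      unfolding logc_def e[symmetric] by simp
  qed (use z in auto)
  define x1 x2 x3 x4 x5 where x: "x1 = br n 1 / br m 1" "x2 = br n 1 / br (2 * m) 1" "x3 = br n 2 / br m 2"
     "x4 = br n 2 / br (2 * m) 2" "x5 = br (p - 1) 1 * (br n 2 / (br m 1 * br (2 * m) 1))"
  note qx = q1[OF mp(1) Zp_1, folded x] q1[OF mp(2) Zp_1, folded x] q1[OF mp(1) Zp_numeral, of "Num.Bit0 Num.One", folded x]
    q1[OF mp(2) Zp_numeral, of "Num.Bit0 Num.One", folded x] q2[folded x]
  have d1: "quad D1 (- 1 / 2) (3 / 2) 0" unfolding D1_def by (rule quad_linear) auto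
  have d2: "quad D2 (3 / 4) (- 5) (25 / 4)"
    unfolding D2_def by (rule quad_coeffs, rule quad_mult; (rule quad_linear)?) auto
  have d12: "quad (D1 * D2) (- 3 / 8) (29 / 8) (- 85 / 8)"
    by (rule quad_coeffs, rule quad_mult[OF d1 d2]) auto
  have l: "quad (- 1 / 6 + 7 / 6 * P) (- 1 / 6) (7 / 6) 0" "quad (- 1 / 3 + 4 / 3 * P) (- 1 / 3) (4 / 3) 0"
    "quad (- 7 / 6 + 13 / 6 * P) (- 7 / 6) (13 / 6) 0" "quad (- 1 / 6 + 13 / 6 * P) (- 1 / 6) (13 / 6) 0"
    "quad (- 4 / 3 + 7 / 3 * P) (- 4 / 3) (7 / 3) 0" "quad (- 1 / 3 + 7 / 3 * P) (- 1 / 3) (7 / 3) 0"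
    "quad (- 1 + 1 * P) (- 1) 1 0"
    by (rule quad_linear; auto)+
  have c: "quad 15 15 0 0" "quad (- 10) (- 10) 0 0" "quad 3 3 0 0" "quad 2 2 0 0" "quad 8 8 0 0"
    by (rule quad_const; auto)+
  have m1: "quad ((- 7 / 6 + 13 / 6 * P) * (- 1 / 6 + 13 / 6 * P)) (7 / 36) (- 26 / 9) (169 / 36)"
    by (rule quad_coeffs, rule quad_mult[OF l(3) l(4)]) auto
  have m2: "quad ((- 4 / 3 + 7 / 3 * P) * (- 1 / 3 + 7 / 3 * P)) (4 / 9) (- 35 / 9) (49 / 9)"
    by (rule quad_coeffs, rule quad_mult[OF l(5) l(6)]) auto
  have m3: "quad (2 * ((- 1 / 6 + 7 / 6 * P) * (- 1 / 3 + 4 / 3 * P))) (1 / 9) (- 11 / 9) (28 / 9)"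
    by (rule quad_coeffs, rule quad_mult[OF c(4) quad_mult[OF l(1) l(2)]]) auto
  note b1 = quad_mult[OF d2 quad_add[OF quad_mult[OF l(1) qx(1)] quad_mult[OF l(2) qx(2)]]]
  note b2 = quad_mult[OF d1 quad_add[OF quad_add[OF quad_mult[OF m1 qx(3)] quad_mult[OF m2 qx(4)]] quad_mult[OF m3 qx(5)]]]
  note lhs = quad_mult[OF l(7) quad_add[OF quad_add[OF quad_mult[OF c(1) d12] quad_mult[OF c(2) b1]] quad_mult[OF c(3) b2]]]
  note rhs = quad_minus[OF quad_mult[OF quad_mult[OF c(5) d12] q3]]
  show ?thesis
    unfolding bracket_sum_def x[symmetric]
    by (rule quad_cong_eq[OF lhs rhs]; simp add: field_simps power2_eq_square)
qed

end

section \<open>Primes of the form 6m + 1: the congruences\<close>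

context padic_prime_1
begin

text \<open>By the next lemmas this is the unit root of \<open>X\<^sup>2 - S 1 * X + p\<close> modulo \<open>p\<^sup>3\<close>.\<close>
definition J :: rat where "J = - (C * E lam)"

lemma lam_0: "lam \<simeq>\<^sub>1 0"
proof -
  have "2 * lam \<simeq>\<^sub>1 2 * 0" using logc_X4 unfolding logc_def by simp
  then show ?thesis by (rule rc_cancel) simp
qed

lemma J_unit: "unit J"
  unfolding J_def using C_unit E_unit[OF lam_0] by auto

lemma Y1_cong: "of_int Y1 / 8 \<simeq>\<^sub>3 J"
proof -
  have u: "unit (D1 * D2)"
  proof -
    have "unit (- 1 / 2 + P * (3 / 2))" "unit (- 3 / 2 + P * (5 / 2))" "unit (- 1 / 2 + P * (5 / 2))"
      by (intro unit_add_P; auto)+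
    then show ?thesis unfolding D1_def D2_def by (auto simp: mult.commute[of P])
  qed
  have "D1 * D2 * of_int Y1 \<simeq>\<^sub>3 C * (- (8 * (D1 * D2) * E lam))"
    unfolding Y1_eq by (intro rc_mult_left bracket_sum_cong unit_Zp C_unit)
  also have "C * (- (8 * (D1 * D2) * E lam)) = D1 * D2 * (8 * J)" unfolding J_def by simp
  finally have "of_int Y1 \<simeq>\<^sub>3 8 * J" by (rule rc_cancel[OF _ u])
  then have "of_int Y1 / 8 \<simeq>\<^sub>3 8 * J / 8" using J_unit unit_Zp by (intro rc_divide) auto
  then show ?thesis by simp
qed

text \<open>\<open>J\<close> and \<open>p / J\<close> are the two eigenvalues, so \<open>4 x\<^sup>2 \<equiv> (J + p / J)\<^sup>2\<close>. Solving for \<open>J\<^sup>2\<close> uses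
\<open>J\<^sup>2 \<equiv> 4 x\<^sup>2 (mod p)\<close> in the term with \<open>p\<^sup>2\<close>.\<close>
lemma J_square:
  assumes xy: "q = x ^ 2 + 3 * y ^ 2"
  defines "X \<equiv> (of_int x :: rat)"
  shows "J\<^sup>2 \<simeq>\<^sub>3 4 * X\<^sup>2 - 2 * P - P\<^sup>2 / (4 * X\<^sup>2)" and "J\<^sup>2 \<simeq>\<^sub>1 4 * X\<^sup>2" and "unit (4 * X\<^sup>2)"
proof -
  have JZ: "J \<in> Zp" using J_unit unit_Zp by blast
  have "of_int (Y1 * Y2) \<simeq>\<^sub>3 of_int (64 * q)" by (rule rc_of_int[OF Y_relations(2)])
  then have "of_int (Y1 * Y2) / 64 \<simeq>\<^sub>3 of_int (64 * q) / 64"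
    using unit_power[OF unit_numerals(3), of 2] by (intro rc_divide rc_refl) auto
  then have Y12: "(of_int Y1 / 8) * (of_int Y2 / 8) \<simeq>\<^sub>3 P" by simp
  have "J * (of_int Y2 / 8) \<simeq>\<^sub>3 (of_int Y1 / 8) * (of_int Y2 / 8)"
    by (rule rc_mult_right[OF rc_sym[OF Y1_cong]]) auto
  then have "J * (of_int Y2 / 8) \<simeq>\<^sub>3 P" using Y12 rc_trans by blast
  then have "J * (of_int Y2 / 8) / J \<simeq>\<^sub>3 P / J" using J_unit by (intro rc_divide) auto
  then have Y2: "of_int Y2 / 8 \<simeq>\<^sub>3 P / J" using unit_nz[OF J_unit] by simp
  have "of_int (8 * Sa) \<simeq>\<^sub>3 of_int (Y1 + Y2)" by (rule rc_of_int[OF Y_relations(3)])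
  then have "of_int (8 * Sa) / 8 \<simeq>\<^sub>3 of_int (Y1 + Y2) / 8" by (intro rc_divide) auto
  then have "of_int Sa \<simeq>\<^sub>3 of_int Y1 / 8 + of_int Y2 / 8" by (simp add: add_divide_distrib)
  also have "of_int Y1 / 8 + of_int Y2 / 8 \<simeq>\<^sub>3 J + P / J" by (intro rc_add Y1_cong Y2)
  finally have "(of_int Sa)\<^sup>2 \<simeq>\<^sub>3 (J + P / J)\<^sup>2" using J_unit JZ by (intro rc_power) auto
  moreover have "(of_int Sa)\<^sup>2 = 4 * X\<^sup>2"
    using arg_cong[OF Sa_square[OF xy], of "of_int :: int \<Rightarrow> rat"] unfolding X_def by simp
  moreover have "(J + P / J)\<^sup>2 = J\<^sup>2 + 2 * P + P\<^sup>2 * (1 / J\<^sup>2)"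
    using unit_nz[OF J_unit] by (simp add: field_simps power2_eq_square)
  ultimately have X4: "4 * X\<^sup>2 \<simeq>\<^sub>3 J\<^sup>2 + 2 * P + P\<^sup>2 * (1 / J\<^sup>2)" by (simp only:)
  have J2: "unit (J\<^sup>2)" using J_unit by auto
  have "J\<^sup>2 + 2 * P + P\<^sup>2 * (1 / J\<^sup>2) \<simeq>\<^sub>1 J\<^sup>2"
    by (rule rat_cong_I[of _ _ _ "2 + P * (1 / J\<^sup>2)"]) (use J2 in \<open>auto simp: algebra_simps power2_eq_square\<close>)
  then show J1: "J\<^sup>2 \<simeq>\<^sub>1 4 * X\<^sup>2" using rc_le[OF X4, of 1] rc_trans rc_sym by (metis one_le_numeral)
  show u: "unit (4 * X\<^sup>2)" using rc_unit[OF rc_sym[OF J1] le_refl J2] .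
  have "P\<^sup>2 * (1 / J\<^sup>2) \<simeq>\<^sub>3 P\<^sup>2 * (1 / (4 * X\<^sup>2))"
    using J2 u by (intro P_rc rc_divide J1) auto
  from rc_diff[OF rc_diff[OF X4 rc_refl[of 3 "2 * P"]] rc_sym[OF this]]
  have "4 * X\<^sup>2 - 2 * P - P\<^sup>2 * (1 / (4 * X\<^sup>2)) \<simeq>\<^sub>3 J\<^sup>2" by simp
  then show "J\<^sup>2 \<simeq>\<^sub>3 4 * X\<^sup>2 - 2 * P - P\<^sup>2 / (4 * X\<^sup>2)" using rc_sym by simp
qed

lemma C_square_logc:
  assumes "logc X (2 * lam)"
  shows "C\<^sup>2 * X \<simeq>\<^sub>3 J\<^sup>2"
proof -
  have a: "X \<simeq>\<^sub>3 E (2 * lam)" using assms unfolding logc_def by simp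
  have b: "E (2 * lam) \<simeq>\<^sub>3 E lam * E lam" using rc_sym[OF E_add[OF lam_0 lam_0]] by (simp only: mult_2)
  have "C\<^sup>2 * X \<simeq>\<^sub>3 C\<^sup>2 * (E lam * E lam)"
    by (rule rc_mult_left[OF rc_trans[OF a b]]) (rule Zp_power[OF unit_Zp[OF C_unit]])
  also have "C\<^sup>2 * (E lam * E lam) = J\<^sup>2" unfolding J_def by (simp add: power2_eq_square)
  finally show ?thesis .
qed

lemma C_square_cong: "C\<^sup>2 \<simeq>\<^sub>1 J\<^sup>2"
proof -
  have "E lam \<simeq>\<^sub>1 1" using E_cong[OF lam_0] by simp
  then have "(E lam)\<^sup>2 \<simeq>\<^sub>1 1\<^sup>2" by (rule rc_power) simp
  then have "C\<^sup>2 * (E lam)\<^sup>2 \<simeq>\<^sub>1 C\<^sup>2 * 1" using C_unit unit_Zp by (intro rc_mult_left) auto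
  then show ?thesis unfolding J_def by (simp add: power_mult_distrib rc_sym)
qed

theorem domb_square_sums_mod_p3:
  assumes xy: "q = x ^ 2 + 3 * y ^ 2"
  defines "X \<equiv> (of_int x :: rat)"
  shows "(\<Sum>k=0..p - 1. of_nat k ^ 2 * (of_nat (domb k) / 4 ^ k)) \<simeq>\<^sub>3 16 / 9 * X\<^sup>2 - 8 * P / 9 - 7 * P\<^sup>2 / (18 * X\<^sup>2)"
    and "(\<Sum>k=0..p - 1. of_nat k ^ 2 * (of_nat (domb k) / 16 ^ k)) \<simeq>\<^sub>3 4 / 9 * X\<^sup>2 - 2 * P / 9 - P\<^sup>2 / (18 * X\<^sup>2)"
proof -
  note J = J_square[OF xy, folded X_def]
  have X0: "X \<noteq> 0" using unit_nz[OF J(3)] by auto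
  have c: "C\<^sup>2 \<simeq>\<^sub>1 4 * X\<^sup>2" using C_square_cong J(2) rc_trans by blast
  have "(\<Sum>k=0..p - 1. of_nat k ^ 2 * (of_nat (domb k) / 4 ^ k))
     \<simeq>\<^sub>3 4 / 9 * (4 * X\<^sup>2 - 2 * P - P\<^sup>2 / (4 * X\<^sup>2)) - 10 / 9 * (P\<^sup>2 / (4 * X\<^sup>2))"
    by (rule square_domb_sum_4[OF rc_trans[OF C_square_logc[OF logc_X4] J(1)] c J(3)])
  also have "\<dots> = 16 / 9 * X\<^sup>2 - 8 * P / 9 - 7 * P\<^sup>2 / (18 * X\<^sup>2)"
    using X0 by (simp add: field_simps)
  finally show "(\<Sum>k=0..p - 1. of_nat k ^ 2 * (of_nat (domb k) / 4 ^ k)) \<simeq>\<^sub>3 16 / 9 * X\<^sup>2 - 8 * P / 9 - 7 * P\<^sup>2 / (18 * X\<^sup>2)" .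
  have "(\<Sum>k=0..p - 1. of_nat k ^ 2 * (of_nat (domb k) / 16 ^ k))
     \<simeq>\<^sub>3 (4 * X\<^sup>2 - 2 * P - P\<^sup>2 / (4 * X\<^sup>2)) / 9 - P\<^sup>2 / (9 * (4 * X\<^sup>2))"
    by (rule square_domb_sum_16[OF rc_trans[OF C_square_logc[OF logc_X16] J(1)] c J(3)])
  also have "\<dots> = 4 / 9 * X\<^sup>2 - 2 * P / 9 - P\<^sup>2 / (18 * X\<^sup>2)"
    using X0 by (simp add: field_simps)
  finally show "(\<Sum>k=0..p - 1. of_nat k ^ 2 * (of_nat (domb k) / 16 ^ k)) \<simeq>\<^sub>3 4 / 9 * X\<^sup>2 - 2 * P / 9 - P\<^sup>2 / (18 * X\<^sup>2)" .
qed

end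

section \<open>Primes of the form 6d + 5: Fermat quotients and products\<close>

context padic_prime
begin

text \<open>First order expansions in \<open>p\<close>, which suffice modulo \<open>p\<^sup>2\<close>.\<close>
definition lin :: "rat \<Rightarrow> rat \<Rightarrow> rat \<Rightarrow> bool" where
  "lin x a b \<longleftrightarrow> x \<simeq>\<^sub>2 a + P * b \<and> a \<in> Zp \<and> b \<in> Zp"

lemma lin_linear: "a \<in> Zp \<Longrightarrow> b \<in> Zp \<Longrightarrow> lin (a + b * P) a b"
  unfolding lin_def by (simp add: mult.commute)

lemma lin_const: "a \<in> Zp \<Longrightarrow> lin a a 0"
  unfolding lin_def by simp

lemma lin_Zp: "lin x a b \<Longrightarrow> x \<in> Zp"
proof -
  assume l: "lin x a b"
  then have "x \<simeq>\<^sub>2 a + P * b" "a + P * b \<in> Zp" unfolding lin_def by auto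
  then show "x \<in> Zp" by (rule rc_Zp)
qed

lemma lin_add: "lin x a b \<Longrightarrow> lin y c d \<Longrightarrow> lin (x + y) (a + c) (b + d)"
proof -
  assume x: "lin x a b" and y: "lin y c d"
  have "x + y \<simeq>\<^sub>2 (a + P * b) + (c + P * d)"
    using x y unfolding lin_def by (intro rc_add) auto
  also have "(a + P * b) + (c + P * d) = (a + c) + P * (b + d)"
    by (simp add: algebra_simps)
  finally show ?thesis using x y unfolding lin_def by auto
qed

lemma lin_mult: "lin x a b \<Longrightarrow> lin y c d \<Longrightarrow> lin (x * y) (a * c) (a * d + b * c)"
proof -
  assume x: "lin x a b" and y: "lin y c d"
  have z: "a \<in> Zp" "b \<in> Zp" "c \<in> Zp" "d \<in> Zp" using x y unfolding lin_def by auto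
  have "x * y \<simeq>\<^sub>2 (a + P * b) * (c + P * d)"
    using x y lin_Zp[OF x] z unfolding lin_def by (intro rc_mult) auto
  also have "\<dots> \<simeq>\<^sub>2 a * c + P * (a * d + b * c)"
    by (rule rat_cong_I[of _ _ _ "b * d"])
       (use z in \<open>auto simp: algebra_simps power2_eq_square\<close>)
  finally show ?thesis using z unfolding lin_def by auto
qed

lemma lin_logc:
  assumes "logc x (P * l + P\<^sup>2 * k)" "l \<in> Zp" "k \<in> Zp"
  shows "lin x 1 l"
proof -
  have "x \<simeq>\<^sub>2 1 + P * l + P\<^sup>2 * (k + l\<^sup>2 / 2)"
    using quad_E[OF assms] rc_le[of 3 _ _ 2] unfolding quad_def by simp
  also have "\<dots> \<simeq>\<^sub>2 1 + P * l"
    by (rule rat_cong_I[of _ _ _ "k + l\<^sup>2 / 2"]) (use assms in auto)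
  finally show ?thesis using assms unfolding lin_def by auto
qed

lemma lin_cong: "lin x a b \<Longrightarrow> lin y a c \<Longrightarrow> b \<simeq>\<^sub>1 c \<Longrightarrow> x \<simeq>\<^sub>2 y"
proof -
  assume x: "lin x a b" and y: "lin y a c" and bc: "b \<simeq>\<^sub>1 c"
  have "x \<simeq>\<^sub>2 a + P * b" using x unfolding lin_def by simp
  also have "a + P * b \<simeq>\<^sub>2 a + P * c" using bc by (intro rc_add rc_refl P_rc)
  also have "a + P * c \<simeq>\<^sub>2 y" using y rc_sym unfolding lin_def by blast
  finally show ?thesis .
qed

lemma lin_coeffs: "lin x a b \<Longrightarrow> a = c \<Longrightarrow> b = d \<Longrightarrow> lin x c d" by simp

text \<open>Both sides of \<open>(2 n)! = 4 ^ n * (1 / 2)\<^sub>n * n!\<close> are reduced to factorials of \<open>n\<close>: \<open>1 / 2\<close> is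
\<open>- n + p / 2\<close>, and \<open>(2 n)! = (p - 1)!\<close> is reflected.\<close>
lemma two_power: "2 ^ (p - 1) = br n (- 1) / br n (- 1 / 2)"
proof -
  have pn: "p - 1 = 2 * n" "n + n = p - 1" using p_eq by simp_all
  have nz: "br n (- 1 / 2) \<noteq> 0" using n_less by (intro unit_nz br_unit) auto
  have h2: "1 / 2 = - h + 1 / 2 * P" using h_eq by (simp add: field_simps)
  have "pochhammer (- h + 1 / 2 * P) n = (- 1) ^ n * (fact n * br n (- (1 / 2)))" by (rule pochhammer_down)
  then have "pochhammer (1 / 2) n = (- 1) ^ n * (fact n * br n (- (1 / 2)))" unfolding h2[symmetric] .
  then have "fact (2 * n) = 2 ^ (2 * n) * ((- 1) ^ n * (fact n * br n (- (1 / 2)))) * (fact n :: rat)"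
    using fact_double[where 'a = rat, of n] by simp
  moreover have "fact (2 * n) = (- 1) ^ n * fact n * fact n * br n (- 1)"
    using fact_reflect[OF pn(2)] unfolding pn(1) .
  ultimately have "((- 1) ^ n * fact n * fact n) * (2 ^ (2 * n) * br n (- (1 / 2))) = ((- 1) ^ n * fact n * fact n) * br n (- 1)"
    by (simp only: mult_ac)
  then have "2 ^ (2 * n) * br n (- (1 / 2)) = br n (- 1)"
    by (rule mult_left_cancel[THEN iffD1, rotated]) simp
  then show ?thesis unfolding pn(1) using nz by (simp add: field_simps)
qed

lemma fact_triple: "fact (3 * N) = (27 ^ N * fact N * pochhammer (1 / 3) N * pochhammer (2 / 3) N :: rat)"
proof (induction N)
  case (Suc N)
  have "fact (3 * Suc N) = (of_nat (3 * N + 3)) * (of_nat (3 * N + 2)) * (of_nat (3 * N + 1)) * (fact (3 * N) :: rat)"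
    by (simp add: eval_nat_numeral algebra_simps)
  then show ?case unfolding Suc by (simp add: pochhammer_Suc field_simps)
qed simp

end

locale padic_prime_2 = padic_prime +
  fixes d :: nat
  assumes p65: "p = 6 * d + 5"
begin

abbreviation D :: rat where "D \<equiv> of_nat d"
definition C :: rat where "C = of_nat (n choose d)"

lemma n_eq: "n = 3 * d + 2" using p_eq p65 by linarith
lemma P_D: "P = 6 * D + 5" by (subst p65) simp
lemma C_fact: "C = fact n / (fact d * fact (2 * d + 2))"
proof -
  have "n - d = 2 * d + 2" "d \<le> n" using n_eq by auto
  then show ?thesis unfolding C_def by (simp add: binomial_fact)
qed
lemma C_Zp: "C \<in> Zp" unfolding C_def by auto
lemma small: "d < p" "d + 1 < p" "2 * d < p" "2 * d + 1 < p" "2 * d + 2 < p" "4 * d + 3 < p" "5 * d + 4 < p"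
  using p65 by auto

text \<open>The same idea with the triplication formula for \<open>(p - 2)!\<close>, as \<open>p - 2 = 3 (2 d + 1)\<close>.\<close>
lemma three_power: "3 ^ (p - 1) = br (2 * d + 1) (- 2 / 3) / br (p - 1) (- 1 / 3)"
proof -
  define N where "N = 2 * d + 1"
  have oddN: "(- 1 :: rat) ^ N = - 1" unfolding N_def by simp
  have pN: "p - 1 = 3 * N + 1" "4 * d + 3 + N = p - 1" unfolding N_def using p65 by simp_all
  have Np: "N < p" unfolding N_def using small by simp
  have nz: "br N (- 1 / 3) \<noteq> 0" "br N (- 1) \<noteq> 0" "br (p - 1) (- 1 / 3) \<noteq> 0" "br (4 * d + 3) (- 1 / 3) \<noteq> 0" "br N (- 2 / 3) \<noteq> 0"
    using Np small by (auto intro!: unit_nz br_unit)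
  have D0: "D \<ge> 0" by simp
  \<comment> \<open>the two parameters of the triplication formula lie \<open>p / 3\<close> away from integers\<close>
  have a1: "1 / 3 = of_nat N + 1 + (- 1 / 3) * P" unfolding P_D N_def by (simp add: field_simps)
  have a2: "2 / 3 = - of_nat N + 1 / 3 * P" unfolding P_D N_def by (simp add: field_simps)
  have q1: "pochhammer (1 / 3) N = fact (4 * d + 2) * br (4 * d + 2) (- 1 / 3) / (fact N * br N (- 1 / 3))"
  proof -
    have "N + N < p" "N + N = 4 * d + 2" unfolding N_def using p65 by auto
    then show ?thesis unfolding a1 using pochhammer_up[of N N "- 1 / 3"] by auto
  qed
  have q2: "pochhammer (2 / 3) N = - (fact N * br N (- 1 / 3))"
    unfolding a2 using pochhammer_down[of N "1 / 3"] oddN by simp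
  have f1: "fact (4 * d + 3) = (4 * D + 3) * (fact (4 * d + 2) :: rat)"
  proof -
    have "4 * d + 3 = Suc (4 * d + 2)" by simp
    then have "fact (4 * d + 3) = of_nat (4 * d + 3) * (fact (4 * d + 2) :: rat)" by (metis fact_Suc)
    then show ?thesis by simp
  qed
  have f2: "fact (p - 1) = - (fact (4 * d + 3) * fact N * br N (- 1))"
    using fact_reflect[OF pN(2)] oddN by simp
  have f3: "fact (p - 1) = (P - 1) * (fact (3 * N) :: rat)"
  proof -
    have "p - 1 = Suc (3 * N)" using pN(1) by simp
    then have "fact (p - 1) = of_nat (p - 1) * (fact (3 * N) :: rat)" by (metis fact_Suc)
    then show ?thesis using p_pos by (simp add: of_nat_diff)
  qed
  have b1: "br (4 * d + 3) (- 1 / 3) * (2 * P - 1) = br (4 * d + 2) (- 1 / 3) * (P - 1)"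
  proof -
    have s: "4 * d + 3 = Suc (4 * d + 2)" by simp
    have 1: "br (4 * d + 3) (- 1 / 3) = br (4 * d + 2) (- 1 / 3) * (1 + - 1 / 3 * P / of_nat (4 * d + 3))"
      unfolding s br_def by (simp del: of_nat_Suc)
    have 2: "of_nat (4 * d + 3) = (2 * P - 1) / (3 :: rat)" unfolding P_D by (simp add: field_simps)
    have 3: "2 * P - 1 \<noteq> 0" using P_D D0 by linarith
    then have "(1 + - 1 / 3 * P / ((2 * P - 1) / 3)) * (2 * P - 1) = P - 1"
      by (simp add: add_divide_eq_iff divide_simps)
    then show ?thesis unfolding 1 2 by (simp only: mult.assoc)
  qed
  have b2: "br (p - 1) (- 1 / 3) * br N (- 1) = br (4 * d + 3) (- 1 / 3) * br N (- 2 / 3)"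
    using br_reflect[OF pN(2), of "- 1 / 3"] by auto
  have D3: "4 * D + 3 \<noteq> 0" "P - 1 \<noteq> 0" "2 * P - 1 \<noteq> 0" "3 * (4 * D + 3) = 2 * P - 1" unfolding P_D using D0 by (linarith | simp)+
  have t: "fact (3 * N) = - (27 ^ N * fact N * (fact (4 * d + 2) * br (4 * d + 2) (- 1 / 3)))"
    unfolding fact_triple q1 q2 using nz by simp
  have "- ((4 * D + 3) * fact (4 * d + 2) * fact N * br N (- 1)) = (P - 1) * - (27 ^ N * fact N * (fact (4 * d + 2) * br (4 * d + 2) (- 1 / 3)))"
    using f2 f3 unfolding f1 t by simp
  then have "(fact (4 * d + 2) * fact N) * ((4 * D + 3) * br N (- 1)) = (fact (4 * d + 2) * fact N) * (27 ^ N * (br (4 * d + 2) (- 1 / 3) * (P - 1)))"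
    by (simp only: mult_minus_right neg_equal_iff_equal mult_ac)
  then have "(4 * D + 3) * br N (- 1) = 27 ^ N * (br (4 * d + 2) (- 1 / 3) * (P - 1))"
    by (rule mult_left_cancel[THEN iffD1, rotated]) simp
  then have "(2 * P - 1) * br N (- 1) = 3 * 27 ^ N * (br (4 * d + 3) (- 1 / 3) * (2 * P - 1))"
    unfolding b1 using D3(4) by (metis mult.assoc)
  then have "br N (- 1) = 3 * 27 ^ N * br (4 * d + 3) (- 1 / 3)" using D3(3) by simp
  moreover have "3 * 27 ^ N = (3 :: rat) ^ (p - 1)" unfolding pN(1) by (simp add: power_mult)
  ultimately have "br N (- 1) = 3 ^ (p - 1) * br (4 * d + 3) (- 1 / 3)" by simp
  then have "br (p - 1) (- 1 / 3) * (3 ^ (p - 1) * br (4 * d + 3) (- 1 / 3)) = br (4 * d + 3) (- 1 / 3) * br N (- 2 / 3)"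
    using b2 by simp
  then have "3 ^ (p - 1) * br (p - 1) (- 1 / 3) = br N (- 2 / 3)" using nz by (simp add: mult_ac)
  then show ?thesis unfolding N_def[symmetric] using nz by (simp add: field_simps)
qed

text \<open>Duplication at \<open>d + 1\<close>, where the complementary index \<open>n - (d + 1)\<close> is \<open>2 d + 1\<close>.\<close>
lemma H_relation: "H d \<simeq>\<^sub>1 H n + H (2 * d + 1)"
proof -
  have e: "n - (d + 1) = 2 * d + 1" "d + 1 \<le> n" "2 * (d + 1) = Suc (2 * d + 1)" using n_eq by auto
  have z: "H2 n \<in> Zp" "H2 (2 * d + 1) \<in> Zp" using small n_less by (auto intro: H2_Zp)
  have D0: "D \<ge> 0" by simp
  have "H (2 * (d + 1)) \<simeq>\<^sub>2 H (d + 1) / 2 - (H n - H (2 * d + 1)) / 2 - P / 4 * (H2 n - H2 (2 * d + 1))"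
    using duplication_H[OF e(2)] unfolding e(1) .
  then have "H (2 * (d + 1)) \<simeq>\<^sub>1 H (d + 1) / 2 - (H n - H (2 * d + 1)) / 2 - P / 4 * (H2 n - H2 (2 * d + 1))"
    by (rule rc_le) simp
  also have "\<dots> \<simeq>\<^sub>1 H (d + 1) / 2 - (H n - H (2 * d + 1)) / 2"
    by (rule rat_cong_I[of _ _ _ "- (H2 n - H2 (2 * d + 1)) / 4"]) (use z in \<open>auto simp: field_simps\<close>)
  finally have "2 * H (2 * (d + 1)) \<simeq>\<^sub>1 2 * (H (d + 1) / 2 - (H n - H (2 * d + 1)) / 2)"
    by (rule rc_mult_left) simp
  moreover have "2 * H (2 * (d + 1)) = 2 * H (2 * d + 1) + 1 / (D + 1)"
  proof -
    have "H (2 * (d + 1)) = H (2 * d + 1) + 1 / (2 * D + 2)" unfolding e(3) H_def by (simp add: add.commute)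
    moreover have "2 * (1 / (2 * D + 2)) = 1 / (D + 1)" using D0 by (simp add: field_simps)
    ultimately show ?thesis by (simp only: distrib_left)
  qed
  moreover have "2 * (H (d + 1) / 2 - (H n - H (2 * d + 1)) / 2) = H d + 1 / (D + 1) - (H n - H (2 * d + 1))"
  proof -
    have "H (d + 1) = H d + 1 / (D + 1)" unfolding H_def by (simp add: add.commute)
    moreover have "2 * (x / 2 - y / 2) = x - y" for x y :: rat by (simp add: field_simps)
    ultimately show ?thesis by (simp only:)
  qed
  ultimately have "2 * H (2 * d + 1) + 1 / (D + 1) \<simeq>\<^sub>1 H d + 1 / (D + 1) - (H n - H (2 * d + 1))"
    by (simp only:)
  then have "2 * H (2 * d + 1) + 1 / (D + 1) - (1 / (D + 1) - (H n - H (2 * d + 1)))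
     \<simeq>\<^sub>1 H d + 1 / (D + 1) - (H n - H (2 * d + 1)) - (1 / (D + 1) - (H n - H (2 * d + 1)))"
    by (intro rc_diff rc_refl)
  then show ?thesis by (simp add: rc_sym add.commute)
qed

text \<open>The critical index is \<open>2 d + 1\<close>, where \<open>3 k + 2 = p\<close>. The factor \<open>2 - p\<close> absorbs the
mismatch between \<open>(2 d + 1)!\<close>, \<open>(d + 1)!\<close> and the factorials in \<open>C\<close>.\<close>
lemma central_product:
  assumes e: "e \<in> Zp" and f: "f \<in> Zp"
  shows "P * (fact n * pochhammer (D + 2 + e * P) n / (pochhammer (- h + f * P) n * (2 * pochhammer (5 / 3) n)))
     = 2 * (2 - P) * C\<^sup>2 * (br n (- 1) * br (p - 1) e
        / (br (2 * d + 1) (- (1 + e)) * br (d + 1) e * br n (- f) * br (2 * d) (- 1 / 3) * br (d + 1) (1 / 3)))"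
proof -
  have D0: "D \<ge> 0" by simp
  have r: "4 * d + 3 + (2 * d + 1) = p - 1" "n + n = p - 1" using p65 p_eq by auto
  have up: "pochhammer (D + 2 + e * P) n = fact (4 * d + 3) * br (4 * d + 3) e / (fact (d + 1) * br (d + 1) e)"
  proof -
    have "d + 1 + n = 4 * d + 3" using n_eq by simp
    moreover have "of_nat (d + 1) + 1 = D + 2" by simp
    ultimately show ?thesis using pochhammer_up[of "d + 1" n e] small e by (simp only:)
  qed
  have th: "pochhammer (5 / 3) n = fact (2 * d) * br (2 * d) (- 1 / 3) * (1 / 3 * P) * (fact (d + 1) * br (d + 1) (1 / 3))"
  proof -
    have a: "5 / 3 = - of_nat (2 * d) + 1 / 3 * P" unfolding P_D by (simp add: field_simps)
    have b: "n = 2 * d + Suc (d + 1)" using n_eq by simp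
    show ?thesis unfolding a b pochhammer_through_P by simp
  qed
  have nz: "br (2 * d + 1) (- (1 + e)) \<noteq> 0" "br (d + 1) e \<noteq> 0" "br n (- f) \<noteq> 0" "br (2 * d) (- 1 / 3) \<noteq> 0"
      "br (d + 1) (1 / 3) \<noteq> 0" "br (2 * d + 1) (- 1) \<noteq> 0" "br n (- 1) \<noteq> 0"
    using small n_less e f by (auto intro!: unit_nz br_unit)
  have f4: "- (fact (4 * d + 3) * fact (2 * d + 1) * br (2 * d + 1) (- 1)) = (- 1) ^ n * (fact n)\<^sup>2 * br n (- 1)"
    using fact_reflect[OF r(1)] fact_reflect[OF r(2)] by (simp add: power2_eq_square)
  have F: "fact (4 * d + 3) = - ((- 1) ^ n * (fact n)\<^sup>2 * br n (- 1) / (fact (2 * d + 1) * br (2 * d + 1) (- 1)))"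
    unfolding f4[symmetric] using nz by simp
  have b4: "br (p - 1) e * br (2 * d + 1) (- 1) = br (4 * d + 3) e * br (2 * d + 1) (- (1 + e))"
    by (rule br_reflect[OF r(1) e])
  have B: "br (4 * d + 3) e = br (p - 1) e * br (2 * d + 1) (- 1) / br (2 * d + 1) (- (1 + e))"
    unfolding b4 using nz by simp
  have s: "(- 1) ^ n * (- 1) ^ n = (1 :: rat)" by (simp flip: power_mult_distrib)
  have D1: "D + 1 \<noteq> 0" "2 * D + 1 \<noteq> 0" using D0 by linarith+
  have ff: "fact (d + 1) = (D + 1) * fact d" "fact (2 * d + 1) = (2 * D + 1) * fact (2 * d)"
    "fact (2 * d + 2) = 2 * (D + 1) * ((2 * D + 1) * fact (2 * d))"
    by (simp_all add: algebra_simps)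
  have "P * (fact n * pochhammer (D + 2 + e * P) n / (pochhammer (- h + f * P) n * (2 * pochhammer (5 / 3) n)))
    = - (3 / 2) * ((fact n)\<^sup>2 / ((fact (d + 1))\<^sup>2 * fact (2 * d) * fact (2 * d + 1))) * (br n (- 1) * br (p - 1) e
        / (br (2 * d + 1) (- (1 + e)) * br (d + 1) e * br n (- f) * br (2 * d) (- 1 / 3) * br (d + 1) (1 / 3)))"
    unfolding up pochhammer_down th F B using nz s p_pos
    by (simp add: divide_simps del: fact_Suc) (simp add: power2_eq_square del: fact_Suc)
  also have "(fact n)\<^sup>2 / ((fact (d + 1))\<^sup>2 * fact (2 * d) * fact (2 * d + 1)) = 4 * (2 * D + 1) * C\<^sup>2"
    unfolding C_fact ff using D1 by (simp add: divide_simps) (simp add: power2_eq_square algebra_simps)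
  also have "- (3 / 2) * (4 * (2 * D + 1) * C\<^sup>2) = 2 * (2 - P) * C\<^sup>2"
    unfolding P_D by (simp add: algebra_simps)
  finally show ?thesis .
qed

lemma inverse_shift: "H (2 * d) \<simeq>\<^sub>1 H (2 * d + 1) + 3 / 2" "H (d + 1) \<simeq>\<^sub>1 H n + H (2 * d + 1) + 6"
proof -
  have u: "unit (2 * D + 1)" "unit (D + 1)"
    using unit_of_nat_less[of "2 * d + 1"] unit_of_nat_less[of "d + 1"] small by (simp_all add: add.commute)
  have "2 * D + 1 \<simeq>\<^sub>1 - 2 / 3" by (rule rat_cong_I[of _ _ _ "1 / 3"]) (auto simp: P_D)
  then have i1: "1 / (2 * D + 1) \<simeq>\<^sub>1 1 / (- 2 / 3)" using u by (intro rc_divide) auto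
  have "H (2 * d + 1) = H (2 * d) + 1 / (2 * D + 1)" unfolding H_def by (simp add: add.commute)
  then have "H (2 * d) = H (2 * d + 1) - 1 / (2 * D + 1)" by simp
  also have "\<dots> \<simeq>\<^sub>1 H (2 * d + 1) - 1 / (- 2 / 3)" by (intro rc_diff rc_refl i1)
  finally show "H (2 * d) \<simeq>\<^sub>1 H (2 * d + 1) + 3 / 2" by simp
  have "D + 1 \<simeq>\<^sub>1 1 / 6" by (rule rat_cong_I[of _ _ _ "1 / 6"]) (auto simp: P_D)
  then have i2: "1 / (D + 1) \<simeq>\<^sub>1 1 / (1 / 6)" using u by (intro rc_divide) auto
  have "H (d + 1) = H d + 1 / (D + 1)" unfolding H_def by (simp add: add.commute)
  also have "H d + 1 / (D + 1) \<simeq>\<^sub>1 (H n + H (2 * d + 1)) + 1 / (1 / 6)" by (intro rc_add H_relation i2)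
  finally show "H (d + 1) \<simeq>\<^sub>1 H n + H (2 * d + 1) + 6" by simp
qed

text \<open>The relations between harmonic numbers above leave two of them, \<open>H n\<close> and
\<open>H (2 d + 1)\<close>, modulo \<open>p\<close>.\<close>
lemma bracket_lin:
  assumes e: "e \<in> Zp" and f: "f \<in> Zp"
  obtains l where "lin (br n (- 1) * br (p - 1) e
        / (br (2 * d + 1) (- (1 + e)) * br (d + 1) e * br n (- f) * br (2 * d) (- 1 / 3) * br (d + 1) (1 / 3))) 1 l"
    and "l \<simeq>\<^sub>1 (f - e - 4 / 3) * H n + H (2 * d + 1) - 6 * e - 3 / 2"
proof
  let ?l = "- H n + (1 + e) * H (2 * d + 1) - e * H (d + 1) + f * H n + H (2 * d) / 3 - H (d + 1) / 3"
  let ?k = "- H2 n / 2 + (1 + e)\<^sup>2 / 2 * H2 (2 * d + 1) + e\<^sup>2 / 2 * H2 (d + 1) + f\<^sup>2 / 2 * H2 n + H2 (2 * d) / 18 + H2 (d + 1) / 18"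
  have z: "H n \<in> Zp" "H (2 * d + 1) \<in> Zp" "H (d + 1) \<in> Zp" "H (2 * d) \<in> Zp"
     "H2 n \<in> Zp" "H2 (2 * d + 1) \<in> Zp" "H2 (d + 1) \<in> Zp" "H2 (2 * d) \<in> Zp"
    using small n_less by (auto intro: H_Zp H2_Zp)
  show "lin (br n (- 1) * br (p - 1) e
        / (br (2 * d + 1) (- (1 + e)) * br (d + 1) e * br n (- f) * br (2 * d) (- 1 / 3) * br (d + 1) (1 / 3))) 1 ?l"
  proof (rule lin_logc[where k = ?k])
    have "logc (br n (- 1) * br (p - 1) e
        / (br (2 * d + 1) (- (1 + e)) * br (d + 1) e * br n (- f) * br (2 * d) (- 1 / 3) * br (d + 1) (1 / 3)))
       ((lbr n (- 1) + 0) - (lbr (2 * d + 1) (- (1 + e)) + lbr (d + 1) e + lbr n (- f) + lbr (2 * d) (- 1 / 3) + lbr (d + 1) (1 / 3)))"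
      using small n_less e f by (intro logc_mult logc_divide logc_br logc_br_p_minus_1) auto
    also have "(lbr n (- 1) + 0) - (lbr (2 * d + 1) (- (1 + e)) + lbr (d + 1) e + lbr n (- f) + lbr (2 * d) (- 1 / 3) + lbr (d + 1) (1 / 3))
      = P * ?l + P\<^sup>2 * ?k"
      unfolding lbr_def by (simp add: field_simps power2_eq_square)
    finally show "logc (br n (- 1) * br (p - 1) e
        / (br (2 * d + 1) (- (1 + e)) * br (d + 1) e * br n (- f) * br (2 * d) (- 1 / 3) * br (d + 1) (1 / 3))) (P * ?l + P\<^sup>2 * ?k)" .
  qed (use z e f in auto)
  have "?l = (f - 1) * H n + (1 + e) * H (2 * d + 1) + 1 / 3 * H (2 * d) + (- e - 1 / 3) * H (d + 1)"
    by (simp add: field_simps)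
  also have "\<dots> \<simeq>\<^sub>1 (f - 1) * H n + (1 + e) * H (2 * d + 1) + 1 / 3 * (H (2 * d + 1) + 3 / 2) + (- e - 1 / 3) * (H n + H (2 * d + 1) + 6)"
    using e by (intro rc_add rc_refl rc_mult_left inverse_shift) auto
  also have "\<dots> = (f - e - 4 / 3) * H n + H (2 * d + 1) - 6 * e - 3 / 2"
    by (simp add: field_simps)
  finally show "?l \<simeq>\<^sub>1 (f - e - 4 / 3) * H n + H (2 * d + 1) - 6 * e - 3 / 2" .
qed

definition R_factor :: rat where "R_factor = 1 + 2 * P + 4 / 3 * (2 ^ (p - 1) - 1) - 3 / 2 * (3 ^ (p - 1) - 1)"

lemma R3_eq: "R3 p = R_factor * C\<^sup>2"
proof -
  have "p div 6 = d" using p65 by simp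
  then show ?thesis unfolding R3_def R_factor_def C_def n_def by simp
qed

text \<open>The Fermat quotients of 2 and 3 are \<open>- H n / 2\<close> and \<open>- 2 / 3 * H (2 d + 1)\<close> modulo \<open>p\<close>.\<close>
lemma R_factor_lin: "lin R_factor 1 (2 - 2 / 3 * H n + H (2 * d + 1))"
proof -
  have z: "H n \<in> Zp" "H (2 * d + 1) \<in> Zp" "H2 n \<in> Zp" "H2 (2 * d + 1) \<in> Zp"
    using small n_less by (auto intro: H_Zp H2_Zp)
  have "lin (2 ^ (p - 1)) 1 (- 1 / 2 * H n)"
  proof (rule lin_logc)
    have "logc (2 ^ (p - 1)) (lbr n (- 1) - lbr n (- 1 / 2))"
      unfolding two_power using n_less by (intro logc_divide logc_br) auto
    also have "lbr n (- 1) - lbr n (- 1 / 2) = P * (- 1 / 2 * H n) + P\<^sup>2 * (- 3 / 8 * H2 n)"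
      unfolding lbr_def by (simp add: field_simps power2_eq_square)
    finally show "logc (2 ^ (p - 1)) (P * (- 1 / 2 * H n) + P\<^sup>2 * (- 3 / 8 * H2 n))" .
  qed (use z in auto)
  moreover have "lin (3 ^ (p - 1)) 1 (- 2 / 3 * H (2 * d + 1))"
  proof (rule lin_logc)
    have "logc (3 ^ (p - 1)) (lbr (2 * d + 1) (- 2 / 3) - 0)"
      unfolding three_power using small by (intro logc_divide logc_br logc_br_p_minus_1) auto
    also have "lbr (2 * d + 1) (- 2 / 3) - 0 = P * (- 2 / 3 * H (2 * d + 1)) + P\<^sup>2 * (- 2 / 9 * H2 (2 * d + 1))"
      unfolding lbr_def by (simp add: field_simps power2_eq_square)
    finally show "logc (3 ^ (p - 1)) (P * (- 2 / 3 * H (2 * d + 1)) + P\<^sup>2 * (- 2 / 9 * H2 (2 * d + 1)))" .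
  qed (use z in auto)
  ultimately have "lin ((7 / 6 + 2 * P) + (4 / 3 * 2 ^ (p - 1) + (- 3 / 2) * 3 ^ (p - 1)))
     (7 / 6 + (4 / 3 * 1 + (- 3 / 2) * 1)) (2 + ((4 / 3 * (- 1 / 2 * H n) + 0 * 1) + ((- 3 / 2) * (- 2 / 3 * H (2 * d + 1)) + 0 * 1)))"
    by (intro lin_add lin_mult lin_const lin_linear) auto
  moreover have "(7 / 6 + 2 * P) + (4 / 3 * 2 ^ (p - 1) + (- 3 / 2) * 3 ^ (p - 1)) = R_factor"
    unfolding R_factor_def by (simp add: field_simps)
  ultimately show ?thesis by (simp add: field_simps)
qed

end

section \<open>Primes of the form 6d + 5: the congruences\<close>

context padic_prime_2
begin

lemma central_parameters: "1 / 3 + 1 / 2 = - D + (1 / 6) * P" "1 / 3 + 1 / 2 - P = - D + (- 5 / 6) * P"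
    "2 / 3 + 1 / 2 = D + 2 + (- 1 / 6) * P" "2 / 3 + 1 / 2 - P = D + 2 + (- 7 / 6) * P"
  using P_D by linarith+

lemma unit_3k_1:
  assumes "k < p" "k \<noteq> 4 * d + 3"
  shows "unit (3 * of_nat k + 1)"
proof -
  have "3 * k + 1 \<noteq> p" by (simp only: p65) presburger
  then show ?thesis
    unfolding of_nat_3k using assms p65 by (intro unit_of_nat_less_3p) linarith+
qed

lemma unit_3k_2:
  assumes "k < p" "k \<noteq> 2 * d + 1"
  shows "unit (3 * of_nat k + 2)"
proof -
  have "3 * k + 2 \<noteq> 2 * p" by (simp only: p65) presburger
  then show ?thesis
    unfolding of_nat_3k using assms p65 by (intro unit_of_nat_less_3p) linarith+
qed

text \<open>No denominator \<open>3 k + 1\<close> with \<open>k \<le> n\<close> is divisible by \<open>p\<close>, while the numerator of the product runs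
through a multiple of \<open>p\<close>; together with the factor in front this gives \<open>p\<^sup>2\<close>.\<close>
lemma vanishing_product:
  assumes e: "e \<in> Zp" and f: "f \<in> Zp"
  shows "P * (fact n * pochhammer (- D + e * P) n / (pochhammer (- h + f * P) n * pochhammer (4 / 3) n)) \<simeq>\<^sub>2 0"
proof -
  have nd: "n = d + Suc (2 * d + 1)" using n_eq by simp
  have th: "pochhammer (- D + e * P) n = P * ((- 1) ^ d * fact d * br d (- e) * e * (fact (2 * d + 1) * br (2 * d + 1) e))"
    unfolding nd pochhammer_through_P by (simp only: mult_ac)
  have up: "pochhammer (4 / 3) n = fact (5 * d + 4) * br (5 * d + 4) (- 1 / 3) / (fact (2 * d + 2) * br (2 * d + 2) (- 1 / 3))"
  proof -
    have a: "4 / 3 = of_nat (2 * d + 2) + 1 + (- 1 / 3) * P" unfolding P_D by (simp add: field_simps)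
    have "2 * d + 2 + n = 5 * d + 4" using n_eq by simp
    moreover have "- 1 / 3 \<in> Zp" by auto
    ultimately show ?thesis unfolding a using pochhammer_up[of "2 * d + 2" n "- 1 / 3"] small by (simp only:)
  qed
  have u: "unit (pochhammer (4 / 3) n)" unfolding up using small by (intro unit_divide unit_mult unit_fact br_unit) auto
  have u2: "unit (pochhammer (- h + f * P) n)" unfolding pochhammer_down using n_less f by (auto intro!: unit_fact br_unit)
  have z: "br d (- e) \<in> Zp" "br (2 * d + 1) e \<in> Zp" using small e by (auto intro!: unit_Zp[OF br_unit])
  have zf: "fact k \<in> Zp" for k using Zp_of_nat[of "fact k"] by simp
  have e: "P * (fact n * pochhammer (- D + e * P) n / (pochhammer (- h + f * P) n * pochhammer (4 / 3) n))
    = P ^ 2 * (fact n * ((- 1) ^ d * fact d * br d (- e) * e * (fact (2 * d + 1) * br (2 * d + 1) e))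
        / (pochhammer (- h + f * P) n * pochhammer (4 / 3) n))"
    unfolding th by (simp add: power2_eq_square)
  show ?thesis unfolding e
    by (rule rc0_P) (intro Zp_divide Zp_mult Zp_power Zp_uminus Zp_1 unit_mult u u2 z zf assms)
qed

text \<open>Modulo \<open>p\<^sup>2\<close> even the term of the tail with denominator \<open>2 p\<close> is negligible.\<close>
lemma tail_zero_2:
  assumes "n < k" "k < p" "unit d' \<or> d' = 2 * P"
  shows "P * (T (- P) k / d') \<simeq>\<^sub>2 0"
  using assms(3)
proof
  assume u: "unit d'"
  show ?thesis by (rule rc_le[OF tail_zero[OF assms(1,2) u]]) simp
next
  assume d: "d' = 2 * P"
  obtain u where u: "T (- P) k = P\<^sup>2 * u" "u \<in> Zp" using tail_Zp assms by blast
  have e: "P * (T (- P) k / d') = P ^ 2 * (u / 2)" unfolding u d by (simp add: power2_eq_square)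
  show ?thesis unfolding e by (rule rc0_P) (use u in auto)
qed

lemma first_sum_4: "P * (\<Sum>k<p. T P k / (3 * of_nat k + 1)) \<simeq>\<^sub>2 0"
proof -
  have "P * (\<Sum>k\<le>n. v4 k * rho4 k / (3 * of_nat k + 1)) \<simeq>\<^sub>3 (P * (\<Sum>k\<le>n. v4 k / (3 * of_nat k + 1))) * 1"
  proof (rule weighted_sum_cong)
    fix k assume "k \<le> n"
    then have k: "k < p" "k \<noteq> 4 * d + 3" using n_less n_eq by auto
    then show "v4 k \<in> Zp" "rho4 k \<simeq>\<^sub>2 1" by (auto intro: v4_Zp rho4_cong2)
    show "unit (3 * of_nat k + 1) \<or> rho4 k = 1" using unit_3k_1[OF k] by auto
  qed auto
  then have "P * (\<Sum>k<p. T P k / (3 * of_nat k + 1)) \<simeq>\<^sub>2 P * (\<Sum>k\<le>n. v4 k / (3 * of_nat k + 1))"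
    unfolding sum_T_4 mult_1_right by (rule rc_le) simp
  moreover have "P * (\<Sum>k\<le>n. v4 k / (3 * of_nat k + 1)) \<simeq>\<^sub>2 0"
  proof -
    have s: "(\<Sum>k\<le>n. v4 k / (3 * of_nat k + 1)) = fact n * pochhammer (- D + (1 / 6) * P) n
       / (pochhammer (- h + (1 / 2) * P) n * pochhammer (4 / 3) n)"
      using central_sum_v4[of 1] unfolding half_parameters central_parameters by simp
    show ?thesis unfolding s by (rule vanishing_product) auto
  qed
  ultimately show ?thesis by (rule rc_trans)
qed

lemma first_sum_16: "P * (\<Sum>k<p. T (- P) k / (3 * of_nat k + 1)) \<simeq>\<^sub>2 0"
proof -
  have "P * (\<Sum>k\<le>n. v16 k * rho16 k / (3 * of_nat k + 1)) \<simeq>\<^sub>3 (P * (\<Sum>k\<le>n. v16 k / (3 * of_nat k + 1))) * 1"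
  proof (rule weighted_sum_cong)
    fix k assume "k \<le> n"
    then have k: "k < p" "k \<noteq> 4 * d + 3" using n_less n_eq by auto
    then show "v16 k \<in> Zp" "rho16 k \<simeq>\<^sub>2 1" by (auto intro: v16_Zp rho16_cong2)
    show "unit (3 * of_nat k + 1) \<or> rho16 k = 1" using unit_3k_1[OF k] by auto
  qed auto
  then have 1: "P * (\<Sum>k\<le>n. v16 k * rho16 k / (3 * of_nat k + 1)) \<simeq>\<^sub>2 P * (\<Sum>k\<le>n. v16 k / (3 * of_nat k + 1))"
    unfolding mult_1_right by (rule rc_le) simp
  have 2: "P * (\<Sum>k\<le>n. v16 k / (3 * of_nat k + 1)) \<simeq>\<^sub>2 0"
  proof -
    have s: "(\<Sum>k\<le>n. v16 k / (3 * of_nat k + 1)) = fact n * pochhammer (- D + (- 5 / 6) * P) n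
       / (pochhammer (- h + (- 1 / 2) * P) n * pochhammer (4 / 3) n)"
      using central_sum_v16[OF zero_less_one] unfolding half_parameters central_parameters(2) mult_1_left by simp
    show ?thesis unfolding s by (rule vanishing_product) auto
  qed
  have 3: "(\<Sum>k\<in>{n<..<p}. P * (T (- P) k / (3 * of_nat k + 1))) \<simeq>\<^sub>2 (\<Sum>k\<in>{n<..<p}. 0)"
  proof (rule rc_sum)
    fix k assume "k \<in> {n<..<p}"
    then have k: "n < k" "k < p" by auto
    show "P * (T (- P) k / (3 * of_nat k + 1)) \<simeq>\<^sub>2 0"
    proof (rule tail_zero_2[OF k])
      have "3 * of_nat (4 * d + 3) + 1 = 2 * P" unfolding P_D by simp
      then show "unit (3 * of_nat k + 1) \<or> 3 * of_nat k + 1 = 2 * P" using unit_3k_1[OF k(2)] by blast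
    qed
  qed
  have "P * (\<Sum>k<p. T (- P) k / (3 * of_nat k + 1)) \<simeq>\<^sub>2 0 + (\<Sum>k\<in>{n<..<p}. 0)"
    unfolding sum_T_16 distrib_left sum_distrib_left[of P _ "{n<..<p}"]
    by (intro rc_add 3 rc_trans[OF 1 2])
  then show ?thesis by simp
qed

definition brs :: "rat \<Rightarrow> rat \<Rightarrow> rat" where
  "brs e f = br n (- 1) * br (p - 1) e
     / (br (2 * d + 1) (- (1 + e)) * br (d + 1) e * br n (- f) * br (2 * d) (- 1 / 3) * br (d + 1) (1 / 3))"

lemma brs_Zp: "e \<in> Zp \<Longrightarrow> f \<in> Zp \<Longrightarrow> brs e f \<in> Zp"
  unfolding brs_def by (rule unit_Zp, intro unit_divide unit_mult br_unit) (use small n_less p_pos in auto)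

text \<open>Modulo \<open>p\<^sup>2\<close> the correction factor at the critical index can be replaced by 1.\<close>
lemma drop_weight:
  assumes "Q \<simeq>\<^sub>3 2 * (2 - P) * C\<^sup>2 * brs e f * w" "w \<simeq>\<^sub>2 1" "e \<in> Zp" "f \<in> Zp"
  shows "Q \<simeq>\<^sub>2 C\<^sup>2 * ((4 + (- 2) * P) * brs e f)"
proof -
  have "Q \<simeq>\<^sub>2 2 * (2 - P) * C\<^sup>2 * brs e f * w" using assms(1) by (rule rc_le) simp
  also have "\<dots> \<simeq>\<^sub>2 2 * (2 - P) * C\<^sup>2 * brs e f * 1"
    using C_Zp brs_Zp[OF assms(3,4)] by (intro rc_mult_left assms(2)) auto
  also have "\<dots> = C\<^sup>2 * ((4 + (- 2) * P) * brs e f)" by (simp add: algebra_simps)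
  finally show ?thesis .
qed

text \<open>In contrast to the case \<open>p = 6 m + 1\<close> the critical index now belongs to the denominators
\<open>3 k + 2\<close>, so these sums carry the main term.\<close>
lemma second_sum_4: "P * (\<Sum>k<p. T P k / (3 * of_nat k + 2)) \<simeq>\<^sub>2 C\<^sup>2 * ((4 + (- 2) * P) * brs (- 1 / 6) (1 / 2))"
proof (rule drop_weight)
  have s: "(\<Sum>k\<le>n. v4 k / (3 * of_nat k + 2)) = fact n * pochhammer (D + 2 + (- 1 / 6) * P) n
       / (pochhammer (- h + (1 / 2) * P) n * (2 * pochhammer (5 / 3) n))"
    using central_sum_v4[of 2] unfolding half_parameters central_parameters by simp
  have "P * (\<Sum>k<p. T P k / (3 * of_nat k + 2)) = P * (\<Sum>k\<le>n. v4 k * rho4 k / (3 * of_nat k + 2))"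
    unfolding sum_T_4 ..
  also have "\<dots> \<simeq>\<^sub>3 (P * (\<Sum>k\<le>n. v4 k / (3 * of_nat k + 2))) * rho4 (2 * d + 1)"
  proof (rule weighted_sum_cong)
    fix k assume "k \<le> n"
    then have k: "k < p" using n_less by simp
    then show "v4 k \<in> Zp" "rho4 k \<simeq>\<^sub>2 1" by (auto intro: v4_Zp rho4_cong2)
    show "unit (3 * of_nat k + 2) \<or> rho4 k = rho4 (2 * d + 1)" using unit_3k_2[OF k] by auto
  qed (rule rho4_cong2[OF small(4)])
  also have "P * (\<Sum>k\<le>n. v4 k / (3 * of_nat k + 2)) = 2 * (2 - P) * C\<^sup>2 * brs (- 1 / 6) (1 / 2)"
    unfolding s brs_def by (rule central_product) auto
  finally show "P * (\<Sum>k<p. T P k / (3 * of_nat k + 2)) \<simeq>\<^sub>3 2 * (2 - P) * C\<^sup>2 * brs (- 1 / 6) (1 / 2) * rho4 (2 * d + 1)" .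
qed (rule rho4_cong2[OF small(4)], auto)

lemma second_sum_16: "P * (\<Sum>k<p. T (- P) k / (3 * of_nat k + 2)) \<simeq>\<^sub>2 C\<^sup>2 * ((4 + (- 2) * P) * brs (- 7 / 6) (- 1 / 2))"
proof (rule drop_weight)
  have s: "(\<Sum>k\<le>n. v16 k / (3 * of_nat k + 2)) = fact n * pochhammer (D + 2 + (- 7 / 6) * P) n
       / (pochhammer (- h + (- 1 / 2) * P) n * (2 * pochhammer (5 / 3) n))"
    using central_sum_v16[of 2] unfolding half_parameters central_parameters by simp
  have "P * (\<Sum>k<p. T (- P) k / (3 * of_nat k + 2)) = P * (\<Sum>k\<le>n. v16 k * rho16 k / (3 * of_nat k + 2))
      + (\<Sum>k\<in>{n<..<p}. P * (T (- P) k / (3 * of_nat k + 2)))"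
    unfolding sum_T_16 distrib_left sum_distrib_left ..
  also have "\<dots> \<simeq>\<^sub>3 (P * (\<Sum>k\<le>n. v16 k / (3 * of_nat k + 2))) * rho16 (2 * d + 1) + (\<Sum>k\<in>{n<..<p}. 0)"
  proof (intro rc_add rc_sum weighted_sum_cong)
    fix k assume "k \<le> n"
    then have k: "k < p" using n_less by simp
    then show "v16 k \<in> Zp" "rho16 k \<simeq>\<^sub>2 1" by (auto intro: v16_Zp rho16_cong2)
    show "unit (3 * of_nat k + 2) \<or> rho16 k = rho16 (2 * d + 1)" using unit_3k_2[OF k] by auto
  next
    fix k assume "k \<in> {n<..<p}"
    then show "P * (T (- P) k / (3 * of_nat k + 2)) \<simeq>\<^sub>3 0"
      using n_eq by (intro tail_zero unit_3k_2) auto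
  qed (rule rho16_cong2[OF small(4)])
  also have "P * (\<Sum>k\<le>n. v16 k / (3 * of_nat k + 2)) = 2 * (2 - P) * C\<^sup>2 * brs (- 7 / 6) (- 1 / 2)"
    unfolding s brs_def by (rule central_product) auto
  finally show "P * (\<Sum>k<p. T (- P) k / (3 * of_nat k + 2)) \<simeq>\<^sub>3 2 * (2 - P) * C\<^sup>2 * brs (- 7 / 6) (- 1 / 2) * rho16 (2 * d + 1)"
    by simp
qed (rule rho16_cong2[OF small(4)], auto)

lemma R_factor_scaled: "lin (c * R_factor) (c * 1) (c * (2 - 2 / 3 * H n + H (2 * d + 1)) + 0 * 1)" if "c \<in> Zp"
  using that by (intro lin_mult lin_const R_factor_lin)

lemma brs_scaled:
  assumes c: "c \<in> Zp"
  assumes l: "lin (brs e f) 1 l"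
  shows "lin ((c + 1 * P) * ((4 + (- 2) * P) * brs e f)) (c * (4 * 1)) (c * (4 * l + (- 2) * 1) + 1 * (4 * 1))"
  by (intro lin_mult lin_linear l c) auto

text \<open>The bracket and \<open>R_factor\<close> have the same harmonic part; the factors \<open>1 / 3 + p\<close> and \<open>4 - 2 p\<close>
adjust the rational part of the linear coefficient.\<close>
lemma weight_times_sum_4: "(1 / 3 + 1 * P) * ((4 + (- 2) * P) * brs (- 1 / 6) (1 / 2)) \<simeq>\<^sub>2 4 / 3 * R_factor"
proof -
  have "- 1 / 6 \<in> Zp" "1 / 2 \<in> Zp" by auto
  from bracket_lin[OF this, folded brs_def] obtain l where l: "lin (brs (- 1 / 6) (1 / 2)) 1 l"
    "l \<simeq>\<^sub>1 (1 / 2 - - 1 / 6 - 4 / 3) * H n + H (2 * d + 1) - 6 * (- 1 / 6) - 3 / 2" by blast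
  have "4 / 3 * l + 10 / 3 \<simeq>\<^sub>1 4 / 3 * ((1 / 2 - - 1 / 6 - 4 / 3) * H n + H (2 * d + 1) - 6 * (- 1 / 6) - 3 / 2) + 10 / 3"
    by (intro rc_add rc_refl rc_mult_left l(2)) auto
  also have "4 / 3 * ((1 / 2 - - 1 / 6 - 4 / 3) * H n + H (2 * d + 1) - 6 * (- 1 / 6) - 3 / 2) + 10 / 3
     = 4 / 3 * (2 - 2 / 3 * H n + H (2 * d + 1)) + 0 * 1" by (simp add: field_simps)
  also have "4 / 3 * l + 10 / 3 = 1 / 3 * (4 * l + (- 2) * 1) + 1 * (4 * 1)" by (simp add: field_simps)
  finally have "1 / 3 * (4 * l + (- 2) * 1) + 1 * (4 * 1) \<simeq>\<^sub>1 4 / 3 * (2 - 2 / 3 * H n + H (2 * d + 1)) + 0 * 1" .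
  moreover have "lin ((1 / 3 + 1 * P) * ((4 + (- 2) * P) * brs (- 1 / 6) (1 / 2))) (4 / 3 * 1) (1 / 3 * (4 * l + (- 2) * 1) + 1 * (4 * 1))"
    by (rule lin_coeffs[OF brs_scaled[OF _ l(1)]]) auto
  moreover have "lin (4 / 3 * R_factor) (4 / 3 * 1) (4 / 3 * (2 - 2 / 3 * H n + H (2 * d + 1)) + 0 * 1)"
    by (rule R_factor_scaled) auto
  ultimately show ?thesis using lin_cong by blast
qed

lemma weight_times_sum_16: "(- 1 / 3 + 1 * P) * ((4 + (- 2) * P) * brs (- 7 / 6) (- 1 / 2)) \<simeq>\<^sub>2 - 4 / 3 * R_factor"
proof -
  have "- 7 / 6 \<in> Zp" "- 1 / 2 \<in> Zp" by auto
  from bracket_lin[OF this, folded brs_def] obtain l where l: "lin (brs (- 7 / 6) (- 1 / 2)) 1 l"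
    "l \<simeq>\<^sub>1 (- 1 / 2 - - 7 / 6 - 4 / 3) * H n + H (2 * d + 1) - 6 * (- 7 / 6) - 3 / 2" by blast
  have "- 4 / 3 * l + 14 / 3 \<simeq>\<^sub>1 - 4 / 3 * ((- 1 / 2 - - 7 / 6 - 4 / 3) * H n + H (2 * d + 1) - 6 * (- 7 / 6) - 3 / 2) + 14 / 3"
    by (intro rc_add rc_refl rc_mult_left l(2)) auto
  also have "- 4 / 3 * ((- 1 / 2 - - 7 / 6 - 4 / 3) * H n + H (2 * d + 1) - 6 * (- 7 / 6) - 3 / 2) + 14 / 3
     = - 4 / 3 * (2 - 2 / 3 * H n + H (2 * d + 1)) + 0 * 1" by (simp add: field_simps)
  also have "- 4 / 3 * l + 14 / 3 = - 1 / 3 * (4 * l + (- 2) * 1) + 1 * (4 * 1)" by (simp add: field_simps)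
  finally have "- 1 / 3 * (4 * l + (- 2) * 1) + 1 * (4 * 1) \<simeq>\<^sub>1 - 4 / 3 * (2 - 2 / 3 * H n + H (2 * d + 1)) + 0 * 1" .
  moreover have "lin ((- 1 / 3 + 1 * P) * ((4 + (- 2) * P) * brs (- 7 / 6) (- 1 / 2))) (- 4 / 3 * 1) (- 1 / 3 * (4 * l + (- 2) * 1) + 1 * (4 * 1))"
    by (rule lin_coeffs[OF brs_scaled[OF _ l(1)]]) auto
  moreover have "lin (- 4 / 3 * R_factor) (- 4 / 3 * 1) (- 4 / 3 * (2 - 2 / 3 * H n + H (2 * d + 1)) + 0 * 1)"
    by (rule R_factor_scaled) auto
  ultimately show ?thesis using lin_cong by blast
qed

lemma linear_domb_sum_4: "(\<Sum>k=0..p - 1. of_nat k * (of_nat (domb k) / 4 ^ k)) \<simeq>\<^sub>2 4 / 3 * R3 p"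
proof -
  have "(\<Sum>k=0..p - 1. of_nat k * (of_nat (domb k) / 4 ^ k))
     = - 2 / 3 * (P * (\<Sum>k<p. T P k / (3 * of_nat k + 1))) + (1 / 3 + P) * (P * (\<Sum>k<p. T P k / (3 * of_nat k + 2)))"
    by (rule domb_sums_4(2))
  also have "\<dots> \<simeq>\<^sub>2 - 2 / 3 * 0 + (1 / 3 + P) * (C\<^sup>2 * ((4 + (- 2) * P) * brs (- 1 / 6) (1 / 2)))"
    by (intro rc_add rc_mult_left first_sum_4 second_sum_4) auto
  also have "\<dots> = C\<^sup>2 * ((1 / 3 + 1 * P) * ((4 + (- 2) * P) * brs (- 1 / 6) (1 / 2)))"
    by (simp only: mult_zero_right add_0_left mult_1_left mult.left_commute)
  also have "\<dots> \<simeq>\<^sub>2 C\<^sup>2 * (4 / 3 * R_factor)"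
    using C_Zp by (intro rc_mult_left weight_times_sum_4) auto
  also have "\<dots> = 4 / 3 * R3 p" unfolding R3_eq by (simp only: mult_ac)
  finally show ?thesis .
qed

lemma linear_domb_sum_16: "(\<Sum>k=0..p - 1. of_nat k * (of_nat (domb k) / 16 ^ k)) \<simeq>\<^sub>2 - 4 / 3 * R3 p"
proof -
  have "(\<Sum>k=0..p - 1. of_nat k * (of_nat (domb k) / 16 ^ k))
     = - 1 / 3 * (P * (\<Sum>k<p. T (- P) k / (3 * of_nat k + 1))) + (P - 1 / 3) * (P * (\<Sum>k<p. T (- P) k / (3 * of_nat k + 2)))"
    by (rule domb_sums_16(2))
  also have "\<dots> \<simeq>\<^sub>2 - 1 / 3 * 0 + (P - 1 / 3) * (C\<^sup>2 * ((4 + (- 2) * P) * brs (- 7 / 6) (- 1 / 2)))"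
    by (intro rc_add rc_mult_left first_sum_16 second_sum_16) auto
  also have "P - 1 / 3 = - 1 / 3 + 1 * P" by simp
  also have "- 1 / 3 * 0 + (- 1 / 3 + 1 * P) * (C\<^sup>2 * ((4 + (- 2) * P) * brs (- 7 / 6) (- 1 / 2)))
     = C\<^sup>2 * ((- 1 / 3 + 1 * P) * ((4 + (- 2) * P) * brs (- 7 / 6) (- 1 / 2)))"
    by (simp only: mult_zero_right add_0_left mult.left_commute)
  also have "\<dots> \<simeq>\<^sub>2 C\<^sup>2 * (- 4 / 3 * R_factor)"
    using C_Zp by (intro rc_mult_left weight_times_sum_16) auto
  also have "\<dots> = - 4 / 3 * R3 p" unfolding R3_eq by (simp only: mult_ac)
  finally show ?thesis .
qed

lemma R3_Zp: "R3 p \<in> Zp"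
  unfolding R3_eq using C_Zp lin_Zp[OF R_factor_lin] by auto

theorem domb_sums_mod_p2:
  shows "(\<Sum>k=0..p - 1. of_nat k ^ 2 * (of_nat (domb k) / 4 ^ k)) \<simeq>\<^sub>2 - (20 / 9) * R3 p"
    and "(\<Sum>k=0..p - 1. of_nat k ^ 2 * (of_nat (domb k) / 16 ^ k)) \<simeq>\<^sub>2 4 / 9 * R3 p"
    and "(\<Sum>k=0..p - 1. of_nat k * (of_nat (domb k) / 4 ^ k))
      \<simeq>\<^sub>2 - (\<Sum>k=0..p - 1. of_nat k * (of_nat (domb k) / 16 ^ k))"
    and "- (\<Sum>k=0..p - 1. of_nat k * (of_nat (domb k) / 16 ^ k)) \<simeq>\<^sub>2 4 / 3 * R3 p"
proof -
  let ?S = "\<lambda>c. \<Sum>k=0..p - 1. of_nat k * (of_nat (domb k) / c ^ k) :: rat"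
  show m: "- ?S 16 \<simeq>\<^sub>2 4 / 3 * R3 p"
    using rc_minus[OF linear_domb_sum_16] by simp
  show "?S 4 \<simeq>\<^sub>2 - ?S 16" by (rule rc_trans[OF linear_domb_sum_4 rc_sym[OF m]])
  have s0: "(\<Sum>k=0..p - 1. of_nat (domb k) / 4 ^ k) \<simeq>\<^sub>2 0"
    unfolding domb_sums_4(1) by (rule first_sum_4)
  have "(\<Sum>k=0..p - 1. of_nat k ^ 2 * (of_nat (domb k) / 4 ^ k))
     \<simeq>\<^sub>2 - (5 * ?S 4 + 2 * (\<Sum>k=0..p - 1. of_nat (domb k) / 4 ^ k)) / 3"
    using square_sum_4 by (rule rc_le) simp
  also have "- (5 * ?S 4 + 2 * (\<Sum>k=0..p - 1. of_nat (domb k) / 4 ^ k)) / 3 \<simeq>\<^sub>2 - (5 * (4 / 3 * R3 p) + 2 * 0) / 3"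
    using R3_Zp by (intro rc_divide rc_minus rc_add rc_mult_left s0 linear_domb_sum_4 rc_refl) auto
  also have "- (5 * (4 / 3 * R3 p) + 2 * 0) / 3 = - (20 / 9) * R3 p" by simp
  finally show "(\<Sum>k=0..p - 1. of_nat k ^ 2 * (of_nat (domb k) / 4 ^ k)) \<simeq>\<^sub>2 - (20 / 9) * R3 p" .
  have "(\<Sum>k=0..p - 1. of_nat k ^ 2 * (of_nat (domb k) / 16 ^ k)) \<simeq>\<^sub>2 - ?S 16 / 3"
    using square_sum_16 by (rule rc_le) simp
  also have "- ?S 16 / 3 \<simeq>\<^sub>2 (4 / 3 * R3 p) / 3"
    using R3_Zp by (intro rc_divide m rc_refl) auto
  also have "(4 / 3 * R3 p) / 3 = 4 / 9 * R3 p" by simp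
  finally show "(\<Sum>k=0..p - 1. of_nat k ^ 2 * (of_nat (domb k) / 16 ^ k)) \<simeq>\<^sub>2 4 / 9 * R3 p" .
qed

end

section \<open>The main congruences\<close>

theorem theorem1p3:
  fixes p :: nat
  assumes "prime p" and "p > 3"
  shows
    "(\<forall>x y :: int. [p = 1] (mod 3) \<and> int p = x\<^sup>2 + 3 * y\<^sup>2 \<longrightarrow>
        rat_cong p 3 (\<Sum>k = 0..p - 1. of_nat k ^ 2 * (of_nat (domb k) / 4 ^ k))
          (16 / 9 * (of_int x)\<^sup>2 - 8 * of_nat p / 9 - 7 * (of_nat p)\<^sup>2 / (18 * (of_int x)\<^sup>2)) \<and>
        rat_cong p 3 (\<Sum>k = 0..p - 1. of_nat k ^ 2 * (of_nat (domb k) / 16 ^ k))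
          (4 / 9 * (of_int x)\<^sup>2 - 2 * of_nat p / 9 - (of_nat p)\<^sup>2 / (18 * (of_int x)\<^sup>2)))
     \<and>
     ([p = 2] (mod 3) \<longrightarrow>
        rat_cong p 2 (\<Sum>k = 0..p - 1. of_nat k ^ 2 * (of_nat (domb k) / 4 ^ k))
          (- (20 / 9) * R3 p) \<and>
        rat_cong p 2 (\<Sum>k = 0..p - 1. of_nat k ^ 2 * (of_nat (domb k) / 16 ^ k))
          (4 / 9 * R3 p) \<and>
        rat_cong p 2 (\<Sum>k = 0..p - 1. of_nat k * (of_nat (domb k) / 4 ^ k))
          (- (\<Sum>k = 0..p - 1. of_nat k * (of_nat (domb k) / 16 ^ k))) \<and>
        rat_cong p 2 (- (\<Sum>k = 0..p - 1. of_nat k * (of_nat (domb k) / 16 ^ k)))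
          (4 / 3 * R3 p))"
proof (rule conjI; (intro allI impI)?)
  have odd: "odd p" using assms prime_odd_nat by force
  show "rat_cong p 3 (\<Sum>k = 0..p - 1. of_nat k ^ 2 * (of_nat (domb k) / 4 ^ k))
          (16 / 9 * (of_int x)\<^sup>2 - 8 * of_nat p / 9 - 7 * (of_nat p)\<^sup>2 / (18 * (of_int x)\<^sup>2)) \<and>
        rat_cong p 3 (\<Sum>k = 0..p - 1. of_nat k ^ 2 * (of_nat (domb k) / 16 ^ k))
          (4 / 9 * (of_int x)\<^sup>2 - 2 * of_nat p / 9 - (of_nat p)\<^sup>2 / (18 * (of_int x)\<^sup>2))"
    if xy: "[p = 1] (mod 3) \<and> int p = x\<^sup>2 + 3 * y\<^sup>2" for x y :: int
  proof -
    have "p mod 3 = 1" using xy by (simp add: cong_def)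
    then have "p = 6 * (p div 6) + 1" using odd by presburger
    then have "padic_prime_1 p (p div 6)" using assms by unfold_locales
    from padic_prime_1.domb_square_sums_mod_p3[OF this conjunct2[OF xy]] show ?thesis by blast
  qed
  show "rat_cong p 2 (\<Sum>k = 0..p - 1. of_nat k ^ 2 * (of_nat (domb k) / 4 ^ k))
          (- (20 / 9) * R3 p) \<and>
        rat_cong p 2 (\<Sum>k = 0..p - 1. of_nat k ^ 2 * (of_nat (domb k) / 16 ^ k))
          (4 / 9 * R3 p) \<and>
        rat_cong p 2 (\<Sum>k = 0..p - 1. of_nat k * (of_nat (domb k) / 4 ^ k))
          (- (\<Sum>k = 0..p - 1. of_nat k * (of_nat (domb k) / 16 ^ k))) \<and>
        rat_cong p 2 (- (\<Sum>k = 0..p - 1. of_nat k * (of_nat (domb k) / 16 ^ k)))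
          (4 / 3 * R3 p)"
    if "[p = 2] (mod 3)"
  proof -
    have "p mod 3 = 2" using that by (simp add: cong_def)
    then have "p = 6 * (p div 6) + 5" using odd by presburger
    then have "padic_prime_2 p (p div 6)" using assms by unfold_locales
    from padic_prime_2.domb_sums_mod_p2[OF this] show ?thesis by blast
  qed
qed

end
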